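(* Let $\mathbb{G}$ be a stratified Lie group of homogeneous dimension $Q$, let $0<\beta<1$, $b\in L^1_{\rm loc}(\mathbb{G})$, let $\Phi,\Psi$ be Young functions, and assume $\Phi\in\mathcal{Y}$. 1. If $\Phi\in\nabla_2$ and there is a constant $C>0$ such that $t^{-\beta/Q}\,\Phi^{-1}(t)\le C\,\Psi^{-1}(t)$ for all $t>0$, then the condition $b\in\dot{\Lambda}_{\beta}(\mathbb{G})$ is sufficient for the boundedness of the maximal commutator $M_b$ from $L^{\Phi}(\mathbb{G})$ to $L^{\Psi}(\mathbb{G})$. 2. If there is a constant $C>0$ such that $\Psi^{-1}(t)\le C\,\Phi^{-1}(t)\,t^{-\beta/Q}$ for all $t>0$, then the condition $b\in\dot{\Lambda}_{\beta}(\mathbb{G})$ is necessary for the boundedness of $M_b$ from $L^{\Phi}(\mathbb{G})$ to $L^{\Psi}(\mathbb{G})$. 3. If $\Phi\in\nabla_2$ and $\Psi^{-1}(t)\approx\Phi^{-1}(t)\,t^{-\beta/Q}$ (i.e. each side is bounded by a constant times the other, with constants independent of $t>0$), then the condition $b\in\dot{\Lambda}_{\beta}(\mathbb{G})$ is necessary and sufficient for the boundedness of $M_b$ from $L^{\Phi}(\mathbb{G})$ to $L^{\Psi}(\mathbb{G})$.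
   Context: **Stratified group.** $\mathbb{G}$ is the simply connected Lie group of a finite-dimensional real nilpotent Lie algebra $\mathcal{G}=V_1\oplus\cdots\oplus V_m$ with $[V_1,V_j]=V_{j+1}$ for $1\le j<m$ and $[V_1,V_m]=0$. The exponential map is a global diffeomorphism; dilations are $\delta_r(\exp\sum_j v_j)=\exp(\sum_j r^j v_j)$, $v_j\in V_j$, $r>0$. The homogeneous dimension is $Q=\sum_{j=1}^m j\dim V_j$. Haar measure $dx$ is the push-forward of Lebesgue measure by $\exp$; $|E|$ is the Haar measure of $E$. Fix a homogeneous norm $\rho:\mathbb{G}\to[0,\infty)$: continuous, $C^\infty$ away from the identity $e$, $\rho(x^{-1})=\rho(x)$, $\rho(\delta_t x)=t\rho(x)$ for $t>0$, $\rho(x)=0$ iff $x=e$, and $\rho(xy)\le c_0(\rho(x)+\rho(y))$ for some $c_0\ge1$. Balls are $B(x,r)=\{y\in\mathbb{G}:\rho(y^{-1}x)<r\}$, and $|B(x,r)|=c_1 r^Q$. **Young functions.** A Young function is a convex, left-continuous $\Phi:[0,\infty)\to[0,\infty]$ with $\lim_{r\to0+}\Phi(r)=\Phi(0)=0$ and $\lim_{r\to\infty}\Phi(r)=\infty$. $\mathcal{Y}$ is the set of Young functions with $0<\Phi(r)<\infty$ for $0<r<\infty$. $\Phi^{-1}(s)=\inf\{r\ge0:\Phi(r)>s\}$. $\Phi\in\nabla_2$ means: there is $C>1$ with $\Phi(r)\le\frac{1}{2C}\Phi(Cr)$ for all $r\ge0$. **Orlicz space.** $L^{\Phi}(\mathbb{G})$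 is the set of $f\in L^1_{\rm loc}(\mathbb{G})$ with $\int_{\mathbb{G}}\Phi(k|f(x)|)dx<\infty$ for some $k>0$, with norm $\|f\|_{L^\Phi(\mathbb{G})}=\inf\{\lambda>0:\int_{\mathbb{G}}\Phi(|f(x)|/\lambda)dx\le1\}$. **Lipschitz space.** $b\in\dot{\Lambda}_\beta(\mathbb{G})$ means there is $C$ with $|b(x)-b(y)|\le C\rho(y^{-1}x)^\beta$ for all $x,y\in\mathbb{G}$. Locally integrable functions are identified when equal almost everywhere, so $b\in\dot\Lambda_\beta$ means $b$ agrees a.e. with such a function. **Maximal commutator.** $M_b f(x)=\sup_{B\ni x}|B|^{-1}\int_B|b(x)-b(y)||f(y)|dy$, the supremum over all balls $B$ containing $x$. **Boundedness.** An operator $T$ is bounded from $L^\Phi(\mathbb{G})$ to $L^\Psi(\mathbb{G})$ if there is $C$ with $\|Tf\|_{L^\Psi(\mathbb{G})}\le C\|f\|_{L^\Phi(\mathbb{G})}$ for all $f\in L^\Phi(\mathbb{G})$. *)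

theory Defs
  imports "HOL-Analysis.Analysis"
begin

fun higher_differentiable_on ::
  "'a::real_normed_vector set \<Rightarrow> ('a \<Rightarrow> 'b::real_normed_vector) \<Rightarrow> nat \<Rightarrow> bool" where
  "higher_differentiable_on S f 0 \<longleftrightarrow> continuous_on S f"
| "higher_differentiable_on S f (Suc n) \<longleftrightarrow>
     (\<forall>x\<in>S. f differentiable (at x)) \<and>
     (\<forall>v. higher_differentiable_on S (\<lambda>x. frechet_derivative f (at x) v) n)"

text \<open>\<open>C\<^sup>\<infinity>\<close> on \<open>S\<close>; meant for open \<open>S\<close> (and finite-dimensional domain), because derivatives are
  full derivatives at the points of \<open>S\<close>.\<close>

definition smooth_on :: "'a::real_normed_vector set \<Rightarrow> ('a \<Rightarrow> 'b::real_normed_vector) \<Rightarrow> bool" where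
  "smooth_on S f \<longleftrightarrow> (\<forall>n. higher_differentiable_on S f n)"


section \<open>Stratified groups\<close>

locale lie_algebra =
  fixes brk :: "'a::euclidean_space \<Rightarrow> 'a \<Rightarrow> 'a"
  assumes bilinear_brk: "bilinear brk"
    and brk_self: "brk x x = 0"
    and jacobi: "brk x (brk y z) + brk y (brk z x) + brk z (brk x y) = 0"

text \<open>Only \<open>V 1, \<dots>, V m\<close> matter. The layer \<open>[V 1, V j]\<close> is the linear span of the brackets.\<close>

locale stratified_lie_algebra = lie_algebra brk
  for brk :: "'a::euclidean_space \<Rightarrow> 'a \<Rightarrow> 'a" +
  fixes V :: "nat \<Rightarrow> 'a set" and m :: nat
  assumes m_pos: "1 \<le> m"
    and subspace_layer: "j \<in> {1..m} \<Longrightarrow> subspace (V j)"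
    and direct_sum: "\<exists>!v. v \<in> Pi\<^sub>E {1..m} V \<and> x = (\<Sum>j=1..m. v j)"
    and brk_layer: "1 \<le> j \<Longrightarrow> j < m \<Longrightarrow> span {brk u v | u v. u \<in> V 1 \<and> v \<in> V j} = V (Suc j)"
    and brk_last: "u \<in> V 1 \<Longrightarrow> v \<in> V m \<Longrightarrow> brk u v = 0"

text \<open>A Lie group whose underlying manifold is a vector space (with identity element 0) has the
  tangent space \<open>'a\<close> at the identity. Its Lie bracket is the commutator at 0 of left-invariant
  vector fields.\<close>

definition left_invariant_field ::
  "('a::euclidean_space \<Rightarrow> 'a \<Rightarrow> 'a) \<Rightarrow> 'a \<Rightarrow> 'a \<Rightarrow> 'a" where
  "left_invariant_field mul u x = frechet_derivative (\<lambda>y. mul x y) (at 0) u"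

definition vector_field_bracket ::
  "('a::euclidean_space \<Rightarrow> 'a) \<Rightarrow> ('a \<Rightarrow> 'a) \<Rightarrow> 'a \<Rightarrow> 'a" where
  "vector_field_bracket X Y x =
     frechet_derivative Y (at x) (X x) - frechet_derivative X (at x) (Y x)"

text \<open>The simply connected Lie group of a stratified Lie algebra, written in exponential
  coordinates: since \<open>exp\<close> is a global diffeomorphism, a group element \<open>exp x\<close> is represented by
  \<open>x\<close>. So \<open>mul\<close> is a smooth group law on the vector space \<open>'a\<close> (which is simply connected),
  its Lie algebra is \<open>(UNIV, brk)\<close>, and its exponential map is the identity, that is,
  \<open>\<lambda>t. t *\<^sub>R v\<close> is the one-parameter subgroup with velocity \<open>v\<close>. Accordingly the identity element
  is 0, the inverse of \<open>x\<close> is \<open>- x\<close>, the topology of the group is that of \<open>'a\<close>, and the Haar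
  measure, the image of Lebesgue measure under \<open>exp\<close>, is \<open>lebesgue\<close>.\<close>

locale stratified_group = stratified_lie_algebra brk V m
  for brk :: "'a::euclidean_space \<Rightarrow> 'a \<Rightarrow> 'a" and V :: "nat \<Rightarrow> 'a set" and m :: nat +
  fixes mul :: "'a \<Rightarrow> 'a \<Rightarrow> 'a"
  assumes group_mul: "Groups.group mul 0 uminus"
    and smooth_mul: "smooth_on UNIV (\<lambda>(x, y). mul x y)"
    and exp_coordinates: "mul (s *\<^sub>R v) (t *\<^sub>R v) = (s + t) *\<^sub>R v"
    and lie_algebra_of_mul:
      "brk u v = vector_field_bracket (left_invariant_field mul u) (left_invariant_field mul v) 0"

definition layer_component :: "(nat \<Rightarrow> 'a::euclidean_space set) \<Rightarrow> nat \<Rightarrow> 'a \<Rightarrow> nat \<Rightarrow> 'a" where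
  "layer_component V m x = (THE v. v \<in> Pi\<^sub>E {1..m} V \<and> x = (\<Sum>j=1..m. v j))"

definition dilation :: "(nat \<Rightarrow> 'a::euclidean_space set) \<Rightarrow> nat \<Rightarrow> real \<Rightarrow> 'a \<Rightarrow> 'a" where
  "dilation V m r x = (\<Sum>j=1..m. r ^ j *\<^sub>R layer_component V m x j)"

definition homogeneous_dimension :: "(nat \<Rightarrow> 'a::euclidean_space set) \<Rightarrow> nat \<Rightarrow> nat" where
  "homogeneous_dimension V m = (\<Sum>j=1..m. j * dim (V j))"

definition homogeneous_norm ::
  "(nat \<Rightarrow> 'a::euclidean_space set) \<Rightarrow> nat \<Rightarrow> ('a \<Rightarrow> 'a \<Rightarrow> 'a) \<Rightarrow> ('a \<Rightarrow> real) \<Rightarrow> bool" where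
  "homogeneous_norm V m mul \<rho> \<longleftrightarrow>
     (\<forall>x. 0 \<le> \<rho> x) \<and>
     continuous_on UNIV \<rho> \<and>
     smooth_on (- {0}) \<rho> \<and>
     (\<forall>x. \<rho> (- x) = \<rho> x) \<and>
     (\<forall>t>0. \<forall>x. \<rho> (dilation V m t x) = t * \<rho> x) \<and>
     (\<forall>x. \<rho> x = 0 \<longleftrightarrow> x = 0) \<and>
     (\<exists>c\<^sub>0\<ge>1. \<forall>x y. \<rho> (mul x y) \<le> c\<^sub>0 * (\<rho> x + \<rho> y))"

definition group_ball ::
  "('a::euclidean_space \<Rightarrow> 'a \<Rightarrow> 'a) \<Rightarrow> ('a \<Rightarrow> real) \<Rightarrow> 'a \<Rightarrow> real \<Rightarrow> 'a set" where
  "group_ball mul \<rho> x r = {y. \<rho> (mul (- y) x) < r}"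


section \<open>Young functions\<close>

text \<open>A function \<open>[0, \<infinity>) \<rightarrow> [0, \<infinity>]\<close> is modelled as \<open>real \<Rightarrow> ennreal\<close>; its values at negative arguments
  are never used.\<close>

definition young_function :: "(real \<Rightarrow> ennreal) \<Rightarrow> bool" where
  "young_function \<Phi> \<longleftrightarrow>
     (\<forall>r\<ge>0. \<forall>s\<ge>0. \<forall>t\<in>{0..1}.
        \<Phi> ((1 - t) * r + t * s) \<le> ennreal (1 - t) * \<Phi> r + ennreal t * \<Phi> s) \<and>
     (\<forall>r>0. continuous (at_left r) \<Phi>) \<and>
     \<Phi> 0 = 0 \<and> (\<Phi> \<longlongrightarrow> 0) (at_right 0) \<and> (\<Phi> \<longlongrightarrow> \<infinity>) at_top"

definition young_class_Y :: "(real \<Rightarrow> ennreal) set" where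
  "young_class_Y = {\<Phi>. young_function \<Phi> \<and> (\<forall>r>0. 0 < \<Phi> r \<and> \<Phi> r < \<infinity>)}"

definition young_inverse :: "(real \<Rightarrow> ennreal) \<Rightarrow> real \<Rightarrow> real" where
  "young_inverse \<Phi> s = Inf {r. 0 \<le> r \<and> ennreal s < \<Phi> r}"

definition nabla2 :: "(real \<Rightarrow> ennreal) \<Rightarrow> bool" where
  "nabla2 \<Phi> \<longleftrightarrow> (\<exists>C>1. \<forall>r\<ge>0. \<Phi> r \<le> ennreal (1 / (2 * C)) * \<Phi> (C * r))"


section \<open>Function spaces\<close>

definition locally_integrable :: "('a::euclidean_space \<Rightarrow> real) \<Rightarrow> bool" where
  "locally_integrable f \<longleftrightarrow> (\<forall>K. compact K \<longrightarrow> set_integrable lebesgue K f)"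

definition orlicz_space :: "(real \<Rightarrow> ennreal) \<Rightarrow> ('a::euclidean_space \<Rightarrow> real) set" where
  "orlicz_space \<Phi> = {f. locally_integrable f \<and>
     (\<exists>k>0. (\<integral>\<^sup>+x. \<Phi> (k * \<bar>f x\<bar>) \<partial>lebesgue) < \<infinity>)}"

text \<open>The maximal commutator may take the value \<open>\<infinity>\<close>, so the Luxemburg norm is defined for
  \<open>[0, \<infinity>]\<close>-valued functions \<open>F\<close> (standing for \<open>\<bar>f\<bar>\<close>), with \<open>\<Phi> \<infinity> = \<infinity>\<close>. The norm is \<open>\<infinity>\<close>, the infimum
  of the empty set, if no \<open>\<lambda>\<close> is admissible.\<close>

definition young_ext :: "(real \<Rightarrow> ennreal) \<Rightarrow> ennreal \<Rightarrow> ennreal" where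
  "young_ext \<Phi> u = (if u = \<infinity> then \<infinity> else \<Phi> (enn2real u))"

definition orlicz_norm :: "(real \<Rightarrow> ennreal) \<Rightarrow> ('a::euclidean_space \<Rightarrow> ennreal) \<Rightarrow> ennreal" where
  "orlicz_norm \<Phi> F =
     Inf {ennreal l | l. 0 < l \<and> (\<integral>\<^sup>+x. young_ext \<Phi> (F x / ennreal l) \<partial>lebesgue) \<le> 1}"

definition orlicz_bounded ::
  "(real \<Rightarrow> ennreal) \<Rightarrow> (real \<Rightarrow> ennreal) \<Rightarrow>
   (('a::euclidean_space \<Rightarrow> real) \<Rightarrow> 'a \<Rightarrow> ennreal) \<Rightarrow> bool" where
  "orlicz_bounded \<Phi> \<Psi> T \<longleftrightarrow>
     (\<exists>C\<ge>0. \<forall>f\<in>orlicz_space \<Phi>.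
        orlicz_norm \<Psi> (T f) \<le> ennreal C * orlicz_norm \<Phi> (\<lambda>x. ennreal \<bar>f x\<bar>))"

definition lipschitz_space ::
  "('a::euclidean_space \<Rightarrow> 'a \<Rightarrow> 'a) \<Rightarrow> ('a \<Rightarrow> real) \<Rightarrow> real \<Rightarrow> ('a \<Rightarrow> real) set" where
  "lipschitz_space mul \<rho> \<beta> = {b. \<exists>g. (AE x in lebesgue. b x = g x) \<and>
     (\<exists>C. \<forall>x y. \<bar>g x - g y\<bar> \<le> C * \<rho> (mul (- y) x) powr \<beta>)}"

text \<open>A ball of radius \<open>\<le> 0\<close> is empty, so the supremum runs over balls of positive radius.\<close>

definition maximal_commutator ::
  "('a::euclidean_space \<Rightarrow> 'a \<Rightarrow> 'a) \<Rightarrow> ('a \<Rightarrow> real) \<Rightarrow> ('a \<Rightarrow> real) \<Rightarrow> ('a \<Rightarrow> real) \<Rightarrow> 'a \<Rightarrow> ennreal" where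
  "maximal_commutator mul \<rho> b f x =
     (SUP B \<in> {group_ball mul \<rho> z r | z r. x \<in> group_ball mul \<rho> z r}.
        (\<integral>\<^sup>+y\<in>B. ennreal (\<bar>b x - b y\<bar> * \<bar>f y\<bar>) \<partial>lebesgue) / emeasure lebesgue B)"

end

theory Submission
  imports Defs
begin

text \<open>The group enters the analysis through the quasi-metric \<open>d x y = \<rho> (y\<^sup>-\<^sup>1 x)\<close>, whose balls of radius
\<open>r\<close> all have measure \<open>c\<^sub>1 r ^ Q\<close>. So the proof has a geometric half, which establishes this, and an
analytic half in an Ahlfors regular quasi-metric space (\<open>ahlfors_quasimetric\<close>).

Geometry. A ball is a left translate of a ball about the identity, and the latter is a dilate of the
unit ball. A dilation acts on the layer \<open>V j\<close> as \<open>r ^ j\<close>, so its determinant is \<open>r ^ Q\<close>. It remains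
to see that left translations preserve Lebesgue measure, that is, that their Jacobian determinants are
1. By the chain rule this reduces to the coframe \<open>coframe x\<close>, the derivative at \<open>x\<close> of left
translation by \<open>- x\<close>. In exponential coordinates \<open>p t = coframe (t w) (t u)\<close> solves the linear
equation \<open>p' = u - [w, p]\<close> (\<open>exp_curve_ode\<close>). As a dilation is an automorphism of the Lie algebra, it maps
solutions to solutions, so it conjugates \<open>coframe x\<close> to the coframe at the dilated point
(\<open>coframe_automorphism\<close>). The determinant of the coframe is therefore constant along dilation orbits, and
these end at the identity, where the coframe is the identity map (\<open>ldet_coframe\<close>).

Lipschitz implies bounded. If \<open>b\<close> is Lipschitz of order \<open>\<beta>\<close>, then \<open>\<bar>b x - b y\<bar>\<close> is at most a constant
times \<open>\<bar>B\<bar>\<close> to the power \<open>\<beta> / Q\<close> for \<open>x\<close>, \<open>y\<close> in a ball \<open>B\<close>, so the commutator is dominated by the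
fractional maximal function. Hedberg's trick (\<open>hedberg_pointwise\<close>) estimates the average of \<open>\<bar>f\<bar>\<close> over a
small ball by the maximal function and over a large ball by the norm of \<open>f\<close>; with the
relation between \<open>\<Phi>\<close> and \<open>\<Psi>\<close> the commutator of a normalized \<open>f\<close> is then at most a constant times
\<open>\<Psi>\<^sup>-\<^sup>1 (\<Phi> (M f / K))\<close>. Applying \<open>\<Psi>\<close> leaves \<open>\<Phi> (M f / K)\<close>, whose integral is controlled by the
maximal theorem (\<open>maximal_theorem\<close>), which holds because \<open>\<Phi>\<close> satisfies the \<open>\<nabla>\<^sub>2\<close> condition.

Bounded implies Lipschitz. On a ball \<open>B\<close> the commutator of the indicator function of \<open>B\<close> dominates
the deviation of \<open>b\<close> from its mean over \<open>B\<close>. The norm of that indicator is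
at most \<open>1 / \<Phi>\<^sup>-\<^sup>1 (1 / \<bar>B\<bar>)\<close>, so boundedness shows that the mean oscillation of \<open>b\<close> over \<open>B\<close> is at most a
constant times \<open>r\<close> to the power \<open>\<beta>\<close> (\<open>lipschitz_of_bounded\<close>). By Campanato's
theorem (\<open>campanato\<close>) \<open>b\<close> then agrees almost everywhere with a Lipschitz function, the limit of its
means over shrinking balls.\<close>



section \<open>Determinants and change of variables on a Euclidean space\<close>

text \<open>This type indexes the coordinates of an arbitrary Euclidean space, which is thereby isometric to a space
\<open>real ^ 'n\<close>, where matrices and the change of variables formula are at hand. The latter asks for a
well-ordered index type.\<close>

typedef (overloaded) 'a coord = "{..<DIM('a::euclidean_space)}"
  by (auto intro!: exI[of _ 0])

instantiation coord :: (euclidean_space) "{finite, wellorder}"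
begin

definition less_eq_coord :: "'a coord \<Rightarrow> 'a coord \<Rightarrow> bool" where
  "less_eq_coord i j \<longleftrightarrow> Rep_coord i \<le> Rep_coord j"

definition less_coord :: "'a coord \<Rightarrow> 'a coord \<Rightarrow> bool" where
  "less_coord i j \<longleftrightarrow> Rep_coord i < Rep_coord j"

instance
proof
  show "finite (UNIV :: 'a coord set)"
    using type_definition.Abs_image[OF type_definition_coord[where ?'a='a]]
    by (metis finite_imageI finite_lessThan)
next
  fix P :: "'a coord \<Rightarrow> bool" and i
  assume step: "\<And>x. (\<And>y. y < x \<Longrightarrow> P y) \<Longrightarrow> P x"
  show "P i"
    by (induction i rule: measure_induct_rule[of Rep_coord]) (auto intro: step simp: less_coord_def)
qed (auto simp: less_eq_coord_def less_coord_def Rep_coord_inject)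

end

lemma card_coord: "CARD('a::euclidean_space coord) = DIM('a)"
  using type_definition.card[OF type_definition_coord[where ?'a='a]] by simp

definition coord_vector :: "'a::euclidean_space coord \<Rightarrow> 'a" where
  "coord_vector = (SOME e. bij_betw e UNIV Basis)"

lemma bij_coord_vector: "bij_betw coord_vector UNIV (Basis :: 'a::euclidean_space set)"
proof -
  have "\<exists>e. bij_betw e (UNIV :: 'a coord set) (Basis :: 'a set)"
    by (rule finite_same_card_bij) (auto simp: card_coord)
  then show ?thesis
    unfolding coord_vector_def by (rule someI_ex)
qed

lemma coord_vector_in_Basis [simp]: "coord_vector i \<in> Basis"
  using bij_coord_vector by (auto simp: bij_betw_def)

definition to_vec :: "'a::euclidean_space \<Rightarrow> real ^ 'a coord" where
  "to_vec x = (\<chi> i. x \<bullet> coord_vector i)"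

definition of_vec :: "real ^ 'a coord \<Rightarrow> 'a::euclidean_space" where
  "of_vec v = (\<Sum>i\<in>UNIV. v $ i *\<^sub>R coord_vector i)"

lemma sum_Basis_coord: "(\<Sum>i\<in>UNIV. f (coord_vector i)) = (\<Sum>b\<in>(Basis :: 'a::euclidean_space set). f b)"
  using sum.reindex_bij_betw[OF bij_coord_vector] .

lemma prod_Basis_coord: "(\<Prod>i\<in>UNIV. f (coord_vector i)) = (\<Prod>b\<in>(Basis :: 'a::euclidean_space set). f b)"
  using prod.reindex_bij_betw[OF bij_coord_vector] .

lemma of_to_vec [simp]: "of_vec (to_vec x) = x"
  unfolding of_vec_def to_vec_def
  using sum_Basis_coord[of "\<lambda>b. (x \<bullet> b) *\<^sub>R b"] by (simp add: euclidean_representation)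

lemma to_of_vec [simp]: "to_vec (of_vec v) = v"
proof -
  have "coord_vector i \<bullet> coord_vector j = (if i = j then 1 else 0)" for i j :: "'a coord"
    using bij_coord_vector by (auto simp: inner_Basis bij_betw_def inj_on_def)
  then have "(\<Sum>j\<in>UNIV. v $ j * (coord_vector j \<bullet> coord_vector i)) = (\<Sum>j\<in>UNIV. if j = i then v $ j else 0)"
    for i :: "'a coord"
    by (intro sum.cong) auto
  then show ?thesis
    by (simp add: of_vec_def to_vec_def vec_eq_iff inner_sum_left)
qed

lemma linear_to_vec: "linear to_vec"
  by (rule linearI) (auto simp: to_vec_def vec_eq_iff inner_left_distrib)

lemma linear_of_vec: "linear of_vec"
  by (rule linearI) (auto simp: of_vec_def algebra_simps sum.distrib scaleR_sum_right)

lemma bij_to_vec: "bij to_vec"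
  by (rule bij_betw_byWitness[where f'=of_vec]) auto

lemma continuous_on_to_vec: "continuous_on S to_vec" and continuous_on_of_vec: "continuous_on T of_vec"
  by (auto intro!: linear_continuous_on linear_to_vec linear_of_vec simp: linear_conv_bounded_linear[symmetric])

text \<open>Reindexing the coordinates maps boxes to boxes of the same volume, hence preserves
  Lebesgue measure.\<close>

lemma distr_lborel_to_vec: "distr lborel borel to_vec = (lborel :: (real ^ 'a::euclidean_space coord) measure)"
proof (rule lborel_eqI[symmetric])
  fix l u :: "real ^ 'a coord"
  assume le: "\<And>b. b \<in> Basis \<Longrightarrow> l \<bullet> b \<le> u \<bullet> b"
  have le': "l $ i \<le> u $ i" for i
    using le[of "axis i 1"] by (simp add: inner_axis)
  have nth: "v $ i = of_vec v \<bullet> coord_vector i" for v :: "real ^ 'a coord" and i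
    by (metis to_of_vec to_vec_def vec_lambda_beta)
  have "to_vec -` box l u = box (of_vec l) (of_vec u)"
  proof -
    have "to_vec x \<in> box l u \<longleftrightarrow> x \<in> box (of_vec l) (of_vec u)" for x :: 'a
    proof -
      have "to_vec x \<in> box l u \<longleftrightarrow> (\<forall>i. of_vec l \<bullet> coord_vector i < x \<bullet> coord_vector i \<and>
          x \<bullet> coord_vector i < of_vec u \<bullet> coord_vector i)"
        by (simp add: mem_box_cart nth)
      also have "\<dots> \<longleftrightarrow> x \<in> box (of_vec l) (of_vec u)"
        using bij_coord_vector[where 'a='a] unfolding mem_box bij_betw_def by (metis UNIV_I imageE image_eqI)
      finally show ?thesis .
    qed
    then show ?thesis by auto
  qed
  moreover have "of_vec l \<bullet> b \<le> of_vec u \<bullet> b" if "b \<in> Basis" for b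
    using le' that bij_coord_vector unfolding bij_betw_def by (metis imageE nth)
  moreover have "(\<Prod>b\<in>Basis. (of_vec u - of_vec l) \<bullet> b) = (\<Prod>i\<in>UNIV. (u - l) $ i)"
    unfolding prod_Basis_coord[symmetric] by (simp add: nth[symmetric] inner_diff_left)
  moreover have "(\<Prod>b\<in>Basis. (u - l) \<bullet> b) = (\<Prod>i\<in>UNIV. (u - l) $ i)"
  proof -
    have "bij_betw (\<lambda>i. axis i 1) UNIV (Basis :: (real ^ 'a coord) set)"
      by (auto simp: Basis_vec_def bij_betw_def inj_on_def axis_eq_axis)
    from prod.reindex_bij_betw[OF this, of "\<lambda>b. (u - l) \<bullet> b"] show ?thesis
      by (simp add: inner_axis)
  qed
  ultimately show "emeasure (distr lborel borel to_vec) (box l u) = (\<Prod>b\<in>Basis. (u - l) \<bullet> b)"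
    by (subst emeasure_distr)
      (auto simp: emeasure_lborel_box_eq intro!: borel_measurable_continuous_onI continuous_on_to_vec)
qed auto

lemma to_vec_image_eq_vimage: "to_vec ` S = of_vec -` S"
  by (auto intro: image_eqI[where x="of_vec x" for x])

lemma of_vec_borel [measurable]: "of_vec \<in> borel_measurable borel"
  and to_vec_borel [measurable]: "to_vec \<in> borel_measurable borel"
  by (auto intro!: borel_measurable_continuous_onI continuous_on_to_vec continuous_on_of_vec)

lemma emeasure_to_vec_image:
  assumes "S \<in> sets borel"
  shows "to_vec ` S \<in> sets borel" and "emeasure lebesgue (to_vec ` S) = emeasure lebesgue S"
proof -
  show 1: "to_vec ` S \<in> sets borel"
    using measurable_sets[OF of_vec_borel assms] by (simp add: to_vec_image_eq_vimage)
  have "emeasure lebesgue (to_vec ` S) = emeasure (distr lborel borel to_vec) (to_vec ` S)"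
    using 1 by (simp add: distr_lborel_to_vec)
  also have "\<dots> = emeasure lborel (to_vec -` to_vec ` S)"
    using 1 by (subst emeasure_distr) auto
  also have "to_vec -` to_vec ` S = S"
    by (simp add: inj_vimage_image_eq bij_is_inj bij_to_vec)
  finally show "emeasure lebesgue (to_vec ` S) = emeasure lebesgue S"
    using assms by simp
qed

text \<open>The determinant of an endomorphism, computed in the standard basis.\<close>

definition ldet :: "('a::euclidean_space \<Rightarrow> 'a) \<Rightarrow> real" where
  "ldet f = det (matrix (to_vec \<circ> f \<circ> of_vec))"

lemma matrix_to_vec_nth:
  "matrix (to_vec \<circ> f \<circ> of_vec) $ i $ j = f (coord_vector j) \<bullet> coord_vector i"
  for f :: "'a::euclidean_space \<Rightarrow> 'a"
proof -
  have "of_vec (axis j 1) = (coord_vector j :: 'a)"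
    by (simp add: of_vec_def axis_def if_distrib[where f="\<lambda>c. c *\<^sub>R _"] sum.delta cong: if_cong)
  then show ?thesis
    by (simp add: matrix_def to_vec_def)
qed

lemma linear_conj_vec: "linear f \<Longrightarrow> linear (to_vec \<circ> f \<circ> of_vec)"
  by (intro linear_compose linear_to_vec linear_of_vec)

lemma ldet_compose:
  fixes f g :: "'a::euclidean_space \<Rightarrow> 'a"
  assumes "linear f" "linear g"
  shows "ldet (f \<circ> g) = ldet f * ldet g"
proof -
  have "to_vec \<circ> (f \<circ> g) \<circ> of_vec = (to_vec \<circ> f \<circ> of_vec) \<circ> (to_vec \<circ> g \<circ> of_vec)"
    by (auto simp: fun_eq_iff)
  then show ?thesis
    unfolding ldet_def using linear_conj_vec assms by (metis matrix_compose det_mul)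
qed

lemma ldet_id: "ldet (\<lambda>x. x) = 1"
proof -
  have "to_vec \<circ> (\<lambda>x. x) \<circ> of_vec = (id :: real ^ 'a coord \<Rightarrow> _)"
    by (auto simp: fun_eq_iff)
  then show ?thesis
    by (simp add: ldet_def matrix_id det_I)
qed

lemma tendsto_ldet:
  assumes "\<And>v. ((\<lambda>x. f x v) \<longlongrightarrow> g v) F"
  shows "((\<lambda>x. ldet (f x)) \<longlongrightarrow> ldet g) F"
  unfolding ldet_def det_def matrix_to_vec_nth
  by (intro tendsto_intros assms)

text \<open>Only maps whose Jacobian determinant is constant in absolute value occur: left translations, where it is
1, and dilations. For these the integral in the change of variables formula is a product.\<close>

lemma emeasure_image_const_det:
  fixes T :: "'a::euclidean_space \<Rightarrow> 'a"
  assumes S: "S \<in> sets borel" "emeasure lebesgue S < \<infinity>" and TS: "T ` S \<in> sets borel"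
    and der: "\<And>x. x \<in> S \<Longrightarrow> (T has_derivative T' x) (at x)"
    and inj: "inj_on T S" and det: "\<And>x. x \<in> S \<Longrightarrow> \<bar>ldet (T' x)\<bar> = k"
  shows "emeasure lebesgue (T ` S) = ennreal k * emeasure lebesgue S"
proof (cases "S = {}")
  case False
  then have k: "k \<ge> 0" using det by force
  define U where "U = to_vec \<circ> T \<circ> of_vec"
  define U' where "U' = (\<lambda>v. to_vec \<circ> T' (of_vec v) \<circ> of_vec)"
  have US: "U ` to_vec ` S = to_vec ` T ` S"
    by (force simp: U_def)
  have VS: "to_vec ` S \<in> lmeasurable"
    using emeasure_to_vec_image[OF S(1)] S(2) by (auto intro!: fmeasurableI)
  have derU: "(U has_derivative U' v) (at v within to_vec ` S)" if "v \<in> to_vec ` S" for v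
  proof -
    have 1: "(T has_derivative T' (of_vec v)) (at (of_vec v))"
      using that by (auto intro: der)
    have 2: "(of_vec has_derivative of_vec) (at v within to_vec ` S)" for v
      by (simp add: linear_imp_has_derivative linear_of_vec)
    have 3: "(to_vec has_derivative to_vec) (at w)" for w
      by (simp add: linear_imp_has_derivative linear_to_vec)
    show ?thesis
      using has_derivative_compose[OF has_derivative_compose[OF 2 1] 3]
      by (simp add: U_def U'_def o_def)
  qed
  have detU: "\<bar>det (matrix (U' v))\<bar> = k" if "v \<in> to_vec ` S" for v
    using that det by (auto simp: U'_def ldet_def)
  have injU: "inj_on U (to_vec ` S)"
    using inj bij_is_inj[OF bij_to_vec] by (auto simp: U_def inj_on_def)
  have "((\<lambda>v. 1) has_integral measure lebesgue (to_vec ` S)) (to_vec ` S)"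
    using VS by (simp add: has_integral_iff lmeasurable_iff_integrable_on lmeasure_integral)
  from has_integral_mult_right[OF this, of k]
  have "((\<lambda>v. k) has_integral k * measure lebesgue (to_vec ` S)) (to_vec ` S)"
    by simp
  then have int: "((\<lambda>v. \<bar>det (matrix (U' v))\<bar>) has_integral k * measure lebesgue (to_vec ` S)) (to_vec ` S)"
    by (rule has_integral_eq[rotated]) (simp add: detU)
  have UVS: "U ` to_vec ` S \<in> lmeasurable"
    using measurable_differentiable_image_eq[OF _ derU injU] VS int by blast
  have "measure lebesgue (U ` to_vec ` S) = k * measure lebesgue (to_vec ` S)"
    using measure_differentiable_image_eq[OF _ derU injU] VS int integral_unique[OF int] by (auto simp: has_integral_iff)
  then have "emeasure lebesgue (U ` to_vec ` S) = ennreal k * emeasure lebesgue (to_vec ` S)"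
    using VS UVS k by (simp add: emeasure_eq_measure2 ennreal_mult)
  then show ?thesis
    unfolding US using emeasure_to_vec_image[OF S(1)] emeasure_to_vec_image[OF TS] by simp
qed simp

text \<open>In a basis adapted to a direct sum decomposition, a map that acts on each summand as a scalar is
  diagonal.\<close>

lemma ldet_scalar_on_layers:
  fixes T :: "'a::euclidean_space \<Rightarrow> 'a" and V :: "'i \<Rightarrow> 'a set"
  assumes I: "finite I" and T: "linear T"
    and V: "\<And>j. j \<in> I \<Longrightarrow> subspace (V j)"
    and dsum: "\<And>x. \<exists>!v. v \<in> Pi\<^sub>E I V \<and> x = (\<Sum>j\<in>I. v j)"
    and scal: "\<And>j v. j \<in> I \<Longrightarrow> v \<in> V j \<Longrightarrow> T v = c j *\<^sub>R v"
  shows "ldet T = (\<Prod>j\<in>I. c j ^ dim (V j))"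
proof -
  \<comment> \<open>The union of bases of the summands is a basis; \<open>P\<close> maps the standard basis to it, and \<open>D\<close> is the
    diagonal map with \<open>T \<circ> P = P \<circ> D\<close>.\<close>
  have "\<exists>B. \<forall>j\<in>I. B j \<subseteq> V j \<and> independent (B j) \<and> V j = span (B j) \<and> card (B j) = dim (V j)"
    by (intro bchoice ballI) (metis basis_exists V span_subspace)
  then obtain B where BV: "\<And>j. j \<in> I \<Longrightarrow> B j \<subseteq> V j" and ind: "\<And>j. j \<in> I \<Longrightarrow> independent (B j)"
    and spanB: "\<And>j. j \<in> I \<Longrightarrow> V j = span (B j)" and cardB: "\<And>j. j \<in> I \<Longrightarrow> card (B j) = dim (V j)"
    by blast
  have finB: "finite (B j)" if "j \<in> I" for j
    using ind[OF that] independent_imp_finite by blast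
  have zero: "v j = 0" if v: "\<And>i. i \<in> I \<Longrightarrow> v i \<in> V i" and s: "(\<Sum>i\<in>I. v i) = 0" and j: "j \<in> I" for v j
  proof -
    have "restrict v I \<in> Pi\<^sub>E I V \<and> 0 = (\<Sum>i\<in>I. restrict v I i)"
      using v s by simp
    moreover have "restrict (\<lambda>_. 0) I \<in> Pi\<^sub>E I V \<and> 0 = (\<Sum>i\<in>I. restrict (\<lambda>_. 0) I i)"
      using V by (simp add: subspace_0)
    ultimately have "restrict v I = restrict (\<lambda>_. 0) I"
      using dsum[of 0] by blast
    then have "restrict v I j = restrict (\<lambda>_. 0) I j" by simp
    then show ?thesis using j by simp
  qed
  have disj: "B i \<inter> B j = {}" if "i \<in> I" "j \<in> I" "i \<noteq> j" for i j
  proof (rule ccontr)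
    assume "B i \<inter> B j \<noteq> {}"
    then obtain x where x: "x \<in> B i" "x \<in> B j" by auto
    define v where "v = (\<lambda>k. if k = i then x else if k = j then - x else 0)"
    have "(\<Sum>k\<in>I. v k) = (\<Sum>k\<in>I. (if k = i then x else 0) + (if k = j then - x else 0))"
      using that by (intro sum.cong) (auto simp: v_def)
    also have "\<dots> = 0"
      using that I by (simp add: sum.distrib)
    finally have s0: "(\<Sum>k\<in>I. v k) = 0" .
    have vV: "v k \<in> V k" if "k \<in> I" for k
      using x BV V that \<open>i \<in> I\<close> \<open>j \<in> I\<close> by (auto simp: v_def subspace_neg subspace_0 subset_iff)
    have "v i = 0"
      by (rule zero[OF vV s0 \<open>i \<in> I\<close>])
    then have "x = 0" by (simp add: v_def)
    then show False using x ind that dependent_zero by blast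
  qed
  define C where "C = (\<Union>j\<in>I. B j)"
  have finC: "finite C" using I finB by (auto simp: C_def)
  have indC: "independent C"
    unfolding independent_explicit
  proof (intro conjI allI impI ballI finC)
    fix a x assume a: "(\<Sum>v\<in>C. a v *\<^sub>R v) = 0" and "x \<in> C"
    then obtain j where j: "j \<in> I" "x \<in> B j" by (auto simp: C_def)
    have "(\<Sum>i\<in>I. \<Sum>v\<in>B i. a v *\<^sub>R v) = (\<Sum>v\<in>C. a v *\<^sub>R v)"
      unfolding C_def using I finB disj by (intro sum.UNION_disjoint[symmetric]) auto
    then have "(\<Sum>v\<in>B j. a v *\<^sub>R v) = 0"
      using a BV V by (intro zero[of "\<lambda>i. \<Sum>v\<in>B i. a v *\<^sub>R v", OF _ _ j(1)])
        (auto intro!: subspace_sum subspace_scale)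
    then show "a x = 0"
      using ind[OF j(1)] j finB unfolding independent_explicit by blast
  qed
  have spanC: "span C = UNIV"
  proof -
    have "x \<in> span C" for x
    proof -
      obtain v where v: "v \<in> Pi\<^sub>E I V" and x: "x = (\<Sum>j\<in>I. v j)" using dsum[of x] by blast
        have "v j \<in> span C" if "j \<in> I" for j
          using PiE_mem[OF v that] spanB[OF that] span_mono[of "B j" C] that by (auto simp: C_def)
        then show ?thesis unfolding x by (rule span_sum)
    qed
    then show ?thesis by auto
  qed
  have cardC: "card C = CARD('a coord)"
    using dim_eq_card[of C UNIV] indC spanC by (simp add: card_coord dim_UNIV)
  have "\<exists>e. bij_betw e (UNIV :: 'a coord set) C"
    by (rule finite_same_card_bij) (auto simp: cardC finC)
  then obtain e where e: "bij_betw e (UNIV :: 'a coord set) C" by blast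
  have "\<exists>l. \<forall>x\<in>C. l x \<in> I \<and> x \<in> B (l x)"
    by (rule bchoice) (auto simp: C_def)
  then obtain l where l: "\<And>x. x \<in> C \<Longrightarrow> l x \<in> I \<and> x \<in> B (l x)" by blast
  have leq: "l x = j" if "j \<in> I" "x \<in> B j" for j x
    using l[of x] disj that by (auto simp: C_def)
  define P where "P = (\<lambda>x. \<Sum>i\<in>UNIV. (x \<bullet> coord_vector i) *\<^sub>R e i)"
  define D where "D = (\<lambda>x. \<Sum>i\<in>UNIV. (c (l (e i)) * (x \<bullet> coord_vector i)) *\<^sub>R (coord_vector i :: 'a))"
  have linP: "linear P" and linD: "linear D"
    unfolding P_def D_def by (rule linearI; simp add: algebra_simps sum.distrib scaleR_sum_right)+
  have orth: "coord_vector i \<bullet> coord_vector j = (if i = j then 1 else 0)" for i j :: "'a coord"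
    using bij_coord_vector by (auto simp: inner_Basis bij_betw_def inj_on_def)
  have eC: "e i \<in> C" for i using e by (auto simp: bij_betw_def)
  have Te: "T (e i) = c (l (e i)) *\<^sub>R e i" for i
    using l[OF eC[of i]] BV by (intro scal) auto
  have coordD: "D x \<bullet> coord_vector i = c (l (e i)) * (x \<bullet> coord_vector i)" for x i
    by (simp add: D_def inner_sum_left orth if_distrib sum.delta cong: if_cong)
  have "T \<circ> P = P \<circ> D"
  proof
    fix x
    have "(T \<circ> P) x = (\<Sum>i\<in>UNIV. (x \<bullet> coord_vector i) *\<^sub>R T (e i))"
      by (simp add: P_def linear_sum[OF T] linear_scale[OF T])
    also have "\<dots> = (P \<circ> D) x"
      by (simp add: P_def Te coordD mult.commute)
    finally show "(T \<circ> P) x = (P \<circ> D) x" .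
  qed
  then have "ldet T * ldet P = ldet P * ldet D"
    using ldet_compose T linP linD by metis
  moreover have "ldet P \<noteq> 0"
  proof -
    have Pe: "P (coord_vector i) = e i" for i
      by (simp add: P_def orth if_distrib[where f="\<lambda>c. c *\<^sub>R _"] sum.delta cong: if_cong)
    have "C \<subseteq> range P"
    proof
      fix x assume "x \<in> C"
      then obtain i where "x = e i" using e unfolding bij_betw_def by blast
      then show "x \<in> range P" using Pe[of i] by (metis rangeI)
    qed
    then have "span C \<subseteq> range P"
      by (intro span_minimal linear_subspace_image linP) auto
    then have "surj P"
      using spanC by auto
    then have "surj (to_vec \<circ> P \<circ> of_vec)"
      by (intro comp_surj bij_is_surj[OF bij_to_vec]) (metis of_to_vec surjI)
    then show ?thesis
      using linear_conj_vec[OF linP] matrix_right_invertible_surjective[of "matrix (to_vec \<circ> P \<circ> of_vec)"]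
      by (auto simp: ldet_def matrix_works invertible_det_nz[symmetric] invertible_right_inverse)
  qed
  ultimately have "ldet T = ldet D" by simp
  also have "\<dots> = (\<Prod>i\<in>UNIV. c (l (e i)))"
    unfolding ldet_def
    by (subst det_diagonal) (auto simp: matrix_to_vec_nth coordD orth)
  also have "\<dots> = (\<Prod>x\<in>C. c (l x))"
    using prod.reindex_bij_betw[OF e, of "\<lambda>x. c (l x)"] .
  also have "\<dots> = (\<Prod>j\<in>I. \<Prod>x\<in>B j. c (l x))"
    unfolding C_def using I finB disj by (intro prod.UNION_disjoint) auto
  also have "\<dots> = (\<Prod>j\<in>I. c j ^ dim (V j))"
    using leq cardB by (intro prod.cong) (auto simp: cardB[symmetric])
  finally show ?thesis .
qed


section \<open>The group law near the identity and the differential of the exponential map\<close>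

lemma has_vector_derivative_at_quotient:
  "(f has_vector_derivative D) (at x) \<longleftrightarrow> ((\<lambda>h. (f (x + h) - f x) /\<^sub>R h) \<longlongrightarrow> D) (at 0)"
proof -
  have "norm (f (x + h) - f x - h *\<^sub>R D) / norm h = norm ((f (x + h) - f x) /\<^sub>R h - D)" if "h \<noteq> 0" for h
  proof -
    have "(f (x + h) - f x) /\<^sub>R h - D = (f (x + h) - f x - h *\<^sub>R D) /\<^sub>R h"
      using that by (simp add: scaleR_diff_right)
    then show ?thesis by (simp add: divide_inverse_commute)
  qed
  then have "((\<lambda>h. norm (f (x + h) - f x - h *\<^sub>R D) / norm h) \<longlongrightarrow> 0) (at 0)
      \<longleftrightarrow> ((\<lambda>h. norm ((f (x + h) - f x) /\<^sub>R h - D)) \<longlongrightarrow> 0) (at 0)"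
    by (intro tendsto_cong) (simp add: eventually_at_filter)
  then show ?thesis
    unfolding has_vector_derivative_def has_derivative_at
    by (simp add: bounded_linear_scaleR_left tendsto_norm_zero_iff LIM_zero_iff)
qed

text \<open>Gronwall's argument: for \<open>c\<close> a bound of \<open>K\<close>, the function \<open>exp (- 2 c t) \<bar>y t\<bar>\<^sup>2\<close> is nonincreasing,
nonnegative and 0 at time 0.\<close>

lemma linear_ode_zero_unique:
  fixes y :: "real \<Rightarrow> 'a::euclidean_space"
  assumes K: "linear K" and y: "\<And>t. (y has_vector_derivative K (y t)) (at t)" and y0: "y 0 = 0"
    and t: "t \<ge> 0"
  shows "y t = 0"
proof -
  from linear_bounded[OF K] obtain c where c: "\<And>x. norm (K x) \<le> c * norm x"
    by (auto)
  define g where "g = (\<lambda>t. exp (- 2 * c * t) * (y t \<bullet> y t))"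
  have g': "(g has_real_derivative exp (- 2 * c * t) * (2 * (y t \<bullet> K (y t)) - 2 * c * (y t \<bullet> y t))) (at t)" for t
  proof -
    have "((\<lambda>t. y t \<bullet> y t) has_derivative (\<lambda>h. y t \<bullet> (h *\<^sub>R K (y t)) + (h *\<^sub>R K (y t)) \<bullet> y t)) (at t)"
      using y[of t] unfolding has_vector_derivative_def by (intro has_derivative_inner)
    then have "((\<lambda>t. y t \<bullet> y t) has_real_derivative 2 * (y t \<bullet> K (y t))) (at t)"
      unfolding has_field_derivative_def by (rule has_derivative_eq_rhs) (auto simp: inner_commute algebra_simps)
    then show ?thesis
      unfolding g_def by (auto intro!: derivative_eq_intros simp: algebra_simps)
  qed
  have "exp (- 2 * c * t) * (2 * (y t \<bullet> K (y t)) - 2 * c * (y t \<bullet> y t)) \<le> 0" for t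
  proof -
    have "y t \<bullet> K (y t) \<le> norm (y t) * norm (K (y t))" by (rule norm_cauchy_schwarz)
    also have "\<dots> \<le> norm (y t) * (c * norm (y t))" by (intro mult_left_mono c) auto
    also have "\<dots> = c * (y t \<bullet> y t)" by (simp add: power2_norm_eq_inner[symmetric] power2_eq_square)
    finally show ?thesis by (simp add: mult_nonneg_nonpos)
  qed
  then have "g t \<le> g 0"
    using g' t by (intro DERIV_nonpos_imp_nonincreasing[of 0 t g]) blast+
  then have "exp (- 2 * c * t) * (y t \<bullet> y t) \<le> 0"
    by (simp add: g_def y0)
  then have "y t \<bullet> y t \<le> 0"
    by (simp only: mult_le_0_iff) (use exp_gt_zero[of "- 2 * c * t"] in linarith)
  then have "y t \<bullet> y t = 0"
    using inner_ge_zero[of "y t"] by linarith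
  then show ?thesis
    by (simp only: inner_eq_zero_iff)
qed

context stratified_group
begin

interpretation G: Groups.group mul 0 uminus
  by (rule group_mul)

text \<open>The derivative at \<open>y\<close> of left translation by \<open>x\<close>, read off from the joint derivative of the group
law so that its dependence on \<open>x\<close> and \<open>y\<close> inherits the smoothness of the group law.\<close>

definition left_deriv :: "'a \<Rightarrow> 'a \<Rightarrow> 'a \<Rightarrow> 'a" where
  "left_deriv x y h = frechet_derivative (\<lambda>(x, y). mul x y) (at (x, y)) (0, h)"

lemma mul_has_derivative:
  "((\<lambda>(x, y). mul x y) has_derivative frechet_derivative (\<lambda>(x, y). mul x y) (at p)) (at p)"
proof -
  have "higher_differentiable_on UNIV (\<lambda>(x, y). mul x y) (Suc 0)"
    using smooth_mul unfolding smooth_on_def by blast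
  then show ?thesis
    unfolding higher_differentiable_on.simps frechet_derivative_works by blast
qed

lemma mul_derivative_differentiable:
  "(\<lambda>p. frechet_derivative (\<lambda>(x, y). mul x y) (at p) v) differentiable (at p)"
proof -
  have "higher_differentiable_on UNIV (\<lambda>(x, y). mul x y) (Suc (Suc 0))"
    using smooth_mul unfolding smooth_on_def by blast
  then show ?thesis
    unfolding higher_differentiable_on.simps by blast
qed

lemma linear_mul_derivative: "linear (frechet_derivative (\<lambda>(x, y). mul x y) (at p))"
  by (rule has_derivative_linear[OF mul_has_derivative])

lemma has_derivative_mul:
  assumes "(f has_derivative f') (at x)" "(g has_derivative g') (at x)"
  shows "((\<lambda>x. mul (f x) (g x)) has_derivative
     (\<lambda>h. frechet_derivative (\<lambda>(x, y). mul x y) (at (f x, g x)) (f' h, g' h))) (at x)"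
  using has_derivative_compose[OF has_derivative_Pair[OF assms] mul_has_derivative]
  by (simp only: prod.case)

lemma has_derivative_mul_left: "(mul x has_derivative left_deriv x y) (at y)"
  unfolding left_deriv_def
  by (rule has_derivative_mul[OF has_derivative_const has_derivative_ident])

lemma linear_left_deriv: "linear (left_deriv x y)"
  by (rule has_derivative_linear[OF has_derivative_mul_left])

lemma continuous_mul: "continuous_on UNIV (\<lambda>(x, y). mul x y)"
  by (intro differentiable_imp_continuous_on) (auto simp: differentiable_on_def intro: differentiableI mul_has_derivative)

text \<open>Smoothness gives continuity of the derivative in each fixed direction; expanding the direction in a
basis makes it jointly continuous.\<close>

lemma tendsto_mul_derivative:
  assumes "(f \<longlongrightarrow> p) F" "(k \<longlongrightarrow> h) F"
  shows "((\<lambda>s. frechet_derivative (\<lambda>(x, y). mul x y) (at (f s)) (k s)) \<longlongrightarrow>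
    frechet_derivative (\<lambda>(x, y). mul x y) (at p) h) F"
proof -
  have expand: "frechet_derivative (\<lambda>(x, y). mul x y) (at p) h =
      (\<Sum>b\<in>Basis. (h \<bullet> b) *\<^sub>R frechet_derivative (\<lambda>(x, y). mul x y) (at p) b)" for p h
  proof -
    have "frechet_derivative (\<lambda>(x, y). mul x y) (at p) (\<Sum>b\<in>Basis. (h \<bullet> b) *\<^sub>R b) =
      (\<Sum>b\<in>Basis. (h \<bullet> b) *\<^sub>R frechet_derivative (\<lambda>(x, y). mul x y) (at p) b)"
      by (simp only: linear_sum[OF linear_mul_derivative] linear_scale[OF linear_mul_derivative])
    then show ?thesis by (simp only: euclidean_representation)
  qed
  have "((\<lambda>s. frechet_derivative (\<lambda>(x, y). mul x y) (at (f s)) b) \<longlongrightarrow>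
    frechet_derivative (\<lambda>(x, y). mul x y) (at p) b) F" for b
    using differentiable_imp_continuous_within[OF mul_derivative_differentiable[of b p]] assms(1)
    by (rule isCont_tendsto_compose)
  then have "((\<lambda>s. \<Sum>b\<in>Basis. (k s \<bullet> b) *\<^sub>R frechet_derivative (\<lambda>(x, y). mul x y) (at (f s)) b) \<longlongrightarrow>
    (\<Sum>b\<in>Basis. (h \<bullet> b) *\<^sub>R frechet_derivative (\<lambda>(x, y). mul x y) (at p) b)) F"
    by (intro tendsto_intros assms)
  then show ?thesis
    by (simp only: expand[symmetric])
qed

lemma tendsto_left_deriv:
  assumes "(f \<longlongrightarrow> x) F" "(g \<longlongrightarrow> y) F" "(k \<longlongrightarrow> h) F"
  shows "((\<lambda>s. left_deriv (f s) (g s) (k s)) \<longlongrightarrow> left_deriv x y h) F"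
  unfolding left_deriv_def
  by (rule tendsto_mul_derivative[OF tendsto_Pair[OF assms(1,2)] tendsto_Pair[OF tendsto_const assms(3)]])

lemma left_deriv_chain: "left_deriv a (mul x y) (left_deriv x y h) = left_deriv (mul a x) y h"
proof -
  have 1: "((\<lambda>y. mul a (mul x y)) has_derivative (\<lambda>h. left_deriv a (mul x y) (left_deriv x y h))) (at y)"
    by (rule has_derivative_compose[OF has_derivative_mul_left has_derivative_mul_left])
  have "(\<lambda>y. mul a (mul x y)) = mul (mul a x)" by (simp add: fun_eq_iff G.assoc)
  with has_derivative_mul_left[of "mul a x" y]
  have 2: "((\<lambda>y. mul a (mul x y)) has_derivative left_deriv (mul a x) y) (at y)" by (simp only:)
  show ?thesis
    using fun_cong[OF has_derivative_unique[OF 1 2], of h] .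
qed

lemma left_deriv_0 [simp]: "left_deriv 0 y h = h"
proof -
  have "mul 0 = (\<lambda>x. x)" by (simp add: fun_eq_iff)
  then have "(mul 0 has_derivative (\<lambda>h. h)) (at y)" by (simp only: has_derivative_ident)
  from fun_cong[OF has_derivative_unique[OF has_derivative_mul_left this], of h] show ?thesis .
qed

text \<open>\<open>frame x\<close> identifies the tangent space at the identity with the one at \<open>x\<close> by left translation, so
\<open>\<lambda>x. frame x u\<close> is the left-invariant vector field of \<open>u\<close>. Its inverse \<open>coframe x\<close> is the
Maurer--Cartan form.\<close>

definition frame :: "'a \<Rightarrow> 'a \<Rightarrow> 'a" where
  "frame x = left_deriv x 0"

definition coframe :: "'a \<Rightarrow> 'a \<Rightarrow> 'a" where
  "coframe x = left_deriv (- x) x"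

lemma linear_frame: "linear (frame x)" and linear_coframe: "linear (coframe x)"
  by (simp_all add: frame_def coframe_def linear_left_deriv)

lemma coframe_frame: "coframe x (frame x h) = h"
  using left_deriv_chain[of "- x" x 0 h] by (simp add: coframe_def frame_def)

lemma frame_coframe: "frame x (coframe x h) = h"
  using left_deriv_chain[of x "- x" x h] by (simp add: coframe_def frame_def)

text \<open>Left translation by \<open>a\<close> near \<open>y\<close> is left translation by \<open>- y\<close> followed by the one by \<open>a y\<close>. So the
determinants of frames and coframes decide about the invariance of Lebesgue measure.\<close>

lemma left_deriv_eq_frame_coframe: "left_deriv a y h = frame (mul a y) (coframe y h)"
  using left_deriv_chain[of a y 0 "coframe y h"] by (simp add: frame_coframe flip: frame_def)

text \<open>The curve \<open>t \<mapsto> (1 + t) x\<close> is \<open>x\<close> times a one-parameter subgroup, so its velocity is the value at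
\<open>x\<close> of the left-invariant field of \<open>x\<close>.\<close>

lemma frame_self: "frame x x = x"
proof -
  have 1: "((\<lambda>t. mul x (t *\<^sub>R x)) has_derivative (\<lambda>h. left_deriv x (0 *\<^sub>R x) (h *\<^sub>R x))) (at 0)"
    by (rule has_derivative_compose[OF _ has_derivative_mul_left]) (auto intro!: derivative_eq_intros)
  have eq: "(\<lambda>t. mul x (t *\<^sub>R x)) = (\<lambda>t. (1 + t) *\<^sub>R x)"
    using exp_coordinates[of 1 x] by (simp add: fun_eq_iff)
  have 2: "((\<lambda>t. mul x (t *\<^sub>R x)) has_derivative (\<lambda>h. h *\<^sub>R x)) (at 0)"
    unfolding eq by (auto intro!: derivative_eq_intros)
  from fun_cong[OF has_derivative_unique[OF 1 2], of 1] show ?thesis by (simp add: frame_def)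
qed

text \<open>Inversion is \<open>x \<mapsto> - x\<close> and exchanges left and right translations, so derivatives of right translations
are frames as well.\<close>

lemma right_deriv_eq_frame:
  "frechet_derivative (\<lambda>(x, y). mul x y) (at (0, x)) (v, 0) = frame (- x) v"
proof -
  have 1: "((\<lambda>y. mul y x) has_derivative
      (\<lambda>h. frechet_derivative (\<lambda>(x, y). mul x y) (at (0, x)) (h, 0))) (at 0)"
    by (rule has_derivative_mul[OF has_derivative_ident has_derivative_const])
  have "((\<lambda>y. - mul (- x) (- y)) has_derivative (\<lambda>h. - left_deriv (- x) (- 0) (- h))) (at 0)"
    by (intro has_derivative_minus has_derivative_compose[OF _ has_derivative_mul_left]) (auto intro!: derivative_intros)
  moreover have "(\<lambda>y. - mul (- x) (- y)) = (\<lambda>y. mul y x)"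
    using G.inverse_distrib_swap[of "- x" "- _"] by (simp add: fun_eq_iff)
  ultimately have 2: "((\<lambda>y. mul y x) has_derivative (\<lambda>h. - left_deriv (- x) (- 0) (- h))) (at 0)"
    by (simp only:)
  show ?thesis
    using fun_cong[OF has_derivative_unique[OF 1 2], of v]
    by (simp add: frame_def linear_neg[OF linear_left_deriv])
qed

text \<open>The derivative at the identity of the left-invariant field of \<open>v\<close> in direction \<open>w\<close>: the bilinear part
of the group law.\<close>

definition frame_deriv :: "'a \<Rightarrow> 'a \<Rightarrow> 'a" where
  "frame_deriv w v = frechet_derivative (\<lambda>x. frame x v) (at 0) w"

lemma frame_has_derivative: "((\<lambda>x. frame x v) has_derivative (\<lambda>w. frame_deriv w v)) (at 0)"
proof -
  have "(\<lambda>x. frechet_derivative (\<lambda>(x, y). mul x y) (at (x, 0)) (0, v)) differentiable (at 0)"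
    by (rule differentiable_compose[OF mul_derivative_differentiable])
      (auto intro!: differentiableI derivative_intros)
  then show ?thesis
    unfolding frame_deriv_def
    by (simp add: frame_def[abs_def] left_deriv_def[abs_def] frechet_derivative_works)
qed

lemma frame_deriv_bracket: "brk u v = frame_deriv u v - frame_deriv v u"
proof -
  have eq: "left_invariant_field mul v = (\<lambda>x. frame x v)" for v
    using frechet_derivative_at[OF has_derivative_mul_left[of _ 0]]
    by (simp add: fun_eq_iff left_invariant_field_def frame_def)
  have "frame 0 v = v" for v by (simp add: frame_def)
  then show ?thesis
    unfolding lie_algebra_of_mul eq vector_field_bracket_def by (simp add: frame_deriv_def)
qed

lemma frame_deriv_add_right: "frame_deriv w (u + v) = frame_deriv w u + frame_deriv w v"
proof -
  have 1: "((\<lambda>x. frame x u + frame x v) has_derivative (\<lambda>w. frame_deriv w u + frame_deriv w v)) (at 0)"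
    by (intro has_derivative_add frame_has_derivative)
  have "(\<lambda>x. frame x u + frame x v) = (\<lambda>x. frame x (u + v))"
    by (simp add: linear_add[OF linear_frame])
  with frame_has_derivative[of "u + v"]
  have 2: "((\<lambda>x. frame x u + frame x v) has_derivative (\<lambda>w. frame_deriv w (u + v))) (at 0)" by (simp only:)
  show ?thesis
    using fun_cong[OF has_derivative_unique[OF 2 1], of w] .
qed

lemma frame_deriv_add_left: "frame_deriv (u + v) w = frame_deriv u w + frame_deriv v w"
  using linear_add[OF has_derivative_linear[OF frame_has_derivative[of w]]] .

text \<open>By \<open>frame_self\<close> the field of \<open>w\<close> is constant along the line through \<open>w\<close>.\<close>

lemma frame_deriv_self: "frame_deriv w w = 0"
proof -
  have "frame (h *\<^sub>R w) w = w" for h :: real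
    using frame_self[of "h *\<^sub>R w"] linear_scale[OF linear_frame, of "h *\<^sub>R w" h w]
    by (cases "h = 0") (auto simp: frame_def)
  then have c: "(\<lambda>h::real. frame (h *\<^sub>R w) w) = (\<lambda>h. w)" by (simp add: fun_eq_iff)
  have "((\<lambda>h::real. frame (h *\<^sub>R w) w) has_derivative (\<lambda>h. frame_deriv (h *\<^sub>R w) w)) (at 0)"
    by (rule has_derivative_compose[where g="\<lambda>x. frame x w" and f="\<lambda>h::real. h *\<^sub>R w"])
      (auto intro!: derivative_eq_intros frame_has_derivative)
  then have "(\<lambda>h::real. frame_deriv (h *\<^sub>R w) w) = (\<lambda>h. 0)"
    unfolding c by (rule has_derivative_unique[OF _ has_derivative_const])
  from fun_cong[OF this, of 1] show ?thesis by simp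
qed

text \<open>\<open>frame_deriv\<close> is alternating by \<open>frame_deriv_self\<close>, so its two terms in the bracket agree. This is
the first nontrivial term of the Baker--Campbell--Hausdorff series.\<close>

lemma bracket_eq_frame_deriv: "brk w v = 2 *\<^sub>R frame_deriv w v"
proof -
  have "frame_deriv (w + v) (w + v) = frame_deriv w v + frame_deriv v w"
    by (simp only: frame_deriv_add_left frame_deriv_add_right) (simp add: frame_deriv_self)
  then have "frame_deriv w v + frame_deriv v w = 0"
    by (metis frame_deriv_self)
  then have "frame_deriv v w = - frame_deriv w v" by (simp add: add_eq_0_iff)
  then show ?thesis
    unfolding frame_deriv_bracket by (simp add: scaleR_2)
qed

text \<open>The differential of the exponential map at \<open>t w\<close> in direction \<open>t u\<close>, translated back to the identity. It is
studied as a function of \<open>t\<close>.\<close>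

definition exp_curve :: "'a \<Rightarrow> 'a \<Rightarrow> real \<Rightarrow> 'a" where
  "exp_curve w u t = coframe (t *\<^sub>R w) (t *\<^sub>R u)"

text \<open>The increments of \<open>exp_curve\<close> follow from the identity
\<open>(- (t + h) w) \<cdot> ((t + h) z) = (- h w) \<cdot> ((- t w) \<cdot> (t z)) \<cdot> (h z)\<close>, differentiated in \<open>z\<close> at \<open>w\<close> in
direction \<open>u\<close>. The map \<open>coframe (h w) \<circ> frame (- h w)\<close> on the right-hand side is conjugation by
\<open>- h w\<close>, differentiated at the identity.\<close>

lemma exp_curve_add:
  "exp_curve w u (t + h) =
     coframe (h *\<^sub>R w) (frame (- (h *\<^sub>R w)) (exp_curve w u t) + h *\<^sub>R u)"
proof -
  define g where "g t s = mul (- (t *\<^sub>R w)) (t *\<^sub>R (w + s *\<^sub>R u))" for t s :: real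
  have lin: "((\<lambda>s. t *\<^sub>R (w + s *\<^sub>R u)) has_derivative (\<lambda>s. s *\<^sub>R (t *\<^sub>R u))) (at 0)" for t :: real
    by (auto intro!: derivative_eq_intros simp: mult.commute)
  have g': "(g t has_derivative (\<lambda>s. s *\<^sub>R exp_curve w u t)) (at 0)" for t
    unfolding g_def exp_curve_def coframe_def
    using has_derivative_compose[OF lin[of t] has_derivative_mul_left[of "- (t *\<^sub>R w)"]]
    by (simp add: linear_scale[OF linear_left_deriv])
  have g0: "g t 0 = 0" for t
    by (simp add: g_def)
  have geq: "g (t + h) s = mul (- (h *\<^sub>R w)) (mul (g t s) (h *\<^sub>R (w + s *\<^sub>R u)))" for s
  proof -
    have "- ((t + h) *\<^sub>R w) = mul (- (h *\<^sub>R w)) (- (t *\<^sub>R w))"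
      using exp_coordinates[of "- h" w "- t"] by (simp add: algebra_simps)
    moreover have "(t + h) *\<^sub>R (w + s *\<^sub>R u) = mul (t *\<^sub>R (w + s *\<^sub>R u)) (h *\<^sub>R (w + s *\<^sub>R u))"
      by (rule exp_coordinates[symmetric])
    ultimately show ?thesis
      by (simp only: g_def G.assoc)
  qed
  have "((\<lambda>s. mul (g t s) (h *\<^sub>R (w + s *\<^sub>R u))) has_derivative
      (\<lambda>s. frechet_derivative (\<lambda>(x, y). mul x y) (at (0, h *\<^sub>R w)) (s *\<^sub>R exp_curve w u t, s *\<^sub>R h *\<^sub>R u))) (at 0)"
    using has_derivative_mul[OF g'[of t] lin[of h]] by (simp add: g0)
  moreover have "frechet_derivative (\<lambda>(x, y). mul x y) (at (0, h *\<^sub>R w)) (s *\<^sub>R a, s *\<^sub>R h *\<^sub>R u)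
      = s *\<^sub>R (frame (- (h *\<^sub>R w)) a + h *\<^sub>R u)" for s a
  proof -
    have "(s *\<^sub>R a, s *\<^sub>R h *\<^sub>R u) = s *\<^sub>R ((a, 0) + (0, h *\<^sub>R u))" by simp
    then show ?thesis
      by (simp only: linear_scale[OF linear_mul_derivative] linear_add[OF linear_mul_derivative]
          right_deriv_eq_frame) (simp flip: left_deriv_def)
  qed
  ultimately have 1: "((\<lambda>s. mul (g t s) (h *\<^sub>R (w + s *\<^sub>R u))) has_derivative
      (\<lambda>s. s *\<^sub>R (frame (- (h *\<^sub>R w)) (exp_curve w u t) + h *\<^sub>R u))) (at 0)"
    by simp
  have "(g (t + h) has_derivative
      (\<lambda>s. s *\<^sub>R coframe (h *\<^sub>R w) (frame (- (h *\<^sub>R w)) (exp_curve w u t) + h *\<^sub>R u))) (at 0)"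
    unfolding geq[abs_def] coframe_def
    using has_derivative_compose[OF 1 has_derivative_mul_left[of "- (h *\<^sub>R w)"]]
    by (simp add: g0 linear_scale[OF linear_left_deriv])
  with g'[of "t + h"] have "(\<lambda>s. s *\<^sub>R exp_curve w u (t + h)) =
      (\<lambda>s. s *\<^sub>R coframe (h *\<^sub>R w) (frame (- (h *\<^sub>R w)) (exp_curve w u t) + h *\<^sub>R u))"
    by (rule has_derivative_unique)
  from fun_cong[OF this, of 1] show ?thesis by simp
qed

text \<open>The equation \<open>p' = u - [w, p]\<close> for the differential of the exponential map. Writing \<open>v = p t\<close> as
\<open>coframe (h w) (frame (h w) v)\<close> turns the difference quotient into \<open>coframe (h w)\<close> applied to
\<open>(frame (- h w) v - frame (h w) v) / h + u\<close>, and the limit follows from the derivative of the frame at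
the identity and the continuity of the coframe.\<close>

lemma exp_curve_ode:
  "(exp_curve w u has_vector_derivative (u - brk w (exp_curve w u t))) (at t)"
  unfolding has_vector_derivative_at_quotient
proof -
  define v where "v = exp_curve w u t"
  have fr: "((\<lambda>h. (frame (h *\<^sub>R a) v - v) /\<^sub>R h) \<longlongrightarrow> frame_deriv a v) (at 0)" for a
  proof -
    have "((\<lambda>h::real. frame (h *\<^sub>R a) v) has_derivative (\<lambda>h. frame_deriv (h *\<^sub>R a) v)) (at 0)"
      by (rule has_derivative_compose[where g="\<lambda>x. frame x v" and f="\<lambda>h::real. h *\<^sub>R a"])
        (auto intro!: derivative_eq_intros frame_has_derivative)
    then have "((\<lambda>h. frame (h *\<^sub>R a) v) has_vector_derivative frame_deriv a v) (at 0)"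
      unfolding has_vector_derivative_def
      by (simp add: linear_scale[OF has_derivative_linear[OF frame_has_derivative[of v]]])
    then show ?thesis
      unfolding has_vector_derivative_at_quotient by (simp add: frame_def)
  qed
  have neg: "frame_deriv (- w) v = - frame_deriv w v"
    using linear_neg[OF has_derivative_linear[OF frame_has_derivative[of v]]] .
  have q: "((\<lambda>h. (frame (h *\<^sub>R (- w)) v - v) /\<^sub>R h - (frame (h *\<^sub>R w) v - v) /\<^sub>R h + u)
      \<longlongrightarrow> u - brk w v) (at 0)"
  proof -
    have "u - brk w v = frame_deriv (- w) v - frame_deriv w v + u"
      unfolding bracket_eq_frame_deriv neg by (simp add: scaleR_2)
    then show ?thesis
      by (simp only:) (intro tendsto_intros fr)
  qed
  have lim: "((\<lambda>h. coframe (h *\<^sub>R w)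
      ((frame (h *\<^sub>R (- w)) v - v) /\<^sub>R h - (frame (h *\<^sub>R w) v - v) /\<^sub>R h + u))
      \<longlongrightarrow> u - brk w v) (at 0)"
  proof -
    have "((\<lambda>h. h *\<^sub>R w) \<longlongrightarrow> 0 *\<^sub>R w) (at 0)"
      by (intro tendsto_intros)
    then have "((\<lambda>h. h *\<^sub>R w) \<longlongrightarrow> 0) (at 0)" and "((\<lambda>h. - (h *\<^sub>R w)) \<longlongrightarrow> 0) (at 0)"
      using tendsto_minus by fastforce+
    from tendsto_left_deriv[OF this(2,1) q] show ?thesis
      by (simp add: coframe_def)
  qed
  have ev: "\<forall>\<^sub>F h in at 0. coframe (h *\<^sub>R w)
      ((frame (h *\<^sub>R (- w)) v - v) /\<^sub>R h - (frame (h *\<^sub>R w) v - v) /\<^sub>R h + u)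
      = (exp_curve w u (t + h) - exp_curve w u t) /\<^sub>R h"
  proof -
    have "coframe (h *\<^sub>R w)
      ((frame (h *\<^sub>R (- w)) v - v) /\<^sub>R h - (frame (h *\<^sub>R w) v - v) /\<^sub>R h + u)
      = (exp_curve w u (t + h) - exp_curve w u t) /\<^sub>R h" if "h \<noteq> 0" for h
    proof -
      have "exp_curve w u t = coframe (h *\<^sub>R w) (frame (h *\<^sub>R w) v)"
        by (simp add: coframe_frame v_def)
      then have "exp_curve w u (t + h) - exp_curve w u t
        = coframe (h *\<^sub>R w) (frame (h *\<^sub>R (- w)) v + h *\<^sub>R u - frame (h *\<^sub>R w) v)"
        unfolding exp_curve_add by (simp add: v_def linear_diff[OF linear_coframe])
      moreover have "(frame (h *\<^sub>R (- w)) v - v) /\<^sub>R h - (frame (h *\<^sub>R w) v - v) /\<^sub>R h + u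
        = (frame (h *\<^sub>R (- w)) v + h *\<^sub>R u - frame (h *\<^sub>R w) v) /\<^sub>R h"
        using that by (simp add: algebra_simps)
      ultimately show ?thesis
        by (simp only: linear_scale[OF linear_coframe])
    qed
    then show ?thesis by (simp add: eventually_at_filter)
  qed
  show "((\<lambda>h. (exp_curve w u (t + h) - exp_curve w u t) /\<^sub>R h) \<longlongrightarrow>
      u - brk w (exp_curve w u t)) (at 0)"
    using Lim_transform_eventually[OF lim ev] by (simp only: v_def)
qed

text \<open>A homomorphism \<open>T\<close> of the Lie algebra maps the equation of \<open>exp_curve w u\<close> to that of
\<open>exp_curve (T w) (T u)\<close>; both solutions start at 0, so they agree.\<close>

lemma coframe_automorphism:
  assumes T: "linear T" and brkT: "\<And>u v. T (brk u v) = brk (T u) (T v)"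
  shows "coframe (T w) (T u) = T (coframe w u)"
proof -
  define y where "y = (\<lambda>t. T (exp_curve w u t) - exp_curve (T w) (T u) t)"
  have linb: "linear (brk a)" for a using bilinear_brk by (simp add: bilinear_def)
  have "(y has_vector_derivative - brk (T w) (y t)) (at t)" for t
  proof -
    have "((\<lambda>t. T (exp_curve w u t)) has_vector_derivative T (u - brk w (exp_curve w u t))) (at t)"
      using bounded_linear.has_vector_derivative[OF _ exp_curve_ode] T
      by (simp add: linear_conv_bounded_linear)
    then have "(y has_vector_derivative T (u - brk w (exp_curve w u t)) - (T u - brk (T w) (exp_curve (T w) (T u) t))) (at t)"
      unfolding y_def by (intro has_vector_derivative_diff exp_curve_ode)
    then show ?thesis
      by (simp add: y_def linear_diff[OF T] linear_diff[OF linb] brkT)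
  qed
  moreover have "linear (\<lambda>a. - brk (T w) a)"
    using linb by (intro linear_compose_neg) 
  moreover have "y 0 = 0"
    by (simp add: y_def exp_curve_def linear_0[OF linear_coframe] linear_0[OF T])
  ultimately have "y 1 = 0"
    using linear_ode_zero_unique[of "\<lambda>a. - brk (T w) a" y 1] by auto
  then show ?thesis by (simp add: y_def exp_curve_def)
qed

end


section \<open>Dilations, invariance of Lebesgue measure, and the measure of balls\<close>

context stratified_lie_algebra
begin

lemma linear_brk_right: "linear (brk a)" and linear_brk_left: "linear (\<lambda>a. brk a c)"
  using bilinear_brk by (simp_all add: bilinear_def)

lemma brk_anticommute: "brk y x = - brk x y"
proof -
  have "brk (x + y) (x + y) = brk x y + brk y x"
    by (simp only: linear_add[OF linear_brk_right] linear_add[OF linear_brk_left]) (simp add: brk_self)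
  then have "brk y x + brk x y = 0" by (simp add: brk_self add.commute)
  then show ?thesis by (simp add: eq_neg_iff_add_eq_0)
qed

text \<open>The layers extended by zero beyond the last one, so that \<open>[V i, V j] \<subseteq> V (i + j)\<close> can be stated for all
\<open>i\<close> and \<open>j\<close>.\<close>

definition layer :: "nat \<Rightarrow> 'a set" where
  "layer j = (if j \<le> m then V j else {0})"

lemma subspace_layer': "1 \<le> j \<Longrightarrow> subspace (layer j)"
  using subspace_layer[of j] by (auto simp: layer_def subspace_0)

lemma brk_first_layer:
  assumes "1 \<le> j" "u \<in> layer 1" "v \<in> layer j"
  shows "brk u v \<in> layer (Suc j)"
proof -
  have u: "u \<in> V 1" using assms m_pos by (simp add: layer_def)
  consider "j < m" | "j = m" | "j > m" by linarith
  then show ?thesis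
  proof cases
    case 1
    then have "brk u v \<in> span {brk u v | u v. u \<in> V 1 \<and> v \<in> V j}"
      using assms u by (intro span_base) (auto simp: layer_def)
    then show ?thesis
      using brk_layer[of j] assms 1 by (simp add: layer_def)
  next
    case 2
    then show ?thesis using brk_last assms u by (simp add: layer_def)
  next
    case 3
    then show ?thesis using assms linear_0[OF linear_brk_right] by (simp add: layer_def)
  qed
qed

text \<open>Induction on \<open>i\<close>: the layer \<open>i + 1\<close> is spanned by brackets \<open>[a, c]\<close> with \<open>a\<close> in the first layer, and the
Jacobi identity writes \<open>[[a, c], v]\<close> as \<open>[a, [c, v]] + [c, [v, a]]\<close>.\<close>

lemma brk_layers:
  "1 \<le> i \<Longrightarrow> 1 \<le> j \<Longrightarrow> u \<in> layer i \<Longrightarrow> v \<in> layer j \<Longrightarrow> brk u v \<in> layer (i + j)"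
proof (induction i arbitrary: j u v rule: nat_induct_at_least)
  case base
  then show ?case using brk_first_layer by simp
next
  case (Suc i)
  have sub: "subspace (layer (Suc i + j))" by (rule subspace_layer') simp
  show ?case
  proof (cases "Suc i \<le> m")
    case False
    then have "u = 0" using Suc.prems by (simp add: layer_def)
    then show ?thesis using linear_0[OF linear_brk_left] subspace_0[OF sub] by simp
  next
    case True
    have "subspace {u. brk u v \<in> layer (Suc i + j)}"
      using sub unfolding subspace_def
      by (auto simp: linear_0[OF linear_brk_left] linear_add[OF linear_brk_left] linear_scale[OF linear_brk_left])
    moreover have "brk (brk a c) v \<in> layer (Suc i + j)" if "a \<in> V 1" "c \<in> V i" for a c
    proof -
      have a: "a \<in> layer 1" and c: "c \<in> layer i" using that True m_pos by (auto simp: layer_def)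
      have 1: "brk a (brk c v) \<in> layer (Suc i + j)"
        using brk_first_layer[of "i + j", OF _ a] Suc.IH[of j c v] c Suc.prems Suc.hyps by simp
      have "- brk a v \<in> layer (Suc j)"
        using brk_first_layer[OF _ a] Suc.prems by (intro subspace_neg subspace_layer') auto
      then have 2: "brk c (brk v a) \<in> layer (Suc i + j)"
        using Suc.IH[of "Suc j" c "brk v a"] c brk_anticommute[of v a] by simp
      have "brk (brk a c) v = brk a (brk c v) + brk c (brk v a)"
        using jacobi[of a c v] brk_anticommute[of "brk a c" v] by (simp add: add_eq_0_iff)
      then show ?thesis using 1 2 sub by (simp add: subspace_add)
    qed
    ultimately have "span {brk u v |u v. u \<in> V 1 \<and> v \<in> V i} \<subseteq> {u. brk u v \<in> layer (Suc i + j)}"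
      by (intro span_minimal) auto
    then show ?thesis
      using brk_layer[of i] Suc True by (auto simp: layer_def)
  qed
qed

lemma layer_component_sum:
  assumes "\<And>j. j \<in> {1..m} \<Longrightarrow> v j \<in> V j" and "j \<in> {1..m}"
  shows "layer_component V m (\<Sum>j=1..m. v j) j = v j"
proof -
  have "layer_component V m (\<Sum>j=1..m. v j) = restrict v {1..m}"
    unfolding layer_component_def
    by (rule the1_equality[OF direct_sum]) (use assms in auto)
  then show ?thesis using assms by simp
qed

lemma layer_component: "j \<in> {1..m} \<Longrightarrow> layer_component V m x j \<in> V j"
  and sum_layer_component: "(\<Sum>j=1..m. layer_component V m x j) = x"
  using theI'[OF direct_sum[of x]] unfolding layer_component_def by (auto simp: PiE_mem)

lemma dilation_sum:
  assumes "\<And>j. j \<in> {1..m} \<Longrightarrow> v j \<in> V j"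
  shows "dilation V m r (\<Sum>j=1..m. v j) = (\<Sum>j=1..m. r ^ j *\<^sub>R v j)"
  unfolding dilation_def by (intro sum.cong refl) (simp only: layer_component_sum[OF assms])

lemma linear_dilation: "linear (dilation V m r)"
proof (rule linearI)
  fix x y c
  note comp = layer_component
  have "dilation V m r (\<Sum>j=1..m. layer_component V m x j + layer_component V m y j) =
      dilation V m r x + dilation V m r y"
    using comp by (subst dilation_sum)
      (auto simp: dilation_def scaleR_add_right sum.distrib intro!: subspace_add subspace_layer)
  then show "dilation V m r (x + y) = dilation V m r x + dilation V m r y"
    by (simp only: sum.distrib sum_layer_component)
  have "dilation V m r (\<Sum>j=1..m. c *\<^sub>R layer_component V m x j) = c *\<^sub>R dilation V m r x"
    using comp by (subst dilation_sum)
      (auto simp: dilation_def scaleR_sum_right mult.commute intro!: subspace_scale subspace_layer)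
  then show "dilation V m r (c *\<^sub>R x) = c *\<^sub>R dilation V m r x"
    by (simp only: sum_layer_component flip: scaleR_sum_right)
qed

lemma dilation_layer:
  assumes "j \<in> {1..m}" "v \<in> V j"
  shows "dilation V m r v = r ^ j *\<^sub>R v"
proof -
  have "dilation V m r (\<Sum>i=1..m. if i = j then v else 0) = (\<Sum>i=1..m. r ^ i *\<^sub>R (if i = j then v else 0))"
    using assms by (intro dilation_sum) (auto simp: subspace_0 subspace_layer)
  moreover have "(\<Sum>i=1..m. r ^ i *\<^sub>R (if i = j then v else 0)) = r ^ j *\<^sub>R v"
    using assms by (simp add: if_distrib[where f="\<lambda>x. _ *\<^sub>R x"] sum.delta cong: if_cong)
  ultimately show ?thesis using assms by (simp add: sum.delta)
qed

lemma dilation_dilation: "dilation V m r (dilation V m s x) = dilation V m (r * s) x"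
proof -
  have "dilation V m r (\<Sum>j=1..m. s ^ j *\<^sub>R layer_component V m x j) = dilation V m (r * s) x"
    using layer_component by (subst dilation_sum)
      (auto simp: dilation_def power_mult_distrib intro!: subspace_scale subspace_layer)
  then show ?thesis by (simp add: dilation_def)
qed

lemma dilation_1: "dilation V m 1 x = x"
  by (simp only: dilation_def sum_layer_component power_one scaleR_one)

lemma dilation_0: "dilation V m 0 x = 0"
  unfolding dilation_def by (intro sum.neutral) auto

lemma continuous_dilation: "continuous_on S (\<lambda>r. dilation V m r x)"
  unfolding dilation_def by (intro continuous_intros)

text \<open>Dilations are homomorphisms of the Lie algebra, because the bracket adds the degrees of layers.\<close>

lemma dilation_brk: "dilation V m r (brk u v) = brk (dilation V m r u) (dilation V m r v)"
proof -
  note lin = linear_sum[OF linear_brk_left] linear_sum[OF linear_brk_right]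
    linear_scale[OF linear_brk_left] linear_scale[OF linear_brk_right]
  have *: "dilation V m r (brk a c) = brk (r ^ i *\<^sub>R a) (r ^ j *\<^sub>R c)"
    if "i \<in> {1..m}" "j \<in> {1..m}" "a \<in> V i" "c \<in> V j" for i j a c
  proof (cases "i + j \<le> m")
    case True
    have "brk a c \<in> V (i + j)"
      using brk_layers[of i j a c] that True by (simp add: layer_def)
    then have "dilation V m r (brk a c) = r ^ (i + j) *\<^sub>R brk a c"
      using that True by (intro dilation_layer) auto
    then show ?thesis by (simp add: lin power_add)
  next
    case False
    have "brk a c = 0"
      using brk_layers[of i j a c] that False by (simp add: layer_def)
    then show ?thesis by (simp add: lin linear_0[OF linear_dilation])
  qed
  have "brk u v = (\<Sum>i=1..m. \<Sum>j=1..m. brk (layer_component V m u i) (layer_component V m v j))"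
    by (simp only: sum_layer_component flip: lin(1,2))
  then have "dilation V m r (brk u v) =
      (\<Sum>i=1..m. \<Sum>j=1..m. brk (r ^ i *\<^sub>R layer_component V m u i) (r ^ j *\<^sub>R layer_component V m v j))"
    using layer_component by (simp add: linear_sum[OF linear_dilation] *)
  also have "\<dots> = brk (dilation V m r u) (dilation V m r v)"
    unfolding dilation_def by (simp only: lin(1)) (simp only: lin(2))
  finally show ?thesis .
qed

lemma ldet_dilation: "ldet (dilation V m r) = r ^ homogeneous_dimension V m"
proof -
  have "ldet (dilation V m r) = (\<Prod>j\<in>{1..m}. (r ^ j) ^ dim (V j))"
    by (rule ldet_scalar_on_layers)
      (use linear_dilation subspace_layer direct_sum dilation_layer in auto)
  then show ?thesis
    by (simp add: homogeneous_dimension_def power_sum power_mult)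
qed

lemma homogeneous_dimension_pos: "0 < homogeneous_dimension V m"
proof (rule ccontr)
  assume "\<not> 0 < homogeneous_dimension V m"
  then have "dim (V j) = 0" if "j \<in> {1..m}" for j
    using that by (auto simp: homogeneous_dimension_def)
  then have "V j \<subseteq> {0}" if "j \<in> {1..m}" for j
    using that by (simp add: dim_eq_0)
  then have "layer_component V m x j = 0" if "j \<in> {1..m}" for x :: 'a and j
    using layer_component that by blast
  then have "x = 0" for x :: 'a
    using sum_layer_component[of x] by (metis (no_types, lifting) sum.neutral)
  then show False using nonempty_Basis nonzero_Basis by blast
qed

end

context stratified_group
begin

interpretation G: Groups.group mul 0 uminus
  by (rule group_mul)

text \<open>The determinant does not change along \<open>dilation V m r x\<close> by \<open>coframe_automorphism\<close>, and this point
tends to the identity as \<open>r\<close> tends to 0.\<close>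

lemma ldet_coframe: "ldet (coframe x) = 1"
proof -
  have "ldet (coframe (dilation V m r x)) = ldet (coframe x)" if "r > 0" for r
  proof -
    have "coframe (dilation V m r x) \<circ> dilation V m r = dilation V m r \<circ> coframe x"
      using coframe_automorphism[OF linear_dilation dilation_brk] by (simp add: fun_eq_iff)
    then have "ldet (coframe (dilation V m r x)) * ldet (dilation V m r) =
        ldet (dilation V m r) * ldet (coframe x)"
      by (simp only: ldet_compose[OF linear_coframe linear_dilation, symmetric]
        ldet_compose[OF linear_dilation linear_coframe, symmetric])
    then show ?thesis using that by (simp add: ldet_dilation)
  qed
  then have "((\<lambda>r. ldet (coframe (dilation V m r x))) \<longlongrightarrow> ldet (coframe x)) (at_right 0)"
    by (intro tendsto_eventually) (simp add: eventually_at_filter)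
  moreover have "((\<lambda>r. ldet (coframe (dilation V m r x))) \<longlongrightarrow> ldet (coframe (dilation V m 0 x))) (at_right 0)"
  proof (rule tendsto_ldet)
    fix v
    have "((\<lambda>r. dilation V m r x) \<longlongrightarrow> dilation V m 0 x) (at_right 0)"
      unfolding dilation_def by (intro tendsto_intros)
    then show "((\<lambda>r. coframe (dilation V m r x) v) \<longlongrightarrow> coframe (dilation V m 0 x) v) (at_right 0)"
      unfolding coframe_def by (intro tendsto_left_deriv tendsto_minus tendsto_const)
  qed
  ultimately have "ldet (coframe x) = ldet (coframe (dilation V m 0 x))"
    by (intro tendsto_unique[of "at_right (0::real)"]) auto
  also have "coframe (dilation V m 0 x) = (\<lambda>v. v)"
    by (simp add: dilation_0 coframe_def fun_eq_iff)
  finally show ?thesis by (simp add: ldet_id)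
qed

lemma ldet_left_deriv: "ldet (left_deriv a y) = 1"
proof -
  have "frame (mul a y) \<circ> coframe (mul a y) = (\<lambda>v. v)"
    by (simp add: fun_eq_iff frame_coframe)
  then have "ldet (frame (mul a y)) = 1"
    using ldet_compose[OF linear_frame linear_coframe, of "mul a y" "mul a y"] by (simp add: ldet_id ldet_coframe)
  moreover have "left_deriv a y = frame (mul a y) \<circ> coframe y"
    by (simp add: fun_eq_iff left_deriv_eq_frame_coframe)
  ultimately show ?thesis
    by (simp add: ldet_compose[OF linear_frame linear_coframe] ldet_coframe)
qed

lemma continuous_on_mul:
  assumes "continuous_on S f" "continuous_on S g"
  shows "continuous_on S (\<lambda>x. mul (f x) (g x))"
  using continuous_on_compose2[OF continuous_mul continuous_on_Pair[OF assms]] by simp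

lemma emeasure_left_translate:
  assumes S: "open S" "bounded S"
  shows "emeasure lebesgue (mul a ` S) = emeasure lebesgue S"
proof -
  have "mul a ` S = mul (- a) -` S"
  proof (intro set_eqI iffI)
    fix y assume "y \<in> mul (- a) -` S"
    moreover have "y = mul a (mul (- a) y)" by (simp flip: G.assoc)
    ultimately show "y \<in> mul a ` S" by blast
  qed (auto simp flip: G.assoc)
  moreover have "open (mul (- a) -` S)"
    using S by (intro open_vimage continuous_on_mul continuous_intros)
  ultimately have "mul a ` S \<in> sets borel" by simp
  moreover have "emeasure lebesgue S < \<infinity>"
    using S emeasure_bounded_finite[of S] by (simp add: less_top)
  moreover have "inj_on (mul a) S"
    by (auto simp: inj_on_def G.left_cancel)
  ultimately have "emeasure lebesgue (mul a ` S) = ennreal 1 * emeasure lebesgue S"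
    using S has_derivative_mul_left ldet_left_deriv
    by (intro emeasure_image_const_det[where T'="left_deriv a"]) auto
  then show ?thesis by simp
qed


lemma group_ball_eq_translate: "group_ball mul \<rho> z r = mul z ` {x. \<rho> x < r}"
  if "\<And>x. \<rho> (- x) = \<rho> x"
proof (intro set_eqI iffI)
  fix y assume "y \<in> group_ball mul \<rho> z r"
  then have "\<rho> (mul (- z) y) < r"
    using that[of "mul (- y) z"] by (simp add: group_ball_def G.inverse_distrib_swap)
  moreover have "y = mul z (mul (- z) y)" by (simp flip: G.assoc)
  ultimately show "y \<in> mul z ` {x. \<rho> x < r}" by blast
next
  fix y assume "y \<in> mul z ` {x. \<rho> x < r}"
  then obtain x where "y = mul z x" "\<rho> x < r" by auto
  then show "y \<in> group_ball mul \<rho> z r"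
    using that[of x] by (simp add: group_ball_def G.inverse_distrib_swap G.assoc)
qed

context
  fixes \<rho>
  assumes hom: "homogeneous_norm V m mul \<rho>"
begin

lemma
  shows norm_nonneg: "0 \<le> \<rho> x"
    and norm_continuous: "continuous_on UNIV \<rho>"
    and norm_neg: "\<rho> (- x) = \<rho> x"
    and norm_dilation: "t > 0 \<Longrightarrow> \<rho> (dilation V m t x) = t * \<rho> x"
    and norm_zero_iff: "\<rho> x = 0 \<longleftrightarrow> x = 0"
  using hom unfolding homogeneous_norm_def by blast+

lemma open_norm_ball: "open {x. \<rho> x < r}"
  using norm_continuous by (intro open_Collect_less continuous_intros)

lemma norm_ball_dilation:
  assumes "r > 0"
  shows "{x. \<rho> x < r * s} = dilation V m r ` {x. \<rho> x < s}"
proof (intro set_eqI iffI)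
  fix y assume y: "y \<in> {x. \<rho> x < r * s}"
  have "\<rho> (dilation V m (1 / r) y) < s"
    using norm_dilation[of "1 / r" y] y assms by (simp add: divide_less_eq mult.commute)
  moreover have "y = dilation V m r (dilation V m (1 / r) y)"
    using assms by (simp add: dilation_dilation dilation_1)
  ultimately show "y \<in> dilation V m r ` {x. \<rho> x < s}" by blast
qed (use assms norm_dilation in auto)

text \<open>Let \<open>k\<close> be the minimum of \<open>\<rho>\<close> on the Euclidean unit sphere. A point outside the unit ball has a dilate
with factor \<open>t \<le> 1\<close> on the sphere, so \<open>\<rho>\<close> is at least \<open>k / t\<close> at that point. Thus the ball of
radius \<open>k\<close> is bounded, and every other ball is a dilate of it.\<close>

lemma bounded_norm_ball: "bounded {x. \<rho> x < r}"
proof -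
  have "compact (sphere (0::'a) 1)" "sphere (0::'a) 1 \<noteq> {}"
    by (simp_all add: compact_sphere)
  then obtain p where p: "p \<in> sphere 0 1" "\<And>x. x \<in> sphere 0 1 \<Longrightarrow> \<rho> p \<le> \<rho> x"
    using continuous_attains_inf[of "sphere 0 1" \<rho>] norm_continuous continuous_on_subset by blast
  define k where "k = \<rho> p"
  have k: "k > 0"
    using p(1) norm_nonneg[of p] norm_zero_iff[of p] by (force simp: k_def)
  have "{x. \<rho> x < k} \<subseteq> ball 0 1"
  proof (rule ccontr)
    assume "\<not> {x. \<rho> x < k} \<subseteq> ball 0 1"
    then have "\<exists>x. \<rho> x < k \<and> \<not> norm x < 1" by auto
    then obtain x where x: "\<rho> x < k" "norm x \<ge> 1" by (auto simp only: not_less)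
    have "\<exists>t. 0 \<le> t \<and> t \<le> 1 \<and> norm (dilation V m t x) = 1"
      by (rule IVT') (use x in \<open>auto simp: dilation_0 dilation_1 intro!: continuous_intros continuous_dilation\<close>)
    then obtain t where t: "0 \<le> t" "t \<le> 1" "norm (dilation V m t x) = 1" by blast
    then have "t \<noteq> 0" by (auto simp: dilation_0)
    then have "k \<le> t * \<rho> x"
      using t p(2)[of "dilation V m t x"] norm_dilation[of t x] by (auto simp: k_def)
    also have "\<dots> \<le> \<rho> x" using t norm_nonneg[of x] by (simp add: mult_left_le_one_le)
    finally show False using x by simp
  qed
  then have bk: "bounded {x. \<rho> x < k}" using bounded_subset bounded_ball by blast
  show ?thesis
  proof (cases "r > 0")
    case True
    have eq: "{x. \<rho> x < r} = dilation V m (r / k) ` {x. \<rho> x < k}"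
      using norm_ball_dilation[of "r / k" k] True k by simp
    have "bounded_linear (dilation V m (r / k))"
      using linear_dilation by (simp only: linear_conv_bounded_linear)
    then show ?thesis
      unfolding eq by (rule bounded_linear_image[OF bk])
  next
    case False
    then have "{x. \<rho> x < r} = {}" using norm_nonneg by (metis (mono_tags, lifting) Collect_empty_eq less_le_trans not_le order.trans)
    then show ?thesis by simp
  qed
qed

lemma emeasure_norm_ball:
  assumes "r > 0"
  shows "emeasure lebesgue {x. \<rho> x < r} = ennreal (r ^ homogeneous_dimension V m) * emeasure lebesgue {x. \<rho> x < 1}"
proof -
  have eq: "{x. \<rho> x < r} = dilation V m r ` {x. \<rho> x < 1}"
    using norm_ball_dilation[of r 1] assms by simp
  have "inj (dilation V m r)"
    by (rule inj_on_inverseI[of _ "dilation V m (1 / r)"])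
      (use assms in \<open>simp add: dilation_dilation dilation_1\<close>)
  moreover have "emeasure lebesgue {x. \<rho> x < 1} < \<infinity>"
    using emeasure_bounded_finite[OF bounded_norm_ball[of 1]] open_norm_ball[of 1] by (simp add: less_top)
  moreover have "dilation V m r ` {x. \<rho> x < 1} \<in> sets borel"
    using open_norm_ball[of r] unfolding eq[symmetric] by simp
  ultimately show ?thesis
    unfolding eq using assms open_norm_ball[of 1]
    by (intro emeasure_image_const_det[where T'="\<lambda>_. dilation V m r"])
      (auto simp: linear_imp_has_derivative linear_dilation ldet_dilation intro: inj_on_subset)
qed

lemma emeasure_group_ball:
  assumes "r > 0"
  shows "emeasure lebesgue (group_ball mul \<rho> z r) =
    ennreal (measure lebesgue {x. \<rho> x < 1} * r ^ homogeneous_dimension V m)"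
proof -
  have "emeasure lebesgue {x. \<rho> x < 1} < \<infinity>"
    using emeasure_bounded_finite[OF bounded_norm_ball[of 1]] open_norm_ball[of 1] by (simp add: less_top)
  then have "emeasure lebesgue {x. \<rho> x < 1} = ennreal (measure lebesgue {x. \<rho> x < 1})"
    by (simp add: emeasure_eq_ennreal_measure)
  moreover have "emeasure lebesgue (group_ball mul \<rho> z r) = emeasure lebesgue {x. \<rho> x < r}"
    unfolding group_ball_eq_translate[of \<rho>, OF norm_neg]
    by (rule emeasure_left_translate[OF open_norm_ball bounded_norm_ball])
  ultimately have "emeasure lebesgue (group_ball mul \<rho> z r) =
      ennreal (r ^ homogeneous_dimension V m) * ennreal (measure lebesgue {x. \<rho> x < 1})"
    using emeasure_norm_ball[OF assms] by (simp only:)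
  then show ?thesis
    using ennreal_mult''[OF measure_nonneg, of "r ^ homogeneous_dimension V m" lebesgue "{x. \<rho> x < 1}"]
    by (simp only: mult.commute)
qed

lemma measure_norm_ball_pos: "measure lebesgue {x. \<rho> x < 1} > 0"
proof -
  have "emeasure lborel {x. \<rho> x < 1} \<noteq> 0"
  proof -
    have "0 \<in> {x. \<rho> x < 1}" using norm_zero_iff[of 0] by simp
    then show ?thesis
      using open_norm_ball[of 1] open_not_negligible[of "{x. \<rho> x < 1}"]
      by (auto simp: negligible_iff_emeasure0)
  qed
  moreover have "emeasure lborel {x. \<rho> x < 1} < \<infinity>"
    using emeasure_bounded_finite[OF bounded_norm_ball[of 1]] by (simp add: less_top)
  ultimately show ?thesis
    using open_norm_ball[of 1] by (simp add: measure_def enn2real_positive_iff less_top zero_less_iff_neq_zero)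
qed

end

end


section \<open>Young functions\<close>

text \<open>The superlevel sets of a monotone function are upper sets of a complete linear order, that is, intervals.\<close>

lemma borel_measurable_mono_ennreal:
  fixes f :: "ennreal \<Rightarrow> ennreal"
  assumes "mono f"
  shows "f \<in> borel_measurable borel"
proof (rule borel_measurableI_greater)
  fix t
  define S where "S = {u. t < f u}"
  have up: "v \<in> S" if "u \<in> S" "u \<le> v" for u v
    using that monoD[OF assms, of u v] by (auto simp: S_def)
  have "S = {Inf S..} \<or> S = {Inf S<..}"
  proof (cases "Inf S \<in> S")
    case True
    then show ?thesis using up by (auto intro: Inf_lower)
  next
    case False
    have "S = {Inf S<..}"
    proof (intro set_eqI iffI)
      fix u assume "u \<in> S"
      then show "u \<in> {Inf S<..}" using False Inf_lower[of u S] by (auto simp: order.order_iff_strict)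
    next
      fix u assume "u \<in> {Inf S<..}"
      then obtain v where "v \<in> S" "v < u" by (auto simp: Inf_less_iff)
      then show "u \<in> S" using up by auto
    qed
    then show ?thesis by simp
  qed
  moreover have "{Inf S..} \<in> sets borel" "{Inf S<..} \<in> sets borel" by auto
  ultimately have "S \<in> sets borel" by (metis (no_types))
  then show "{u \<in> space borel. t < f u} \<in> sets borel" by (simp add: S_def)
qed

locale young =
  fixes \<Phi> :: "real \<Rightarrow> ennreal"
  assumes young: "young_function \<Phi>"
begin

lemma zero [simp]: "\<Phi> 0 = 0"
  using young by (simp add: young_function_def)

lemma scale: "0 \<le> s \<Longrightarrow> 0 \<le> t \<Longrightarrow> t \<le> 1 \<Longrightarrow> \<Phi> (t * s) \<le> ennreal t * \<Phi> s"
proof -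
  assume *: "0 \<le> s" "0 \<le> t" "t \<le> 1"
  have "\<forall>r\<ge>0. \<forall>s\<ge>0. \<forall>t\<in>{0..1}.
        \<Phi> ((1 - t) * r + t * s) \<le> ennreal (1 - t) * \<Phi> r + ennreal t * \<Phi> s"
    using young unfolding young_function_def by blast
  from this[rule_format, of 0 s t] * show ?thesis by simp
qed

lemma scale_divide: "0 < r \<Longrightarrow> r \<le> s \<Longrightarrow> \<Phi> r \<le> ennreal (r / s) * \<Phi> s"
  using scale[of s "r / s"] by simp

lemma young_mono: "0 \<le> r \<Longrightarrow> r \<le> s \<Longrightarrow> \<Phi> r \<le> \<Phi> s"
proof -
  assume *: "0 \<le> r" "r \<le> s"
  show "\<Phi> r \<le> \<Phi> s"
  proof (cases "r = 0")
    case False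
    then have "\<Phi> r \<le> ennreal (r / s) * \<Phi> s" using * by (intro scale_divide) auto
    also have "\<dots> \<le> 1 * \<Phi> s"
      using * False by (intro mult_right_mono) (auto simp: ennreal_le_1)
    finally show ?thesis by simp
  qed simp
qed

lemma mono_young_ext: "mono (young_ext \<Phi>)"
proof (rule monoI)
  fix u v :: ennreal assume "u \<le> v"
  then show "young_ext \<Phi> u \<le> young_ext \<Phi> v"
    by (cases u; cases v) (auto simp: young_ext_def top_unique intro!: young_mono)
qed

lemma young_ext_measurable [measurable]: "young_ext \<Phi> \<in> borel_measurable borel"
  by (rule borel_measurable_mono_ennreal[OF mono_young_ext])

lemma young_ext_ennreal: "0 \<le> r \<Longrightarrow> young_ext \<Phi> (ennreal r) = \<Phi> r"
  by (simp add: young_ext_def)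

lemma ex_greater: "\<exists>r>0. ennreal t < \<Phi> r"
proof -
  have "\<forall>\<^sub>F r in at_top. ennreal t < \<Phi> r"
    using young by (auto simp: young_function_def intro!: order_tendstoD(1))
  then have "\<forall>\<^sub>F r in at_top. ennreal t < \<Phi> r \<and> 0 < r"
    using eventually_gt_at_top[of "0::real"] by eventually_elim auto
  then show ?thesis
    by (metis (mono_tags, lifting) eventually_happens trivial_limit_at_top_linorder)
qed

abbreviation level :: "real \<Rightarrow> real set" where
  "level t \<equiv> {r. 0 \<le> r \<and> ennreal t < \<Phi> r}"

lemma level_nonempty: "level t \<noteq> {}"
  using ex_greater[of t] by (auto intro: less_imp_le)

lemma level_bdd: "bdd_below (level t)"
  by (rule bdd_belowI[of _ 0]) auto

lemma inverse_nonneg: "0 \<le> young_inverse \<Phi> t"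
  unfolding young_inverse_def by (rule cInf_greatest[OF level_nonempty]) auto

lemma inverse_pos: "0 < t \<Longrightarrow> 0 < young_inverse \<Phi> t"
proof -
  assume t: "0 < t"
  have "\<forall>\<^sub>F r in at_right 0. \<Phi> r < ennreal t"
    using young t by (auto simp: young_function_def intro!: order_tendstoD(2))
  then have "\<forall>\<^sub>F r in at_right 0. \<Phi> r < ennreal t \<and> 0 < r"
    using eventually_at_right_less[of "0::real"] by eventually_elim auto
  then obtain e where e: "\<Phi> e < ennreal t" "0 < e"
    by (metis (mono_tags, lifting) eventually_happens trivial_limit_at_right_real)
  have "e \<le> r" if "r \<in> level t" for r
  proof (rule ccontr)
    assume "\<not> e \<le> r"
    then have "\<Phi> r \<le> \<Phi> e" using that by (intro young_mono) auto
    then show False using e that by auto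
  qed
  then have "e \<le> young_inverse \<Phi> t"
    unfolding young_inverse_def by (rule cInf_greatest[OF level_nonempty])
  then show ?thesis using e by simp
qed

lemma le_of_less_inverse: "0 \<le> r \<Longrightarrow> r < young_inverse \<Phi> t \<Longrightarrow> \<Phi> r \<le> ennreal t"
  unfolding young_inverse_def using cInf_lower[OF _ level_bdd, of r t] by (force simp: not_less)

lemma greater_of_inverse_less: "young_inverse \<Phi> t < r \<Longrightarrow> ennreal t < \<Phi> r"
proof -
  assume "young_inverse \<Phi> t < r"
  then obtain q where "q \<in> level t" "q < r"
    unfolding young_inverse_def using cInf_lessD[OF level_nonempty] by blast
  then show ?thesis using young_mono[of q r] by auto
qed

lemma apply_inverse_le:
  assumes "0 < t"
  shows "\<Phi> (young_inverse \<Phi> t) \<le> ennreal t"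
proof -
  have "(\<Phi> \<longlongrightarrow> \<Phi> (young_inverse \<Phi> t)) (at_left (young_inverse \<Phi> t))"
    using young inverse_pos[OF assms] by (auto simp: young_function_def continuous_within)
  moreover have "\<forall>\<^sub>F r in at_left (young_inverse \<Phi> t). \<Phi> r \<le> ennreal t"
  proof -
    have "\<forall>\<^sub>F r in at_left (young_inverse \<Phi> t). r \<in> {0<..<young_inverse \<Phi> t}"
      by (rule eventually_at_leftI[OF _ inverse_pos[OF assms]])
    then show ?thesis by eventually_elim (auto intro: le_of_less_inverse)
  qed
  ultimately show ?thesis
    by (rule tendsto_upperbound) simp
qed

text \<open>Together with \<open>apply_inverse_le\<close>, which uses left continuity, this says how far \<open>young_inverse \<Phi>\<close> is
from being an inverse: \<open>\<Phi> (\<Phi>\<^sup>-\<^sup>1 t) \<le> t\<close> and \<open>r \<le> \<Phi>\<^sup>-\<^sup>1 (\<Phi> r)\<close>.\<close>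

lemma le_inverse_apply: "\<Phi> r = ennreal t \<Longrightarrow> 0 \<le> r \<Longrightarrow> r \<le> young_inverse \<Phi> t"
proof -
  assume *: "\<Phi> r = ennreal t" "0 \<le> r"
  have "r \<le> q" if "q \<in> level t" for q
    using that * young_mono[of q r] by (cases "q \<le> r") (auto dest: leD)
  then show "r \<le> young_inverse \<Phi> t"
    unfolding young_inverse_def by (rule cInf_greatest[OF level_nonempty])
qed

lemma inverse_mono: "s \<le> t \<Longrightarrow> young_inverse \<Phi> s \<le> young_inverse \<Phi> t"
  unfolding young_inverse_def
  by (rule cInf_superset_mono[OF level_nonempty level_bdd]) (auto intro: le_less_trans[OF ennreal_leI])

text \<open>A substitute, with the factor 2, for Jensen's inequality. For \<open>s > \<Phi>\<^sup>-\<^sup>1 (1 / v)\<close> we have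
\<open>\<Phi> s \<ge> 1 / v\<close>, and where \<open>G\<close> exceeds \<open>s\<close>, convexity gives \<open>G \<le> s \<Phi> G / \<Phi> s \<le> s v \<Phi> G\<close>. So
\<open>G \<le> s + s v \<Phi> G\<close> everywhere; integrate over \<open>A\<close> and let \<open>s\<close> decrease to \<open>\<Phi>\<^sup>-\<^sup>1 (1 / v)\<close>. The argument
covers Young functions that take the value \<open>\<infinity>\<close>.\<close>

lemma set_integral_le_inverse:
  assumes G [measurable]: "G \<in> borel_measurable M" and A [measurable]: "A \<in> sets M"
    and mA: "emeasure M A = ennreal v" and v: "v > 0"
    and le1: "(\<integral>\<^sup>+x. young_ext \<Phi> (G x) \<partial>M) \<le> 1"
  shows "(\<integral>\<^sup>+x\<in>A. G x \<partial>M) \<le> ennreal (2 * v * young_inverse \<Phi> (1 / v))"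
proof -
  have bound: "(\<integral>\<^sup>+x\<in>A. G x \<partial>M) \<le> ennreal (2 * v * s)" if s: "young_inverse \<Phi> (1 / v) < s" for s
  proof -
    have s0: "s > 0" using s inverse_nonneg[of "1 / v"] by linarith
    have Gle: "G x \<le> ennreal s + ennreal (s * v) * young_ext \<Phi> (G x)" for x
    proof (cases "G x \<le> ennreal s")
      case True
      then show ?thesis by (metis add_increasing2 zero_le)
    next
      case False
      show ?thesis
      proof (cases "G x")
        case (real g)
        with False have g: "g > s" "g > 0" using s0 by (auto simp: not_le)
        have "ennreal (1 / v) \<le> \<Phi> s" using greater_of_inverse_less[OF s] by simp
        also have "\<dots> \<le> ennreal (s / g) * \<Phi> g" using s0 g by (intro scale_divide) auto
        finally have "ennreal (g * v) * ennreal (1 / v) \<le> ennreal (g * v) * (ennreal (s / g) * \<Phi> g)"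
          by (rule mult_left_mono) simp
        also have "ennreal (g * v) * (ennreal (s / g) * \<Phi> g) = ennreal (s * v) * \<Phi> g"
          using g v s0 by (simp add: mult.assoc[symmetric] ennreal_mult[symmetric]) (simp add: mult.commute)
        also have "ennreal (g * v) * ennreal (1 / v) = G x"
          using g v real by (simp add: ennreal_mult[symmetric])
        finally show ?thesis
          using real g by (simp add: young_ext_ennreal) (metis add_increasing zero_le)
      next
        case top
        then show ?thesis using s0 v by (simp add: young_ext_def ennreal_mult_top)
      qed
    qed
    have "(\<integral>\<^sup>+x\<in>A. G x \<partial>M) \<le> (\<integral>\<^sup>+x. ennreal s * indicator A x + ennreal (s * v) * young_ext \<Phi> (G x) \<partial>M)"
      using Gle by (intro nn_integral_mono) (auto split: split_indicator)
    also have "\<dots> = ennreal s * emeasure M A + ennreal (s * v) * (\<integral>\<^sup>+x. young_ext \<Phi> (G x) \<partial>M)"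
      by (simp add: nn_integral_add nn_integral_cmult)
    also have "\<dots> \<le> ennreal s * ennreal v + ennreal (s * v) * 1"
      using le1 by (intro add_mono mult_left_mono) (auto simp: mA)
    also have "\<dots> = ennreal (2 * v * s)"
      using s0 v by (simp add: ennreal_mult[symmetric] ennreal_plus[symmetric] mult.commute del: ennreal_plus)
    finally show ?thesis .
  qed
  have "((\<lambda>s. ennreal (2 * v * s)) \<longlongrightarrow> ennreal (2 * v * young_inverse \<Phi> (1 / v))) (at_right (young_inverse \<Phi> (1 / v)))"
    by (intro tendsto_intros)
  then show ?thesis
    by (rule tendsto_lowerbound) (auto intro: eventually_mono[OF eventually_at_right_less] bound)
qed

end


section \<open>Covering and the weak type inequality in quasi-metric spaces\<close>

text \<open>The setting of the analytic half: a quasi-metric on a Euclidean space, compatible with its topology,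
whose balls of radius \<open>r\<close> have Lebesgue measure proportional to \<open>r ^ Q\<close>.\<close>

locale ahlfors_quasimetric =
  fixes d :: "'a::euclidean_space \<Rightarrow> 'a \<Rightarrow> real" and c\<^sub>0 c\<^sub>1 :: real and Q :: nat
  assumes d_nonneg: "0 \<le> d x y"
    and d_sym: "d x y = d y x"
    and d_eq_0: "d x y = 0 \<longleftrightarrow> x = y"
    and d_triangle: "d x z \<le> c\<^sub>0 * (d x y + d y z)"
    and c0: "1 \<le> c\<^sub>0" and c1: "0 < c\<^sub>1" and Q: "0 < Q"
    and d_continuous: "continuous_on UNIV (d x)"
    and qball_bounded: "bounded {y. d x y < r}"
    and qball_measure: "0 < r \<Longrightarrow> emeasure lebesgue {y. d x y < r} = ennreal (c\<^sub>1 * r ^ Q)"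
begin

definition qball :: "'a \<Rightarrow> real \<Rightarrow> 'a set" where
  "qball z r = {y. d z y < r}"

lemma mem_qball: "y \<in> qball z r \<longleftrightarrow> d z y < r"
  by (simp add: qball_def)

lemma centre_in_qball: "0 < r \<Longrightarrow> z \<in> qball z r"
  using d_eq_0[of z z] by (simp add: mem_qball)

lemma qball_radius_pos: "x \<in> qball z r \<Longrightarrow> 0 < r"
  using d_nonneg[of z x] by (simp add: mem_qball)

lemma open_qball: "open (qball z r)"
  unfolding qball_def using d_continuous by (intro open_Collect_less continuous_intros)

lemma sets_qball [measurable]: "qball z r \<in> sets lebesgue"
  using open_qball by simp

lemma emeasure_qball: "0 < r \<Longrightarrow> emeasure lebesgue (qball z r) = ennreal (c\<^sub>1 * r ^ Q)"
  unfolding qball_def by (rule qball_measure)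

lemma qball_mono: "r \<le> s \<Longrightarrow> qball z r \<subseteq> qball z s"
  by (auto simp: mem_qball)

lemma dist_in_qball: "x \<in> qball z r \<Longrightarrow> y \<in> qball z r \<Longrightarrow> d x y < 2 * c\<^sub>0 * r"
proof -
  assume *: "x \<in> qball z r" "y \<in> qball z r"
  have "d x y \<le> c\<^sub>0 * (d z x + d z y)"
    using d_triangle[of x y z] d_sym by simp
  also have "\<dots> < c\<^sub>0 * (r + r)"
    using * c0 by (intro mult_strict_left_mono) (auto simp: mem_qball)
  finally show ?thesis by simp
qed

text \<open>The factor by which a ball must be enlarged to contain every ball that meets it and is not larger.\<close>

definition \<kappa> :: real where "\<kappa> = 3 * c\<^sub>0 ^ 2"

lemma kappa_ge_1: "1 \<le> \<kappa>"
  using one_le_power[OF c0, of 2] by (simp add: \<kappa>_def)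

lemma qball_subset_enlarged:
  assumes "qball z r \<inter> qball w s \<noteq> {}" "r \<le> s"
  shows "qball z r \<subseteq> qball w (\<kappa> * s)"
proof
  fix u assume u: "u \<in> qball z r"
  from assms obtain v where v: "v \<in> qball z r" "v \<in> qball w s" by auto
  have s: "0 < s" using qball_radius_pos[OF v(2)] .
  have "d w u \<le> c\<^sub>0 * (d w v + d v u)" by (rule d_triangle)
  also have "\<dots> < c\<^sub>0 * (s + 2 * c\<^sub>0 * r)"
    using v dist_in_qball[OF v(1) u] c0 by (intro mult_strict_left_mono add_strict_mono) (auto simp: mem_qball)
  also have "\<dots> \<le> c\<^sub>0 * (c\<^sub>0 * s + 2 * c\<^sub>0 * s)"
    using assms c0 s by (intro mult_left_mono add_mono) (auto simp: mult_le_cancel_right1)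
  also have "\<dots> = \<kappa> * s" by (simp add: \<kappa>_def power2_eq_square algebra_simps)
  finally show "u \<in> qball w (\<kappa> * s)" by (simp add: mem_qball)
qed

text \<open>Vitali's greedy selection: take a ball of largest radius, discard all balls that meet it, and
recurse on the rest. The discarded balls lie in its enlargement.\<close>

lemma vitali_finite:
  assumes "finite I" and "\<And>z r. (z, r) \<in> I \<Longrightarrow> 0 < r"
  shows "\<exists>J\<subseteq>I. disjoint_family_on (\<lambda>(z, r). qball z r) J \<and>
    (\<Union>(z, r)\<in>I. qball z r) \<subseteq> (\<Union>(z, r)\<in>J. qball z (\<kappa> * r))"
  using assms
proof (induction "card I" arbitrary: I rule: less_induct)
  case (less I)
  show ?case
  proof (cases "I = {}")
    case False
    have "Max (snd ` I) \<in> snd ` I" using less.prems False by (intro Max_in) auto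
    then obtain w s where ws: "(w, s) \<in> I" "s = Max (snd ` I)" by auto
    have max: "r \<le> s" if "(z, r) \<in> I" for z r
      unfolding ws using less.prems that by (intro Max_ge) (auto intro: rev_image_eqI)
    define I' where "I' = {(z, r) \<in> I. qball z r \<inter> qball w s = {}}"
    have "(w, s) \<notin> I'" using centre_in_qball[of s w] less.prems(2) ws by (auto simp: I'_def)
    then have "I' \<subset> I" using ws by (auto simp: I'_def)
    then have "card I' < card I" using less.prems by (intro psubset_card_mono)
    then obtain J where J: "J \<subseteq> I'" "disjoint_family_on (\<lambda>(z, r). qball z r) J"
      "(\<Union>(z, r)\<in>I'. qball z r) \<subseteq> (\<Union>(z, r)\<in>J. qball z (\<kappa> * r))"
      using less.hyps[of I'] less.prems \<open>I' \<subset> I\<close> by (meson finite_subset psubset_imp_subset subsetD)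
    have "disjoint_family_on (\<lambda>(z, r). qball z r) (insert (w, s) J)"
      using J(1,2) unfolding disjoint_family_on_def I'_def by blast
    moreover have "(\<Union>(z, r)\<in>I. qball z r) \<subseteq> (\<Union>(z, r)\<in>insert (w, s) J. qball z (\<kappa> * r))"
    proof -
      have "qball z r \<subseteq> (\<Union>(z, r)\<in>insert (w, s) J. qball z (\<kappa> * r))" if "(z, r) \<in> I" for z r
      proof (cases "(z, r) \<in> I'")
        case True
        then have "qball z r \<subseteq> (\<Union>(z, r)\<in>I'. qball z r)" by blast
        then show ?thesis using J(3) by auto
      next
        case False
        then have "qball z r \<subseteq> qball w (\<kappa> * s)"
          using that max by (intro qball_subset_enlarged) (auto simp: I'_def)
        then show ?thesis by auto
      qed
      then show ?thesis by blast
    qed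
    ultimately show ?thesis
      using J(1) ws(1) \<open>I' \<subset> I\<close> by (intro exI[of _ "insert (w, s) J"]) auto
  qed (auto simp: disjoint_family_on_def)
qed

lemma emeasure_enlarged_qball:
  assumes "0 < r"
  shows "emeasure lebesgue (qball z (\<kappa> * r)) = ennreal (\<kappa> ^ Q) * emeasure lebesgue (qball z r)"
  using assms kappa_ge_1 c1
  by (simp only: emeasure_qball mult_pos_pos zero_less_one less_le_trans[OF zero_less_one kappa_ge_1])
    (simp add: power_mult_distrib ennreal_mult[symmetric] mult.left_commute)

text \<open>The uncentred Hardy--Littlewood maximal function.\<close>

definition hl_max :: "('a \<Rightarrow> ennreal) \<Rightarrow> 'a \<Rightarrow> ennreal" where
  "hl_max F x = (SUP B\<in>{qball z r | z r. x \<in> qball z r}. (\<integral>\<^sup>+y\<in>B. F y \<partial>lebesgue) / emeasure lebesgue B)"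

lemma hl_max_ge:
  "x \<in> qball z r \<Longrightarrow> (\<integral>\<^sup>+y\<in>qball z r. F y \<partial>lebesgue) / emeasure lebesgue (qball z r) \<le> hl_max F x"
  unfolding hl_max_def by (rule SUP_upper) blast

lemma less_hl_max_iff:
  "t < hl_max F x \<longleftrightarrow> (\<exists>z r. x \<in> qball z r \<and> t < (\<integral>\<^sup>+y\<in>qball z r. F y \<partial>lebesgue) / emeasure lebesgue (qball z r))"
  unfolding hl_max_def less_SUP_iff by blast

lemma open_less_hl_max: "open {x. t < hl_max F x}"
proof -
  have "{x. t < hl_max F x} = \<Union>{qball z r | z r. t < (\<integral>\<^sup>+y\<in>qball z r. F y \<partial>lebesgue) / emeasure lebesgue (qball z r)}"
    by (auto simp: less_hl_max_iff)
  then show ?thesis using open_qball by auto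
qed

lemma emeasure_qball_pos_finite:
  assumes "0 < r"
  shows "emeasure lebesgue (qball z r) \<noteq> 0" "emeasure lebesgue (qball z r) \<noteq> \<infinity>"
  using assms c1 by (simp_all add: emeasure_qball del: emeasure_completion) 

text \<open>A compact part of the superlevel set is covered by finitely many balls with large averages. Disjoint ones
among them, selected by \<open>vitali_finite\<close>, still carry a fixed fraction of its measure. The superlevel set is open,
so compact subsets exhaust it.\<close>

lemma weak_type:
  assumes F [measurable]: "F \<in> borel_measurable lebesgue"
  shows "ennreal t * emeasure lebesgue {x. ennreal t < hl_max F x} \<le> ennreal (\<kappa> ^ Q) * (\<integral>\<^sup>+x. F x \<partial>lebesgue)"
proof -
  let ?U = "{x. ennreal t < hl_max F x}"
  have compact_bound: "ennreal t * emeasure lebesgue K \<le> ennreal (\<kappa> ^ Q) * (\<integral>\<^sup>+x. F x \<partial>lebesgue)"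
    if K: "compact K" "K \<subseteq> ?U" for K
  proof -
    define good where "good = {(z, r). 0 < r \<and> ennreal t < (\<integral>\<^sup>+y\<in>qball z r. F y \<partial>lebesgue) / emeasure lebesgue (qball z r)}"
    have "K \<subseteq> (\<Union>(z, r)\<in>good. qball z r)"
    proof
      fix x assume "x \<in> K"
      then obtain z r where "x \<in> qball z r" "ennreal t < (\<integral>\<^sup>+y\<in>qball z r. F y \<partial>lebesgue) / emeasure lebesgue (qball z r)"
        using K less_hl_max_iff by blast
      then show "x \<in> (\<Union>(z, r)\<in>good. qball z r)" using qball_radius_pos unfolding good_def by blast
    qed
    then obtain I where I: "I \<subseteq> good" "finite I" "K \<subseteq> (\<Union>(z, r)\<in>I. qball z r)"
      using compactE_image[OF K(1), of good "\<lambda>(z, r). qball z r"] open_qball by (auto simp: case_prod_beta)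
    from vitali_finite[OF I(2)] obtain J where J: "J \<subseteq> I" "disjoint_family_on (\<lambda>(z, r). qball z r) J"
      "(\<Union>(z, r)\<in>I. qball z r) \<subseteq> (\<Union>(z, r)\<in>J. qball z (\<kappa> * r))"
      using I(1) by (auto simp: good_def)
    have finJ: "finite J" using J(1) I(2) finite_subset by blast
    have "emeasure lebesgue K \<le> emeasure lebesgue (\<Union>(z, r)\<in>J. qball z (\<kappa> * r))"
      using I(3) J(3) finJ by (intro emeasure_mono) (auto intro!: sets.finite_UN)
    also have "\<dots> \<le> (\<Sum>(z, r)\<in>J. emeasure lebesgue (qball z (\<kappa> * r)))"
      unfolding case_prod_beta by (rule emeasure_subadditive_finite[OF finJ]) (use sets_qball in blast)
    also have "\<dots> = (\<Sum>(z, r)\<in>J. ennreal (\<kappa> ^ Q) * emeasure lebesgue (qball z r))"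
      using J(1) I(1) by (intro sum.cong) (auto simp: good_def emeasure_enlarged_qball simp del: emeasure_completion)
    finally have "ennreal t * emeasure lebesgue K \<le>
        ennreal t * (\<Sum>(z, r)\<in>J. ennreal (\<kappa> ^ Q) * emeasure lebesgue (qball z r))"
      by (rule mult_left_mono) simp
    also have "\<dots> = (\<Sum>(z, r)\<in>J. ennreal (\<kappa> ^ Q) * (ennreal t * emeasure lebesgue (qball z r)))"
      by (simp add: sum_distrib_left case_prod_beta mult.left_commute)
    also have "\<dots> \<le> (\<Sum>(z, r)\<in>J. ennreal (\<kappa> ^ Q) * (\<integral>\<^sup>+y\<in>qball z r. F y \<partial>lebesgue))"
    proof (intro sum_mono)
      fix p assume "p \<in> J"
      then obtain z r where p: "p = (z, r)" "0 < r"
        "ennreal t < (\<integral>\<^sup>+y\<in>qball z r. F y \<partial>lebesgue) / emeasure lebesgue (qball z r)"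
        using J(1) I(1) by (auto simp: good_def)
      have "ennreal t * emeasure lebesgue (qball z r) \<le>
          (\<integral>\<^sup>+y\<in>qball z r. F y \<partial>lebesgue) / emeasure lebesgue (qball z r) * emeasure lebesgue (qball z r)"
        using p(3) by (intro mult_right_mono) auto
      also have "\<dots> = (\<integral>\<^sup>+y\<in>qball z r. F y \<partial>lebesgue)"
        using emeasure_qball_pos_finite[OF p(2), of z]
        by (simp add: ennreal_divide_times ennreal_times_divide[symmetric] ennreal_divide_self less_top del: emeasure_completion)
      finally show "(case p of (z, r) \<Rightarrow> ennreal (\<kappa> ^ Q) * (ennreal t * emeasure lebesgue (qball z r)))
        \<le> (case p of (z, r) \<Rightarrow> ennreal (\<kappa> ^ Q) * (\<integral>\<^sup>+y\<in>qball z r. F y \<partial>lebesgue))"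
        using p by (auto intro: mult_left_mono)
    qed
    also have "\<dots> = ennreal (\<kappa> ^ Q) * (\<Sum>p\<in>J. \<integral>\<^sup>+y\<in>(case p of (z, r) \<Rightarrow> qball z r). F y \<partial>lebesgue)"
      by (simp add: sum_distrib_left case_prod_beta)
    also have "(\<Sum>p\<in>J. \<integral>\<^sup>+y\<in>(case p of (z, r) \<Rightarrow> qball z r). F y \<partial>lebesgue)
        = (\<integral>\<^sup>+y. (\<Sum>p\<in>J. F y * indicator (case p of (z, r) \<Rightarrow> qball z r) y) \<partial>lebesgue)"
      by (intro nn_integral_sum[symmetric]) (auto simp: case_prod_beta)
    also have "\<dots> \<le> (\<integral>\<^sup>+y. F y \<partial>lebesgue)"
    proof (intro nn_integral_mono)
      fix y
      have "(\<Sum>p\<in>J. indicator (case p of (z, r) \<Rightarrow> qball z r) y :: ennreal)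
          = indicator (\<Union>p\<in>J. case p of (z, r) \<Rightarrow> qball z r) y"
        by (rule indicator_UN_disjoint[OF finJ J(2), symmetric])
      then have "(\<Sum>p\<in>J. F y * indicator (case p of (z, r) \<Rightarrow> qball z r) y)
          = F y * indicator (\<Union>p\<in>J. case p of (z, r) \<Rightarrow> qball z r) y"
        by (simp only: sum_distrib_left[symmetric])
      also have "\<dots> \<le> F y" by (simp add: indicator_def)
      finally show "(\<Sum>p\<in>J. F y * indicator (case p of (z, r) \<Rightarrow> qball z r) y) \<le> F y" .
    qed
    finally show ?thesis by (simp add: mult_left_mono)
  qed
  obtain C where C: "\<And>n. compact (C n)" "\<And>n. C n \<subseteq> ?U" "\<And>n. C n \<subseteq> interior (C (Suc n))" "\<Union>(range C) = ?U"
    using open_Union_compact_subsets[OF open_less_hl_max] by metis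
  have inc: "incseq C"
    using C(3) interior_subset by (intro incseq_SucI) blast
  have "(SUP n. emeasure lebesgue (C n)) = emeasure lebesgue ?U"
  proof -
    have "C n \<in> sets lebesgue" for n using C(1)[of n] by (simp add: compact_imp_closed)
    then have "range C \<subseteq> sets lebesgue" by blast
    from SUP_emeasure_incseq[OF this inc] show ?thesis by (simp only: C(4))
  qed
  then have "ennreal t * emeasure lebesgue ?U = (SUP n. ennreal t * emeasure lebesgue (C n))"
    by (simp only: SUP_mult_left_ennreal[symmetric])
  also have "\<dots> \<le> ennreal (\<kappa> ^ Q) * (\<integral>\<^sup>+x. F x \<partial>lebesgue)"
    using compact_bound C(1,2) by (intro SUP_least) blast
  finally show ?thesis .
qed

end


section \<open>The maximal theorem in Orlicz spaces\<close>

lemma ex_int_power_between: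
  assumes "1 < a" "0 < (u::real)"
  obtains k :: int where "a powr (of_int k) < u" "u \<le> a powr (of_int (k + 1))"
proof
  let ?k = "\<lceil>log a u\<rceil> - 1"
  have u: "u = a powr (log a u)" using assms by simp
  show "a powr (of_int ?k) < u"
    by (subst (2) u, subst powr_less_cancel_iff) (use assms in linarith)+
  show "u \<le> a powr (of_int (?k + 1))"
    by (subst u, subst powr_le_cancel_iff) (use assms in auto)
qed

text \<open>A sum over all integers up to \<open>N\<close> whose terms at least halve at each step downwards is at most twice its
top term.\<close>

lemma sum_geometric_int_le:
  fixes T :: "int \<Rightarrow> real"
  assumes nn: "\<And>k. 0 \<le> T k" and step: "\<And>k. T (k - 1) \<le> T k / 2"
  shows "(\<integral>\<^sup>+k. ennreal (T k) * indicator {..N} k \<partial>count_space UNIV) \<le> ennreal (2 * T N)"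
proof -
  have le: "T (N - int n) \<le> T N * (1 / 2) ^ n" for n
  proof (induction n)
    case (Suc n)
    have "T (N - int (Suc n)) \<le> T (N - int n) / 2"
      using step[of "N - int n"] by (simp add: algebra_simps)
    also have "\<dots> \<le> T N * (1 / 2) ^ n / 2" using Suc by simp
    finally show ?case by simp
  qed simp
  have "bij_betw (\<lambda>n. N - int n) UNIV {..N}"
    by (rule bij_betw_byWitness[where f'="\<lambda>k. nat (N - k)"]) auto
  then have "(\<integral>\<^sup>+k. ennreal (T k) \<partial>count_space {..N}) = (\<integral>\<^sup>+n. ennreal (T (N - int n)) \<partial>count_space UNIV)"
    by (rule nn_integral_bij_count_space[symmetric])
  also have "\<dots> \<le> (\<integral>\<^sup>+n. ennreal (T N * (1 / 2) ^ n) \<partial>count_space UNIV)"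
    by (intro nn_integral_mono ennreal_leI le)
  also have "\<dots> = (\<Sum>n. ennreal (T N * (1 / 2) ^ n))"
    by (rule nn_integral_count_space_nat)
  also have "\<dots> = ennreal (\<Sum>n. T N * (1 / 2) ^ n)"
    using nn by (intro suminf_ennreal2) (auto intro!: summable_mult)
  also have "(\<Sum>n. T N * (1 / 2) ^ n) = 2 * T N"
    by (simp add: suminf_mult suminf_geometric)
  finally show ?thesis
    by (simp add: nn_integral_count_space_indicator)
qed

lemma nn_integral_count_space_swap:
  fixes f :: "'i::countable \<Rightarrow> 'a \<Rightarrow> ennreal"
  assumes "\<And>k. f k \<in> borel_measurable M"
  shows "(\<integral>\<^sup>+x. \<integral>\<^sup>+k. f k x \<partial>count_space UNIV \<partial>M) = (\<integral>\<^sup>+k. \<integral>\<^sup>+x. f k x \<partial>M \<partial>count_space UNIV)"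
  by (rule nn_integral_count_space_nn_integral) (use assms in auto)

locale young_Y = young +
  assumes Y: "\<Phi> \<in> young_class_Y"
begin

lemma finite_value: "0 \<le> r \<Longrightarrow> \<Phi> r < \<infinity>"
  using Y by (cases "r = 0") (auto simp: young_class_Y_def)

lemma pos_value: "0 < r \<Longrightarrow> 0 < \<Phi> r"
  using Y by (auto simp: young_class_Y_def)

lemma ennreal_value: "0 \<le> r \<Longrightarrow> \<Phi> r = ennreal (enn2real (\<Phi> r))"
  using finite_value[of r] by (simp add: less_top)

text \<open>Discretization at the levels \<open>a\<^sup>k\<close>: if \<open>a\<^sup>k < u \<le> a\<^sup>k\<^sup>+\<^sup>1\<close>, then the single term with index \<open>k\<close> dominates
the left-hand side. If \<open>u = \<infinity>\<close>, infinitely many terms are at least \<open>\<Phi> (a / K) > 0\<close>. Using the powers of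
the constant of the \<open>\<nabla>\<^sub>2\<close> condition as levels makes the sums in \<open>level_sum_le\<close> geometric.\<close>

lemma young_ext_le_sum:
  assumes a: "1 < a" and K: "0 < K"
  shows "young_ext \<Phi> (u / ennreal K) \<le>
    (\<integral>\<^sup>+k. \<Phi> (a * a powr of_int k / K) * indicator {k. ennreal (a powr of_int k) < u} k \<partial>count_space (UNIV :: int set))"
    (is "_ \<le> (\<integral>\<^sup>+k. ?g k \<partial>_)")
proof (cases u)
  case (real r)
  show ?thesis
  proof (cases "r = 0")
    case True
    then show ?thesis using real K by (simp add: young_ext_def)
  next
    case False
    with real have r: "0 < r" by simp
    from ex_int_power_between[OF a r] obtain k :: int
      where k: "a powr of_int k < r" "r \<le> a powr of_int (k + 1)" by blast
    have "r / K \<le> a * a powr of_int k / K"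
      using k(2) a K by (simp add: powr_add divide_right_mono mult.commute)
    then have "young_ext \<Phi> (u / ennreal K) \<le> \<Phi> (a * a powr of_int k / K)"
      using real r K by (simp add: divide_ennreal young_ext_ennreal young_mono)
    also have "\<dots> = ?g k"
      using k(1) real by (simp add: ennreal_less_iff)
    also have "\<dots> \<le> (\<integral>\<^sup>+k. ?g k \<partial>count_space UNIV)"
      by (rule nn_integral_ge_point) simp
    finally show ?thesis .
  qed
next
  case top
  have "\<Phi> (a / K) * emeasure (count_space UNIV) {0::int..} =
      (\<integral>\<^sup>+k. \<Phi> (a / K) * indicator {0::int..} k \<partial>count_space UNIV)"
    by (simp add: nn_integral_cmult_indicator)
  also have "\<dots> \<le> (\<integral>\<^sup>+k. ?g k \<partial>count_space UNIV)"
  proof (rule nn_integral_mono)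
    fix k :: int
    have "1 \<le> a powr of_int k" if "0 \<le> k" using that a by (simp add: ge_one_powr_ge_zero)
    then have "\<Phi> (a / K) \<le> \<Phi> (a * a powr of_int k / K)" if "0 \<le> k"
      using that a K by (intro young_mono divide_right_mono) auto
    then show "\<Phi> (a / K) * indicator {0::int..} k \<le> ?g k"
      using top by (auto split: split_indicator)
  qed
  finally have "\<Phi> (a / K) * emeasure (count_space UNIV) {0::int..} \<le> (\<integral>\<^sup>+k. ?g k \<partial>count_space UNIV)" .
  moreover have "\<Phi> (a / K) * emeasure (count_space UNIV) {0::int..} = \<infinity>"
    using pos_value[of "a / K"] a K by (simp add: infinite_Ici emeasure_count_space ennreal_mult_top)
  ultimately show ?thesis by (simp add: top_unique)
qed

text \<open>Here the \<open>\<nabla>\<^sub>2\<close> condition enters: it says that \<open>\<Phi> (a e\<^sub>k / K) / e\<^sub>k\<close> with \<open>e\<^sub>k = a\<^sup>k\<close> at least doubles when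
\<open>k\<close> grows by 1, so the sum is dominated by the largest \<open>k\<close> with \<open>e\<^sub>k < 2 s\<close>. The choice \<open>K = 4 a A\<close> makes the
constant equal to 1.\<close>

lemma level_sum_le:
  assumes a: "1 < a" and nabla: "\<And>r. 0 \<le> r \<Longrightarrow> \<Phi> r \<le> ennreal (1 / (2 * a)) * \<Phi> (a * r)"
    and A: "1 \<le> A" and s: "0 \<le> s"
  shows "(\<integral>\<^sup>+k. \<Phi> (a * a powr of_int k / (4 * a * A)) * (ennreal (2 * A / a powr of_int k) *
      (ennreal s * indicator {k. a powr of_int k < 2 * s} k)) \<partial>count_space (UNIV :: int set)) \<le> \<Phi> s"
    (is "(\<integral>\<^sup>+k. ?g k \<partial>_) \<le> _")
proof (cases "s = 0")
  case False
  with s have s: "0 < s" by simp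
  define K where "K = 4 * a * A"
  have K: "0 < K" using a A by (simp add: K_def)
  define \<phi> where "\<phi> = (\<lambda>r. enn2real (\<Phi> r))"
  have phi: "\<Phi> r = ennreal (\<phi> r)" if "0 \<le> r" for r
    unfolding \<phi>_def by (rule ennreal_value[OF that])
  have phi0: "0 \<le> \<phi> r" for r by (simp add: \<phi>_def)
  define e :: "int \<Rightarrow> real" where "e = (\<lambda>k. a powr of_int k)"
  have e_pos: "0 < e k" for k using a by (simp add: e_def)
  have e_Suc: "e k = a * e (k - 1)" for k
    using a by (simp add: e_def powr_diff)
  define T where "T = (\<lambda>k. \<phi> (a * e k / K) / e k)"
  have T0: "0 \<le> T k" for k using phi0 e_pos[of k] by (simp add: T_def)
  have step: "T (k - 1) \<le> T k / 2" for k
  proof -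
    have "ennreal (\<phi> (e k / K)) \<le> ennreal (1 / (2 * a) * \<phi> (a * (e k / K)))"
      using nabla[of "e k / K"] phi[of "e k / K"] phi[of "a * (e k / K)"] e_pos[of k] K a
      by (simp add: ennreal_mult[symmetric] phi0)
    then have "\<phi> (e k / K) \<le> \<phi> (a * e k / K) / (2 * a)"
      using a phi0[of "a * (e k / K)"] by (simp add: ennreal_le_iff)
    moreover have "T (k - 1) = \<phi> (e k / K) * a / e k"
      using a e_pos[of "k - 1"] by (simp add: T_def e_Suc[of k] field_simps)
    ultimately have "T (k - 1) \<le> \<phi> (a * e k / K) / (2 * a) * a / e k"
      using a e_pos[of k] by (simp only:) (intro divide_right_mono mult_right_mono, auto)
    also have "\<dots> = T k / 2" using a by (simp add: T_def)
    finally show ?thesis .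
  qed
  have "0 < 2 * s" using s by simp
  from ex_int_power_between[OF a this] obtain N :: int where N: "e N < 2 * s" "2 * s \<le> e (N + 1)"
    by (auto simp: e_def)
  have iff: "e k < 2 * s \<longleftrightarrow> k \<le> N" for k
  proof
    assume "e k < 2 * s"
    then have "e k < e (N + 1)" using N by simp
    then show "k \<le> N" using a by (simp add: e_def)
  next
    assume "k \<le> N"
    then have "e k \<le> e N" using a by (simp add: e_def)
    then show "e k < 2 * s" using N by simp
  qed
  have "?g k = ennreal (2 * A * s) * (ennreal (T k) * indicator {..N} k)" for k
  proof -
    have "\<Phi> (a * e k / K) = ennreal (\<phi> (a * e k / K))" using a e_pos[of k] K by (intro phi) simp
    then have "\<Phi> (a * e k / K) * (ennreal (2 * A / e k) * ennreal s) = ennreal (2 * A * s) * ennreal (T k)"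
      using A s e_pos[of k] phi0 by (simp add: ennreal_mult[symmetric] T_def field_simps)
    then show ?thesis
      unfolding K_def[symmetric] fun_cong[OF e_def, symmetric] using iff[of k] by (auto split: split_indicator)
  qed
  then have "(\<integral>\<^sup>+k. ?g k \<partial>count_space UNIV) = ennreal (2 * A * s) * (\<integral>\<^sup>+k. ennreal (T k) * indicator {..N} k \<partial>count_space UNIV)"
    by (simp add: nn_integral_cmult)
  also have "\<dots> \<le> ennreal (2 * A * s) * ennreal (2 * T N)"
    by (intro mult_left_mono sum_geometric_int_le T0 step) auto
  also have "\<dots> = ennreal (4 * A * s / e N) * \<Phi> (a * e N / K)"
  proof -
    have "\<Phi> (a * e N / K) = ennreal (\<phi> (a * e N / K))" using a e_pos[of N] K by (intro phi) simp
    then show ?thesis using A s e_pos[of N] phi0 by (simp add: ennreal_mult[symmetric] T_def field_simps)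
  qed
  also have "\<dots> \<le> ennreal (4 * A * s / e N) * (ennreal (e N / (4 * A * s)) * \<Phi> s)"
  proof (rule mult_left_mono)
    have "\<Phi> (a * e N / K) \<le> ennreal (a * e N / K / s) * \<Phi> s"
    proof (rule scale_divide)
      have "a * e N / K = e N / (4 * A)" using a by (simp add: K_def)
      also have "\<dots> \<le> e N / 2" using A e_pos[of N] by (intro divide_left_mono) auto
      also have "\<dots> \<le> s" using N by simp
      finally show "a * e N / K \<le> s" .
    qed (use a e_pos[of N] K in simp)
    also have "a * e N / K / s = e N / (4 * A * s)" using a by (simp add: K_def)
    finally show "\<Phi> (a * e N / K) \<le> ennreal (e N / (4 * A * s)) * \<Phi> s" .
  qed simp
  also have "\<dots> = \<Phi> s"
    using A s e_pos[of N] by (simp add: mult.assoc[symmetric] ennreal_mult[symmetric])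
  finally show ?thesis .
qed simp

end

context ahlfors_quasimetric
begin

text \<open>The part of \<open>F\<close> below \<open>t / 2\<close> contributes at most \<open>t / 2\<close> to the maximal function, so only the part above
\<open>t / 2\<close> has to be estimated by the weak type inequality.\<close>

lemma weak_type_truncated:
  assumes F [measurable]: "F \<in> borel_measurable lebesgue" and t: "0 < t"
  shows "emeasure lebesgue {x. ennreal t < hl_max F x} \<le>
    ennreal (2 * \<kappa> ^ Q / t) * (\<integral>\<^sup>+x. F x * indicator {x. ennreal (t / 2) < F x} x \<partial>lebesgue)"
proof -
  define F1 where "F1 = (\<lambda>x. F x * indicator {x. ennreal (t / 2) < F x} x)"
  have F1 [measurable]: "F1 \<in> borel_measurable lebesgue" by (simp add: F1_def)
  have "hl_max F x \<le> hl_max F1 x + ennreal (t / 2)" for x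
    unfolding hl_max_def[of F]
  proof (rule SUP_least, clarify)
    fix z r assume x: "x \<in> qball z r"
    then have r: "0 < r" by (rule qball_radius_pos)
    let ?v = "emeasure lebesgue (qball z r)"
    have "(\<integral>\<^sup>+y\<in>qball z r. F y \<partial>lebesgue) \<le> (\<integral>\<^sup>+y. F1 y * indicator (qball z r) y + ennreal (t / 2) * indicator (qball z r) y \<partial>lebesgue)"
      by (intro nn_integral_mono) (auto simp: F1_def not_less split: split_indicator)
    also have "\<dots> = (\<integral>\<^sup>+y\<in>qball z r. F1 y \<partial>lebesgue) + ennreal (t / 2) * ?v"
      by (simp add: nn_integral_add nn_integral_cmult_indicator del: emeasure_completion)
    finally have "(\<integral>\<^sup>+y\<in>qball z r. F y \<partial>lebesgue) / ?v \<le> ((\<integral>\<^sup>+y\<in>qball z r. F1 y \<partial>lebesgue) + ennreal (t / 2) * ?v) / ?v"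
      by (rule divide_right_mono_ennreal)
    also have "\<dots> = (\<integral>\<^sup>+y\<in>qball z r. F1 y \<partial>lebesgue) / ?v + ennreal (t / 2)"
      using emeasure_qball_pos_finite[OF r, of z]
      by (simp add: add_divide_distrib_ennreal mult_divide_eq_ennreal del: emeasure_completion)
    also have "\<dots> \<le> hl_max F1 x + ennreal (t / 2)"
      by (intro add_right_mono hl_max_ge x)
    finally show "(\<integral>\<^sup>+y\<in>qball z r. F y \<partial>lebesgue) / ?v \<le> hl_max F1 x + ennreal (t / 2)" .
  qed
  then have sub: "{x. ennreal t < hl_max F x} \<subseteq> {x. ennreal (t / 2) < hl_max F1 x}"
  proof (intro subsetI CollectI)
    fix x assume "\<And>x. hl_max F x \<le> hl_max F1 x + ennreal (t / 2)" "x \<in> {x. ennreal t < hl_max F x}"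
    then have "ennreal t < hl_max F1 x + ennreal (t / 2)" using less_le_trans by blast
    then have "\<not> hl_max F1 x \<le> ennreal (t / 2)"
      using add_right_mono[of "hl_max F1 x" "ennreal (t / 2)" "ennreal (t / 2)"] t
      by (auto simp: ennreal_plus[symmetric] simp del: ennreal_plus)
    then show "ennreal (t / 2) < hl_max F1 x" by simp
  qed
  have "emeasure lebesgue {x. ennreal t < hl_max F x} \<le> emeasure lebesgue {x. ennreal (t / 2) < hl_max F1 x}"
    using sub open_less_hl_max[of "ennreal (t / 2)" F1] by (intro emeasure_mono) auto
  also have "\<dots> = ennreal (2 / t) * (ennreal (t / 2) * emeasure lebesgue {x. ennreal (t / 2) < hl_max F1 x})"
    using t by (simp add: mult.assoc[symmetric] ennreal_mult[symmetric] del: emeasure_completion)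
  also have "\<dots> \<le> ennreal (2 / t) * (ennreal (\<kappa> ^ Q) * (\<integral>\<^sup>+x. F1 x \<partial>lebesgue))"
    by (intro mult_left_mono weak_type F1) simp
  also have "\<dots> = ennreal (2 * \<kappa> ^ Q / t) * (\<integral>\<^sup>+x. F1 x \<partial>lebesgue)"
    using t kappa_ge_1 by (simp add: mult.assoc[symmetric] ennreal_mult[symmetric])
  finally show ?thesis by (simp add: F1_def)
qed

text \<open>Decompose \<open>M f\<close> at the levels \<open>a\<^sup>k\<close>, apply the truncated weak type inequality on each level, exchange
sum and integral, and sum over the levels below \<open>2 \<bar>f x\<bar>\<close> at each point.\<close>

theorem maximal_theorem:
  assumes "young_Y \<Phi>" and "nabla2 \<Phi>"
  shows "\<exists>K\<ge>2. \<forall>f. f \<in> borel_measurable lebesgue \<longrightarrow>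
    (\<integral>\<^sup>+x. young_ext \<Phi> (hl_max (\<lambda>y. ennreal \<bar>f y\<bar>) x / ennreal K) \<partial>lebesgue) \<le> (\<integral>\<^sup>+x. \<Phi> \<bar>f x\<bar> \<partial>lebesgue)"
proof -
  interpret young_Y \<Phi> by fact
  from \<open>nabla2 \<Phi>\<close> obtain a where a: "1 < a" and nabla: "\<And>r. 0 \<le> r \<Longrightarrow> \<Phi> r \<le> ennreal (1 / (2 * a)) * \<Phi> (a * r)"
    unfolding nabla2_def by auto
  define A where "A = \<kappa> ^ Q"
  have A: "1 \<le> A" unfolding A_def by (rule one_le_power[OF kappa_ge_1])
  define K where "K = 4 * a * A"
  have "1 * 1 \<le> a * A" using a A by (intro mult_mono) auto
  moreover have "K = 4 * (a * A)" by (simp add: K_def)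
  ultimately have K: "2 \<le> K" by linarith
  have "(\<integral>\<^sup>+x. young_ext \<Phi> (hl_max (\<lambda>y. ennreal \<bar>f y\<bar>) x / ennreal K) \<partial>lebesgue) \<le> (\<integral>\<^sup>+x. \<Phi> \<bar>f x\<bar> \<partial>lebesgue)"
    if f [measurable]: "f \<in> borel_measurable lebesgue" for f
  proof -
    define F where "F = (\<lambda>y. ennreal \<bar>f y\<bar>)"
    have F [measurable]: "F \<in> borel_measurable lebesgue" by (simp add: F_def)
    have level_sets: "{x. t < hl_max F x} \<in> sets lebesgue" for t
      using open_less_hl_max by simp
    have "(\<integral>\<^sup>+x. young_ext \<Phi> (hl_max F x / ennreal K) \<partial>lebesgue) \<le>
      (\<integral>\<^sup>+x. \<integral>\<^sup>+k. \<Phi> (a * a powr of_int k / K) * indicator {x. ennreal (a powr of_int k) < hl_max F x} x \<partial>count_space (UNIV :: int set) \<partial>lebesgue)"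
      using young_ext_le_sum[OF a, of K] K by (intro nn_integral_mono) (auto simp: indicator_def)
    also have "\<dots> = (\<integral>\<^sup>+k. \<integral>\<^sup>+x. \<Phi> (a * a powr of_int k / K) * indicator {x. ennreal (a powr of_int k) < hl_max F x} x \<partial>lebesgue \<partial>count_space (UNIV :: int set))"
      using level_sets by (intro nn_integral_count_space_swap) simp
    also have "\<dots> = (\<integral>\<^sup>+k. \<Phi> (a * a powr of_int k / K) * emeasure lebesgue {x. ennreal (a powr of_int k) < hl_max F x} \<partial>count_space (UNIV :: int set))"
      by (simp only: nn_integral_cmult_indicator[OF level_sets])
    also have "\<dots> \<le> (\<integral>\<^sup>+k. \<Phi> (a * a powr of_int k / K) * (ennreal (2 * A / a powr of_int k) *
        (\<integral>\<^sup>+x. F x * indicator {x. ennreal (a powr of_int k / 2) < F x} x \<partial>lebesgue)) \<partial>count_space (UNIV :: int set))"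
      using a unfolding A_def by (intro nn_integral_mono mult_left_mono weak_type_truncated F) auto
    also have "\<dots> = (\<integral>\<^sup>+k. \<integral>\<^sup>+x. \<Phi> (a * a powr of_int k / K) * (ennreal (2 * A / a powr of_int k) *
        (F x * indicator {x. ennreal (a powr of_int k / 2) < F x} x)) \<partial>lebesgue \<partial>count_space (UNIV :: int set))"
      by (simp add: nn_integral_cmult)
    also have "\<dots> = (\<integral>\<^sup>+x. \<integral>\<^sup>+k. \<Phi> (a * a powr of_int k / K) * (ennreal (2 * A / a powr of_int k) *
        (F x * indicator {x. ennreal (a powr of_int k / 2) < F x} x)) \<partial>count_space (UNIV :: int set) \<partial>lebesgue)"
      by (intro nn_integral_count_space_swap[symmetric]) simp
    also have "\<dots> \<le> (\<integral>\<^sup>+x. \<Phi> \<bar>f x\<bar> \<partial>lebesgue)"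
    proof (rule nn_integral_mono)
      fix x
      have "indicator {x. ennreal (a powr of_int k / 2) < F x} x = (indicator {k. a powr of_int k < 2 * \<bar>f x\<bar>} k :: ennreal)" for k :: int
        using a by (simp add: F_def indicator_def ennreal_less_iff field_simps)
      then show "(\<integral>\<^sup>+k. \<Phi> (a * a powr of_int k / K) * (ennreal (2 * A / a powr of_int k) *
        (F x * indicator {x. ennreal (a powr of_int k / 2) < F x} x)) \<partial>count_space (UNIV :: int set)) \<le> \<Phi> \<bar>f x\<bar>"
        using level_sum_le[OF a nabla A, of "\<bar>f x\<bar>"] by (simp add: K_def F_def)
    qed
    finally show ?thesis by (simp only: F_def)
  qed
  then show ?thesis using K by blast
qed

end


section \<open>Lipschitz functions have bounded maximal commutators\<close>

text \<open>Local integrability controls a function only on compact sets; it is the limit of its restrictions to balls.\<close>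

lemma locally_integrable_measurable:
  assumes "locally_integrable f"
  shows "f \<in> borel_measurable lebesgue"
proof -
  have 1: "(\<lambda>x. indicator (cball 0 (real n)) x *\<^sub>R f x) \<in> borel_measurable lebesgue" for n
    by (rule borel_measurable_integrable)
      (use assms compact_cball in \<open>unfold locally_integrable_def set_integrable_def, blast\<close>)
  have 2: "(\<lambda>n. indicator (cball 0 (real n)) x *\<^sub>R f x) \<longlonglongrightarrow> f x" for x
  proof (rule tendsto_eventually)
    have "\<forall>\<^sub>F n in sequentially. norm x \<le> real n"
      using filterlim_real_sequentially by (simp add: filterlim_at_top)
    then show "\<forall>\<^sub>F n in sequentially. indicator (cball 0 (real n)) x *\<^sub>R f x = f x"
      by eventually_elim simp
  qed
  show ?thesis
    by (rule borel_measurable_LIMSEQ_metric[OF 1 2])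
qed

text \<open>Here \<open>avg\<close> is the average of a function over a ball of measure \<open>v\<close>, and \<open>w = M f x / K\<close>. If \<open>v \<le> 1 / t\<close>,
the bound \<open>small\<close> by the maximal function is used, and otherwise the bound \<open>large\<close>, which comes from the
norm; in both cases the hypothesis relating \<open>\<Phi>\<close> and \<open>\<Psi>\<close> absorbs the power of \<open>v\<close>.\<close>

lemma hedberg_pointwise:
  fixes \<Phi> \<Psi> :: "real \<Rightarrow> ennreal" and \<alpha> :: real
  assumes "young \<Phi>" "young \<Psi>"
    and C: "\<And>t. 0 < t \<Longrightarrow> t powr (- \<alpha>) * young_inverse \<Phi> t \<le> C * young_inverse \<Psi> t"
    and C0: "0 < C" and \<alpha>: "0 \<le> \<alpha>" and K: "2 \<le> K"
    and v: "0 < v" and t: "0 < t" and w: "0 \<le> w" "\<Phi> w = ennreal t"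
    and small: "avg \<le> K * w" and large: "avg \<le> 2 * young_inverse \<Phi> (1 / v)"
  shows "v powr \<alpha> * avg \<le> K * C * young_inverse \<Psi> t"
proof -
  interpret \<Phi>: young \<Phi> by fact
  interpret \<Psi>: young \<Psi> by fact
  show ?thesis
  proof (cases "t \<le> 1 / v")
    case True
    have wle: "w \<le> young_inverse \<Phi> t" using w by (intro \<Phi>.le_inverse_apply)
    have "v \<le> 1 / t" using True v t by (simp add: field_simps)
    then have "v powr \<alpha> \<le> (1 / t) powr \<alpha>" using v \<alpha> by (intro powr_mono2) auto
    also have "\<dots> = t powr (- \<alpha>)" using t by (simp add: powr_divide powr_minus_divide)
    finally have p: "v powr \<alpha> \<le> t powr (- \<alpha>)" .
    have "v powr \<alpha> * avg \<le> v powr \<alpha> * (K * w)" using small by (intro mult_left_mono) auto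
    also have "\<dots> \<le> t powr (- \<alpha>) * (K * young_inverse \<Phi> t)"
      using p wle w K by (intro mult_mono) auto
    also have "\<dots> = K * (t powr (- \<alpha>) * young_inverse \<Phi> t)" by simp
    also have "\<dots> \<le> K * (C * young_inverse \<Psi> t)" using C[OF t] K by (intro mult_left_mono) auto
    finally show ?thesis by simp
  next
    case False
    then have le: "1 / v \<le> t" by simp
    have "v powr \<alpha> * avg \<le> v powr \<alpha> * (2 * young_inverse \<Phi> (1 / v))" using large by (intro mult_left_mono) auto
    also have "\<dots> = 2 * ((1 / v) powr (- \<alpha>) * young_inverse \<Phi> (1 / v))"
      using v by (simp add: powr_divide powr_minus_divide)
    also have "\<dots> \<le> 2 * (C * young_inverse \<Psi> (1 / v))" using C[of "1 / v"] v by (intro mult_left_mono) auto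
    also have "\<dots> \<le> K * (C * young_inverse \<Psi> t)"
      using K C0 \<Psi>.inverse_mono[OF le] \<Psi>.inverse_nonneg by (intro mult_mono) auto
    finally show ?thesis by simp
  qed
qed

context ahlfors_quasimetric
begin

definition maximal_comm :: "('a \<Rightarrow> real) \<Rightarrow> ('a \<Rightarrow> real) \<Rightarrow> 'a \<Rightarrow> ennreal" where
  "maximal_comm b f x = (SUP B\<in>{qball z r | z r. x \<in> qball z r}.
     (\<integral>\<^sup>+y\<in>B. ennreal (\<bar>b x - b y\<bar> * \<bar>f y\<bar>) \<partial>lebesgue) / emeasure lebesgue B)"

lemma lipschitz_oscillation_le:
  assumes bg: "AE y in lebesgue. b y = g y" and bx: "b x = g x"
    and L: "0 \<le> L" "\<And>x y. \<bar>g x - g y\<bar> \<le> L * d x y powr \<beta>" and \<beta>: "0 \<le> \<beta>"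
    and x: "x \<in> qball z r"
    and f: "f \<in> borel_measurable lebesgue"
  shows "(\<integral>\<^sup>+y\<in>qball z r. ennreal (\<bar>b x - b y\<bar> * \<bar>f y\<bar>) \<partial>lebesgue) \<le>
    ennreal (L * (2 * c\<^sub>0 * r) powr \<beta>) * (\<integral>\<^sup>+y\<in>qball z r. ennreal \<bar>f y\<bar> \<partial>lebesgue)"
proof -
  have "(\<integral>\<^sup>+y\<in>qball z r. ennreal (\<bar>b x - b y\<bar> * \<bar>f y\<bar>) \<partial>lebesgue) \<le>
      (\<integral>\<^sup>+y. ennreal (L * (2 * c\<^sub>0 * r) powr \<beta>) * (ennreal \<bar>f y\<bar> * indicator (qball z r) y) \<partial>lebesgue)"
  proof (rule nn_integral_mono_AE)
    have pt: "ennreal (\<bar>b x - b y\<bar> * \<bar>f y\<bar>) * indicator (qball z r) y \<le>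
      ennreal (L * (2 * c\<^sub>0 * r) powr \<beta>) * (ennreal \<bar>f y\<bar> * indicator (qball z r) y)"
      if yg: "b y = g y" for y
    proof (cases "y \<in> qball z r")
      case True
      have "\<bar>b x - b y\<bar> \<le> L * d x y powr \<beta>" using L(2)[of x y] bx yg by simp
      also have "\<dots> \<le> L * (2 * c\<^sub>0 * r) powr \<beta>"
        using dist_in_qball[OF x True] d_nonneg[of x y] L(1) \<beta> by (intro mult_left_mono powr_mono2) auto
      finally have "\<bar>b x - b y\<bar> * \<bar>f y\<bar> \<le> (L * (2 * c\<^sub>0 * r) powr \<beta>) * \<bar>f y\<bar>"
        by (intro mult_right_mono) auto
      then show ?thesis
        using True L(1) by (simp add: ennreal_mult[symmetric] ennreal_leI)
    qed simp
    show "AE y in lebesgue. ennreal (\<bar>b x - b y\<bar> * \<bar>f y\<bar>) * indicator (qball z r) y \<le>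
      ennreal (L * (2 * c\<^sub>0 * r) powr \<beta>) * (ennreal \<bar>f y\<bar> * indicator (qball z r) y)"
      by (rule AE_mp[OF bg], rule AE_I2, rule impI, rule pt)
  qed
  also have "\<dots> = ennreal (L * (2 * c\<^sub>0 * r) powr \<beta>) * (\<integral>\<^sup>+y\<in>qball z r. ennreal \<bar>f y\<bar> \<partial>lebesgue)"
    using f by (intro nn_integral_cmult) auto
  finally show ?thesis .
qed

text \<open>For \<open>f\<close> scaled by an admissible \<open>l\<close>, \<open>hedberg_pointwise\<close> bounds the commutator at almost every \<open>x\<close> by
\<open>D l \<Psi>\<^sup>-\<^sup>1 (\<Phi> (M (f / l) x / K))\<close>. So \<open>D l\<close> is admissible for the commutator, and the infimum over \<open>l\<close> gives
the claim.\<close>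

theorem maximal_commutator_bounded:
  assumes Y: "young_Y \<Phi>" and "young \<Psi>" and "nabla2 \<Phi>"
    and C: "\<And>t. 0 < t \<Longrightarrow> t powr (- \<beta> / Q) * young_inverse \<Phi> t \<le> C * young_inverse \<Psi> t" and C0: "0 < C"
    and \<beta>: "0 < \<beta>"
    and bg: "AE y in lebesgue. b y = g y" and L0: "\<And>x y. \<bar>g x - g y\<bar> \<le> L\<^sub>0 * d x y powr \<beta>"
  shows "orlicz_bounded \<Phi> \<Psi> (maximal_comm b)"
proof -
  interpret \<Phi>: young_Y \<Phi> by fact
  interpret \<Psi>: young \<Psi> by fact
  from maximal_theorem[OF Y \<open>nabla2 \<Phi>\<close>] obtain K where K: "2 \<le> K"
    and max: "\<And>f. f \<in> borel_measurable lebesgue \<Longrightarrow>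
      (\<integral>\<^sup>+x. young_ext \<Phi> (hl_max (\<lambda>y. ennreal \<bar>f y\<bar>) x / ennreal K) \<partial>lebesgue) \<le> (\<integral>\<^sup>+x. \<Phi> \<bar>f x\<bar> \<partial>lebesgue)"
    by blast
  define L where "L = max L\<^sub>0 1"
  have L: "0 < L" "\<bar>g x - g y\<bar> \<le> L * d x y powr \<beta>" for x y
  proof -
    have "\<bar>g x - g y\<bar> \<le> L\<^sub>0 * d x y powr \<beta>" by (rule L0)
    also have "\<dots> \<le> L * d x y powr \<beta>" by (intro mult_right_mono) (auto simp: L_def)
    finally show "\<bar>g x - g y\<bar> \<le> L * d x y powr \<beta>" .
  qed (simp add: L_def)
  define \<alpha> where "\<alpha> = \<beta> / Q"
  have \<alpha>: "0 < \<alpha>" using \<beta> Q by (simp add: \<alpha>_def)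
  define M where "M = L * (2 * c\<^sub>0) powr \<beta> * c\<^sub>1 powr (- \<alpha>)"
  have M: "0 < M" using L c0 c1 by (simp add: M_def)
  \<comment> \<open>The Lipschitz bound on a ball, as a power of its measure.\<close>
  have radius: "L * (2 * c\<^sub>0 * r) powr \<beta> = M * (c\<^sub>1 * r ^ Q) powr \<alpha>" if "0 < r" for r
  proof -
    have "(r ^ Q) powr \<alpha> = r powr \<beta>"
      using that Q by (simp add: powr_realpow[symmetric] powr_powr \<alpha>_def)
    then show ?thesis
      using that c0 c1 by (simp add: M_def powr_mult powr_minus)
  qed
  define D where "D = M * (K * C)"
  have D: "0 < D" using M K C0 by (simp add: D_def)
  have main: "orlicz_norm \<Psi> (maximal_comm b f) \<le> ennreal (D * l)"
    if f [measurable]: "f \<in> borel_measurable lebesgue" and l: "0 < l"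
      and fl: "(\<integral>\<^sup>+x. young_ext \<Phi> (ennreal \<bar>f x\<bar> / ennreal l) \<partial>lebesgue) \<le> 1" for f l
  proof -
    define h where "h = (\<lambda>x. f x / l)"
    have h [measurable]: "h \<in> borel_measurable lebesgue" by (simp add: h_def)
    have fh: "\<bar>f x\<bar> = l * \<bar>h x\<bar>" for x using l by (simp add: h_def)
    have habs: "ennreal \<bar>f x\<bar> / ennreal l = ennreal \<bar>h x\<bar>" for x
      using l by (simp add: h_def divide_ennreal)
    have h1: "(\<integral>\<^sup>+x. young_ext \<Phi> (ennreal \<bar>h x\<bar>) \<partial>lebesgue) \<le> 1"
      using fl by (simp add: habs)
    define H where "H = hl_max (\<lambda>y. ennreal \<bar>h y\<bar>)"
    have Hint: "(\<integral>\<^sup>+x. young_ext \<Phi> (H x / ennreal K) \<partial>lebesgue) \<le> 1"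
      using max[OF h] h1 by (auto simp: H_def \<Phi>.young_ext_ennreal)
    have pointwise: "young_ext \<Psi> (maximal_comm b f x / ennreal (D * l)) \<le> young_ext \<Phi> (H x / ennreal K)"
      if bx: "b x = g x" for x
    proof (cases "H x")
      case top
      then show ?thesis using K by (simp add: young_ext_def ennreal_top_divide)
    next
      case (real u)
      define w where "w = u / K"
      have w: "0 \<le> w" "u = K * w" using real K by (auto simp: w_def)
      have HK: "young_ext \<Phi> (H x / ennreal K) = \<Phi> w"
        using real K by (simp add: w_def divide_ennreal \<Phi>.young_ext_ennreal)
      have term_le: "(\<integral>\<^sup>+y\<in>qball z r. ennreal (\<bar>b x - b y\<bar> * \<bar>f y\<bar>) \<partial>lebesgue) / emeasure lebesgue (qball z r)
          \<le> ennreal (M * l * ((c\<^sub>1 * r ^ Q) powr \<alpha> * avg))"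
        if x: "x \<in> qball z r"
          and avg: "(\<integral>\<^sup>+y\<in>qball z r. ennreal \<bar>h y\<bar> \<partial>lebesgue) / emeasure lebesgue (qball z r) = ennreal avg" "0 \<le> avg"
        for z r avg
      proof -
        have r: "0 < r" using qball_radius_pos[OF x] .
        have "(\<integral>\<^sup>+y\<in>qball z r. ennreal (\<bar>b x - b y\<bar> * \<bar>f y\<bar>) \<partial>lebesgue) \<le>
            ennreal (L * (2 * c\<^sub>0 * r) powr \<beta>) * (\<integral>\<^sup>+y\<in>qball z r. ennreal \<bar>f y\<bar> \<partial>lebesgue)"
          using L \<beta> by (intro lipschitz_oscillation_le[OF bg bx _ _ _ x f]) auto
        also have "(\<integral>\<^sup>+y\<in>qball z r. ennreal \<bar>f y\<bar> \<partial>lebesgue) = ennreal l * (\<integral>\<^sup>+y\<in>qball z r. ennreal \<bar>h y\<bar> \<partial>lebesgue)"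
          using l by (simp add: fh ennreal_mult mult.assoc nn_integral_cmult)
        finally have "(\<integral>\<^sup>+y\<in>qball z r. ennreal (\<bar>b x - b y\<bar> * \<bar>f y\<bar>) \<partial>lebesgue) / emeasure lebesgue (qball z r)
            \<le> ennreal (L * (2 * c\<^sub>0 * r) powr \<beta>) * (ennreal l * (\<integral>\<^sup>+y\<in>qball z r. ennreal \<bar>h y\<bar> \<partial>lebesgue)) / emeasure lebesgue (qball z r)"
          by (rule divide_right_mono_ennreal)
        also have "\<dots> = ennreal (L * (2 * c\<^sub>0 * r) powr \<beta>) * (ennreal l * ennreal avg)"
          by (simp add: ennreal_times_divide[symmetric] avg(1) del: emeasure_completion)
        also have "\<dots> = ennreal (M * l * ((c\<^sub>1 * r ^ Q) powr \<alpha> * avg))"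
          unfolding radius[OF r] using M l avg(2) by (simp add: ennreal_mult[symmetric] mult_ac)
        finally show ?thesis .
      qed
      \<comment> \<open>The two bounds on averages that Hedberg's trick combines.\<close>
      have avg_ex: "\<exists>avg\<ge>0. (\<integral>\<^sup>+y\<in>qball z r. ennreal \<bar>h y\<bar> \<partial>lebesgue) / emeasure lebesgue (qball z r) = ennreal avg \<and>
          avg \<le> K * w \<and> avg \<le> 2 * young_inverse \<Phi> (1 / (c\<^sub>1 * r ^ Q))"
        if x: "x \<in> qball z r" for z r
      proof -
        have r: "0 < r" using qball_radius_pos[OF x] .
        define v where "v = c\<^sub>1 * r ^ Q"
        have v: "0 < v" using c1 r by (simp add: v_def)
        have le: "(\<integral>\<^sup>+y\<in>qball z r. ennreal \<bar>h y\<bar> \<partial>lebesgue) / emeasure lebesgue (qball z r) \<le> ennreal u"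
          using hl_max_ge[OF x, of "\<lambda>y. ennreal \<bar>h y\<bar>"] real by (simp add: H_def del: emeasure_completion)
        define avg where "avg = enn2real ((\<integral>\<^sup>+y\<in>qball z r. ennreal \<bar>h y\<bar> \<partial>lebesgue) / emeasure lebesgue (qball z r))"
        have avg: "0 \<le> avg"
          "(\<integral>\<^sup>+y\<in>qball z r. ennreal \<bar>h y\<bar> \<partial>lebesgue) / emeasure lebesgue (qball z r) = ennreal avg"
          unfolding avg_def by (rule enn2real_nonneg, rule ennreal_enn2real[symmetric])
            (rule le_less_trans[OF le ennreal_less_top])
        have "avg \<le> u" using le avg real by (simp add: ennreal_le_iff del: emeasure_completion)
        moreover have "ennreal avg \<le> ennreal (2 * v * young_inverse \<Phi> (1 / v)) / ennreal v"
          using \<Phi>.set_integral_le_inverse[OF _ sets_qball _ v h1, of z r] emeasure_qball[OF r, of z]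
          by (auto simp: avg(2)[symmetric] v_def[symmetric] intro!: divide_right_mono_ennreal simp del: emeasure_completion)
        then have "avg \<le> 2 * young_inverse \<Phi> (1 / v)"
          using v \<Phi>.inverse_nonneg[of "1 / v"] by (simp add: divide_ennreal ennreal_le_iff)
        ultimately show ?thesis using avg w unfolding v_def by blast
      qed
      show ?thesis
      proof (cases "w = 0")
        case True
        have "maximal_comm b f x \<le> 0"
          unfolding maximal_comm_def
        proof (rule SUP_least, clarify)
          fix z r assume x: "x \<in> qball z r"
          from avg_ex[OF x] True obtain avg where "0 \<le> avg" "avg \<le> 0"
            "(\<integral>\<^sup>+y\<in>qball z r. ennreal \<bar>h y\<bar> \<partial>lebesgue) / emeasure lebesgue (qball z r) = ennreal avg" by auto
          with term_le[OF x, of avg] show "(\<integral>\<^sup>+y\<in>qball z r. ennreal (\<bar>b x - b y\<bar> * \<bar>f y\<bar>) \<partial>lebesgue) / emeasure lebesgue (qball z r) \<le> 0"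
            by (simp del: emeasure_completion)
        qed
        then show ?thesis by (simp add: young_ext_def)
      next
        case False
        with w have w0: "0 < w" by simp
        define t where "t = enn2real (\<Phi> w)"
        have t: "\<Phi> w = ennreal t" "0 < t"
          using \<Phi>.ennreal_value[of w] \<Phi>.pos_value[OF w0] w0 by (auto simp: t_def enn2real_positive_iff \<Phi>.finite_value[unfolded infinity_ennreal_def])
        have "maximal_comm b f x \<le> ennreal (D * l * young_inverse \<Psi> t)"
          unfolding maximal_comm_def
        proof (rule SUP_least, clarify)
          fix z r assume x: "x \<in> qball z r"
          from avg_ex[OF x] obtain avg where avg: "0 \<le> avg"
            "(\<integral>\<^sup>+y\<in>qball z r. ennreal \<bar>h y\<bar> \<partial>lebesgue) / emeasure lebesgue (qball z r) = ennreal avg"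
            "avg \<le> K * w" "avg \<le> 2 * young_inverse \<Phi> (1 / (c\<^sub>1 * r ^ Q))" by blast
          have "(c\<^sub>1 * r ^ Q) powr \<alpha> * avg \<le> K * C * young_inverse \<Psi> t"
            using C c1 qball_radius_pos[OF x] \<alpha>
            by (intro hedberg_pointwise[of \<Phi> \<Psi> \<alpha> C K _ t w] \<Phi>.young_axioms \<Psi>.young_axioms C0 K t w avg) (auto simp: \<alpha>_def)
          then have "M * l * ((c\<^sub>1 * r ^ Q) powr \<alpha> * avg) \<le> M * l * (K * C * young_inverse \<Psi> t)"
            using M l by (intro mult_left_mono) auto
          also have "\<dots> = D * l * young_inverse \<Psi> t" by (simp add: D_def)
          finally show "(\<integral>\<^sup>+y\<in>qball z r. ennreal (\<bar>b x - b y\<bar> * \<bar>f y\<bar>) \<partial>lebesgue) / emeasure lebesgue (qball z r)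
              \<le> ennreal (D * l * young_inverse \<Psi> t)"
            by (rule order_trans[OF term_le[OF x avg(2,1)] ennreal_leI])
        qed
        then have "maximal_comm b f x / ennreal (D * l) \<le> ennreal (D * l * young_inverse \<Psi> t) / ennreal (D * l)"
          by (rule divide_right_mono_ennreal)
        also have "\<dots> = ennreal (young_inverse \<Psi> t)"
          using D l \<Psi>.inverse_nonneg[of t] by (simp add: divide_ennreal)
        finally have "young_ext \<Psi> (maximal_comm b f x / ennreal (D * l)) \<le> young_ext \<Psi> (ennreal (young_inverse \<Psi> t))"
          by (rule monoD[OF \<Psi>.mono_young_ext])
        also have "\<dots> \<le> ennreal t"
          using \<Psi>.apply_inverse_le[OF t(2)] \<Psi>.inverse_nonneg[of t] by (simp add: \<Psi>.young_ext_ennreal)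
        finally show ?thesis by (simp add: HK t(1))
      qed
    qed
    have "(\<integral>\<^sup>+x. young_ext \<Psi> (maximal_comm b f x / ennreal (D * l)) \<partial>lebesgue) \<le> (\<integral>\<^sup>+x. young_ext \<Phi> (H x / ennreal K) \<partial>lebesgue)"
      by (rule nn_integral_mono_AE, rule AE_mp[OF bg], rule AE_I2, rule impI, rule pointwise)
    also note Hint
    finally show ?thesis
      unfolding orlicz_norm_def using D l by (intro Inf_lower) auto
  qed
  have "orlicz_norm \<Psi> (maximal_comm b f) \<le> ennreal D * orlicz_norm \<Phi> (\<lambda>x. ennreal \<bar>f x\<bar>)"
    if f: "f \<in> orlicz_space \<Phi>" for f
  proof -
    have meas: "f \<in> borel_measurable lebesgue"
      using f unfolding orlicz_space_def by (simp add: locally_integrable_measurable)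
    have "orlicz_norm \<Psi> (maximal_comm b f) / ennreal D \<le> orlicz_norm \<Phi> (\<lambda>x. ennreal \<bar>f x\<bar>)"
      unfolding orlicz_norm_def[of \<Phi>]
    proof (rule Inf_greatest, clarify)
      fix l :: real assume l: "0 < l" "(\<integral>\<^sup>+x. young_ext \<Phi> (ennreal \<bar>f x\<bar> / ennreal l) \<partial>lebesgue) \<le> 1"
      have "orlicz_norm \<Psi> (maximal_comm b f) / ennreal D \<le> ennreal (D * l) / ennreal D"
        by (intro divide_right_mono_ennreal main meas l)
      then show "orlicz_norm \<Psi> (maximal_comm b f) / ennreal D \<le> ennreal l"
        using D l by (simp add: divide_ennreal)
    qed
    then have "ennreal D * (orlicz_norm \<Psi> (maximal_comm b f) / ennreal D) \<le> ennreal D * orlicz_norm \<Phi> (\<lambda>x. ennreal \<bar>f x\<bar>)"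
      by (rule mult_left_mono) simp
    then show ?thesis
      using D by (simp add: ennreal_times_divide mult.commute[of "ennreal D"] mult_divide_eq_ennreal)
  qed
  then show ?thesis
    unfolding orlicz_bounded_def using D by (intro exI[of _ D]) auto
qed

end


section \<open>Boundedness of the maximal commutator forces Lipschitz continuity\<close>

context ahlfors_quasimetric
begin

text \<open>The mean over a ball; the denominator is the measure of the ball if \<open>0 < r\<close>.\<close>

definition avg :: "('a \<Rightarrow> real) \<Rightarrow> 'a \<Rightarrow> real \<Rightarrow> real" where
  "avg b z r = (LINT y:qball z r|lebesgue. b y) / (c\<^sub>1 * r ^ Q)"

lemma qball_integrable:
  assumes "locally_integrable b"
  shows "set_integrable lebesgue (qball z r) b"
proof (rule set_integrable_subset)
  have "bounded (qball z r)" using qball_bounded[of z r] by (simp add: qball_def)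
  then have "compact (closure (qball z r))" by (simp add: compact_closure)
  then show "set_integrable lebesgue (closure (qball z r)) b"
    using assms unfolding locally_integrable_def by blast
qed (use closure_subset in auto)

lemma integrable_const_qball: "set_integrable lebesgue (qball z r) (\<lambda>_. c :: real)"
proof (cases "0 < r")
  case True
  then show ?thesis
    using emeasure_qball[OF True, of z] unfolding set_integrable_def
    by (intro integrable_scaleR_left integrable_real_indicator) (auto simp: less_top simp del: emeasure_completion)
next
  case False
  then have "qball z r = {}" using qball_radius_pos by blast
  then show ?thesis by (simp add: set_integrable_def)
qed

lemma measure_qball: "0 < r \<Longrightarrow> measure lebesgue (qball z r) = c\<^sub>1 * r ^ Q"
  using emeasure_qball[of r z] c1 by (simp add: measure_def del: emeasure_completion)

text \<open>The ball of the mean may be smaller than the set \<open>A\<close> on which the deviation is known; with \<open>c\<close> a mean over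
\<open>A\<close> this compares means over nested balls.\<close>

lemma avg_deviation_le:
  assumes b: "locally_integrable b" and r: "0 < r" and A: "qball z r \<subseteq> A"
    and le: "(\<integral>\<^sup>+y\<in>A. ennreal \<bar>b y - c\<bar> \<partial>lebesgue) \<le> ennreal t" and t: "0 \<le> t"
  shows "\<bar>avg b z r - c\<bar> \<le> t / (c\<^sub>1 * r ^ Q)"
proof -
  have int: "set_integrable lebesgue (qball z r) (\<lambda>y. b y - c)"
    by (intro set_integral_diff(1) qball_integrable b integrable_const_qball)
  have v: "0 < c\<^sub>1 * r ^ Q" using c1 r by simp
  have "(LINT y:qball z r|lebesgue. b y - c) = (LINT y:qball z r|lebesgue. b y) - (LINT y:qball z r|lebesgue. c)"
    by (intro set_integral_diff(2) qball_integrable b integrable_const_qball)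
  also have "(LINT y:qball z r|lebesgue. c) = (c\<^sub>1 * r ^ Q) * c"
    using measure_qball[OF r, of z] by (simp add: set_lebesgue_integral_def)
  finally have "(avg b z r - c) * (c\<^sub>1 * r ^ Q) = (LINT y:qball z r|lebesgue. b y - c)"
    using c1 r by (simp add: avg_def left_diff_distrib mult.commute[of c])
  then have "ennreal (\<bar>avg b z r - c\<bar> * (c\<^sub>1 * r ^ Q)) = ennreal (norm (LINT y:qball z r|lebesgue. b y - c))"
    using v by (metis abs_mult abs_of_pos real_norm_def)
  also have "\<dots> \<le> (\<integral>\<^sup>+y. ennreal (norm (indicator (qball z r) y *\<^sub>R (b y - c))) \<partial>lebesgue)"
    unfolding set_lebesgue_integral_def using int unfolding set_integrable_def
    by (rule integral_norm_bound_ennreal)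
  also have "\<dots> \<le> (\<integral>\<^sup>+y\<in>A. ennreal \<bar>b y - c\<bar> \<partial>lebesgue)"
    using A by (intro nn_integral_mono) (auto split: split_indicator)
  also note le
  finally have "\<bar>avg b z r - c\<bar> * (c\<^sub>1 * r ^ Q) \<le> t" using t by (simp add: ennreal_le_iff)
  then show ?thesis using v by (simp add: pos_le_divide_eq)
qed

text \<open>Halving the radius changes the mean by at most a multiple of \<open>r\<close> to the power \<open>\<beta>\<close>, so the changes sum up
geometrically. The means over shrinking balls converge to some \<open>g x\<close>, which differs from the mean over the
ball of radius \<open>r\<close> by at most a multiple of \<open>r\<close> to the power \<open>\<beta>\<close>. Comparing means over balls about \<open>x\<close> and \<open>y\<close> of radius
about \<open>d x y\<close> shows that \<open>g\<close> is Lipschitz.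

Moreover \<open>b = g\<close> almost everywhere: the average of \<open>\<bar>b - g\<bar>\<close> over a ball of radius \<open>s\<close> is at most a multiple
of \<open>s\<close> to the power \<open>\<beta>\<close>, uniformly in the centre. Cover a compact set by balls of radius \<open>\<kappa> s\<close> with
bounded total measure and let \<open>s\<close> tend to 0; the integral of \<open>\<bar>b - g\<bar>\<close> over the set is therefore 0.\<close>

theorem campanato:
  assumes b: "locally_integrable b" and \<beta>: "0 < \<beta>" and K0: "0 \<le> K\<^sub>0"
    and osc: "\<And>z r. 0 < r \<Longrightarrow>
      (\<integral>\<^sup>+y\<in>qball z r. ennreal \<bar>b y - avg b z r\<bar> \<partial>lebesgue) \<le> ennreal (K\<^sub>0 * r ^ Q * r powr \<beta>)"
  shows "\<exists>g. (AE x in lebesgue. b x = g x) \<and> (\<exists>L. \<forall>x y. \<bar>g x - g y\<bar> \<le> L * d x y powr \<beta>)"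
proof -
  define K1 where "K1 = K\<^sub>0 / c\<^sub>1"
  have K1: "0 \<le> K1" using K0 c1 by (simp add: K1_def)
  have nested: "\<bar>avg b y s - avg b x r\<bar> \<le> K1 * (r / s) ^ Q * r powr \<beta>"
    if "0 < s" "0 < r" "qball y s \<subseteq> qball x r" for x y r s
  proof -
    have "\<bar>avg b y s - avg b x r\<bar> \<le> K\<^sub>0 * r ^ Q * r powr \<beta> / (c\<^sub>1 * s ^ Q)"
      using that K0 by (intro avg_deviation_le[OF b _ _ osc]) auto
    also have "\<dots> = K1 * (r / s) ^ Q * r powr \<beta>"
      by (simp add: K1_def power_divide)
    finally show ?thesis .
  qed
  define q where "q = (1 / 2 :: real) powr \<beta>"
  have q: "0 < q" "q < 1" using \<beta> powr_less_mono2[of \<beta> "1 / 2" 1] by (simp_all add: q_def)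
  define M1 where "M1 = K1 * 2 ^ Q"
  have M1: "0 \<le> M1" using K1 by (simp add: M1_def)
  \<comment> \<open>The fixed point of \<open>M = M q + M1\<close>: this constant reproduces itself in the induction over halvings.\<close>
  define M where "M = M1 / (1 - q)"
  have M: "M1 \<le> M" "M * q + M1 = M" "0 \<le> M"
    using q M1 by (auto simp: M_def field_simps mult_left_le)
  have half: "\<bar>avg b x s - avg b x r\<bar> \<le> M1 * r powr \<beta>" if "0 < s" "r / 2 \<le> s" "s \<le> r" for x s r
  proof -
    have "\<bar>avg b x s - avg b x r\<bar> \<le> K1 * (r / s) ^ Q * r powr \<beta>"
      using that by (intro nested qball_mono) auto
    also have "\<dots> \<le> K1 * 2 ^ Q * r powr \<beta>"
      using that K1 by (intro mult_right_mono mult_left_mono power_mono) (auto simp: field_simps)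
    finally show ?thesis by (simp add: M1_def)
  qed
  have dyadic: "\<bar>avg b x s - avg b x r\<bar> \<le> M * r powr \<beta>"
    if "0 < s" "r / 2 ^ Suc n \<le> s" "s \<le> r" for x s r n
    using that
  proof (induction n arbitrary: r)
    case 0
    then have "\<bar>avg b x s - avg b x r\<bar> \<le> M1 * r powr \<beta>" by (intro half) auto
    also have "\<dots> \<le> M * r powr \<beta>" using M by (intro mult_right_mono) auto
    finally show ?case .
  next
    case (Suc n)
    show ?case
    proof (cases "r / 2 \<le> s")
      case True
      then have "\<bar>avg b x s - avg b x r\<bar> \<le> M1 * r powr \<beta>" using Suc.prems by (intro half) auto
      also have "\<dots> \<le> M * r powr \<beta>" using M by (intro mult_right_mono) auto
      finally show ?thesis .
    next
      case False
      have r: "0 < r" using Suc.prems by linarith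
      have "\<bar>avg b x s - avg b x (r / 2)\<bar> \<le> M * (r / 2) powr \<beta>"
        using Suc.prems False by (intro Suc.IH) (auto simp: field_simps)
      also have "(r / 2) powr \<beta> = q * r powr \<beta>"
        using r by (simp add: q_def powr_divide)
      finally have 1: "\<bar>avg b x s - avg b x (r / 2)\<bar> \<le> M * q * r powr \<beta>" by simp
      have 2: "\<bar>avg b x (r / 2) - avg b x r\<bar> \<le> M1 * r powr \<beta>" using r by (intro half) auto
      have "\<bar>avg b x s - avg b x r\<bar> \<le> (M * q + M1) * r powr \<beta>"
        using 1 2 by (simp add: distrib_right)
      then show ?thesis by (simp only: M)
    qed
  qed
  have tele: "\<bar>avg b x s - avg b x r\<bar> \<le> M * r powr \<beta>" if "0 < s" "s \<le> r" for x s r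
  proof -
    obtain n where "r / s < 2 ^ n" using real_arch_pow[of 2 "r / s"] by auto
    also have "(2::real) ^ n \<le> 2 ^ Suc n" by simp
    finally show ?thesis using that by (intro dyadic[of s r n]) (auto simp: field_simps)
  qed
  define a where "a = (\<lambda>x n. avg b x ((1 / 2) ^ n))"
  have scale_to_0: "(\<lambda>n. M * ((1 / 2 :: real) ^ n) powr \<beta>) \<longlonglongrightarrow> 0"
  proof -
    have "((1 / 2 :: real) ^ n) powr \<beta> = q ^ n" for n
      by (simp add: q_def powr_realpow[symmetric] powr_powr powr_power mult.commute)
    moreover have "(\<lambda>n. M * q ^ n) \<longlonglongrightarrow> M * 0"
      using q by (intro tendsto_intros LIMSEQ_power_zero) auto
    ultimately show ?thesis by simp
  qed
  have "Cauchy (a x)" for x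
  proof (rule CauchyI')
    fix e :: real assume "0 < e"
    then have "\<forall>\<^sub>F n in sequentially. M * ((1 / 2 :: real) ^ n) powr \<beta> < e"
      using scale_to_0 by (intro order_tendstoD(2)) auto
    then obtain N where N: "\<And>n. N \<le> n \<Longrightarrow> M * ((1 / 2 :: real) ^ n) powr \<beta> < e"
      by (auto simp: eventually_sequentially)
    show "\<exists>N. \<forall>m\<ge>N. \<forall>n>m. dist (a x m) (a x n) < e"
    proof (intro exI allI impI)
      fix m n assume mn: "N \<le> m" "m < n"
      have "\<bar>a x n - a x m\<bar> \<le> M * ((1 / 2 :: real) ^ m) powr \<beta>"
        using mn unfolding a_def by (intro tele) (auto intro: power_decreasing)
      then show "dist (a x m) (a x n) < e"
        using N[OF mn(1)] by (simp add: dist_real_def abs_minus_commute)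
    qed
  qed
  then have conv: "convergent (a x)" for x by (rule Cauchy_convergent)
  define g where "g = (\<lambda>x. lim (a x))"
  have lim: "a x \<longlonglongrightarrow> g x" for x
    using conv by (simp add: g_def convergent_LIMSEQ_iff)
  have g_avg: "\<bar>g x - avg b x r\<bar> \<le> M * r powr \<beta>" if "0 < r" for x r
  proof -
    have "\<forall>\<^sub>F n in sequentially. (1 / 2 :: real) ^ n < r"
      using LIMSEQ_power_zero[of "1 / 2 :: real"] that by (intro order_tendstoD(2)) auto
    then have "\<forall>\<^sub>F n in sequentially. \<bar>a x n - avg b x r\<bar> \<le> M * r powr \<beta>"
      by eventually_elim (auto simp: a_def intro: tele)
    moreover have "(\<lambda>n. \<bar>a x n - avg b x r\<bar>) \<longlonglongrightarrow> \<bar>g x - avg b x r\<bar>"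
      by (intro tendsto_intros lim)
    ultimately show ?thesis by (intro tendsto_upperbound) auto
  qed
  define L where "L = M * (2 * c\<^sub>0) powr \<beta> + K1 * (2 * c\<^sub>0) ^ Q * (2 * c\<^sub>0) powr \<beta> + M"
  have L: "0 \<le> L" using M K1 c0 by (simp add: L_def)
  have lip: "\<bar>g x - g y\<bar> \<le> L * d x y powr \<beta>" for x y
  proof (cases "x = y")
    case False
    define \<delta> where "\<delta> = d x y"
    have \<delta>: "0 < \<delta>" using False d_nonneg[of x y] d_eq_0[of x y] by (auto simp: \<delta>_def order.order_iff_strict)
    have sub: "qball y \<delta> \<subseteq> qball x (2 * c\<^sub>0 * \<delta>)"
    proof
      fix u assume u: "u \<in> qball y \<delta>"
      have "d x u \<le> c\<^sub>0 * (d x y + d y u)" by (rule d_triangle)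
      also have "\<dots> < c\<^sub>0 * (\<delta> + \<delta>)"
        using u c0 by (intro mult_strict_left_mono) (auto simp: mem_qball \<delta>_def)
      finally show "u \<in> qball x (2 * c\<^sub>0 * \<delta>)" by (simp add: mem_qball)
    qed
    have pw: "(2 * c\<^sub>0 * \<delta>) powr \<beta> = (2 * c\<^sub>0) powr \<beta> * \<delta> powr \<beta>"
      using c0 \<delta> by (simp add: powr_mult)
    have 1: "\<bar>g x - avg b x (2 * c\<^sub>0 * \<delta>)\<bar> \<le> M * (2 * c\<^sub>0) powr \<beta> * \<delta> powr \<beta>"
    proof -
      have "0 < 2 * c\<^sub>0 * \<delta>" using c0 \<delta> by simp
      from g_avg[OF this, of x, unfolded pw] show ?thesis by (simp only: mult.assoc)
    qed
    have 2: "\<bar>avg b y \<delta> - avg b x (2 * c\<^sub>0 * \<delta>)\<bar> \<le> K1 * (2 * c\<^sub>0) ^ Q * (2 * c\<^sub>0) powr \<beta> * \<delta> powr \<beta>"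
    proof -
      have "0 < 2 * c\<^sub>0 * \<delta>" "2 * c\<^sub>0 * \<delta> / \<delta> = 2 * c\<^sub>0" using c0 \<delta> by auto
      with nested[OF \<delta> _ sub, unfolded pw] show ?thesis by (simp only: mult.assoc)
    qed
    have 3: "\<bar>g y - avg b y \<delta>\<bar> \<le> M * \<delta> powr \<beta>" by (rule g_avg[OF \<delta>])
    have "\<bar>g x - g y\<bar> \<le> M * (2 * c\<^sub>0) powr \<beta> * \<delta> powr \<beta> + K1 * (2 * c\<^sub>0) ^ Q * (2 * c\<^sub>0) powr \<beta> * \<delta> powr \<beta> + M * \<delta> powr \<beta>"
      using 1 2 3 by linarith
    then show ?thesis by (simp add: L_def \<delta>_def distrib_right)
  qed (use L in simp)
  have g_cont: "continuous_on UNIV g"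
  proof (simp add: continuous_on_eq_continuous_at isCont_def, intro allI)
    fix x
    have "(d x \<longlongrightarrow> d x x) (at x)"
      using d_continuous[of x] by (simp add: continuous_on_eq_continuous_at isCont_def)
    then have "(d x \<longlongrightarrow> 0) (at x)" using d_eq_0[of x x] by simp
    then have "((\<lambda>y. d x y powr \<beta>) \<longlongrightarrow> 0) (at x)"
      by (rule tendsto_zero_powrI[OF _ tendsto_const]) (use \<beta> d_nonneg in \<open>auto intro: always_eventually\<close>)
    then have "((\<lambda>y. L * d x y powr \<beta>) \<longlongrightarrow> L * 0) (at x)"
      by (rule tendsto_mult_left)
    then have null: "((\<lambda>y. L * d x y powr \<beta>) \<longlongrightarrow> 0) (at x)" by simp
    have "\<forall>y. norm (g y - g x) \<le> L * d x y powr \<beta>"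
      using lip[of x] by (simp add: abs_minus_commute[of _ "g x"])
    then have "((\<lambda>y. g y - g x) \<longlongrightarrow> 0) (at x)"
      by (intro Lim_null_comparison[OF _ null] always_eventually)
    then show "(g \<longlongrightarrow> g x) (at x)" by (simp add: LIM_zero_iff)
  qed
  have g_meas [measurable]: "g \<in> borel_measurable lebesgue"
    using borel_measurable_continuous_onI[OF g_cont] by (auto intro: measurable_completion)
  have b_meas [measurable]: "b \<in> borel_measurable lebesgue"
    by (rule locally_integrable_measurable[OF b])
  define D where "D = K\<^sub>0 / c\<^sub>1 + M + L"
  have D: "0 \<le> D" using K0 c1 M L by (simp add: D_def)
  have small: "(\<integral>\<^sup>+y\<in>qball z s. ennreal \<bar>b y - g y\<bar> \<partial>lebesgue) \<le> ennreal (D * s powr \<beta>) * emeasure lebesgue (qball z s)"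
    if s: "0 < s" for z s
  proof -
    define c where "c = (M + L) * s powr \<beta>"
    have c: "0 \<le> c" using M L by (simp add: c_def)
    have "\<bar>b y - g y\<bar> \<le> \<bar>b y - avg b z s\<bar> + c" if "y \<in> qball z s" for y
    proof -
      have "\<bar>g z - g y\<bar> \<le> L * d z y powr \<beta>" by (rule lip)
      also have "\<dots> \<le> L * s powr \<beta>"
        using that L \<beta> d_nonneg[of z y] by (intro mult_left_mono powr_mono2) (auto simp: mem_qball)
      finally show ?thesis
        using g_avg[OF s, of z] by (simp add: c_def distrib_right)
    qed
    then have "(\<integral>\<^sup>+y\<in>qball z s. ennreal \<bar>b y - g y\<bar> \<partial>lebesgue) \<le>
        (\<integral>\<^sup>+y. ennreal \<bar>b y - avg b z s\<bar> * indicator (qball z s) y + ennreal c * indicator (qball z s) y \<partial>lebesgue)"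
      using c by (intro nn_integral_mono) (auto split: split_indicator simp: ennreal_plus[symmetric] simp del: ennreal_plus intro!: ennreal_leI)
    also have "\<dots> = (\<integral>\<^sup>+y\<in>qball z s. ennreal \<bar>b y - avg b z s\<bar> \<partial>lebesgue) + ennreal c * emeasure lebesgue (qball z s)"
      by (simp add: nn_integral_add nn_integral_cmult_indicator del: emeasure_completion)
    also have "\<dots> \<le> ennreal (K\<^sub>0 * s ^ Q * s powr \<beta>) + ennreal c * emeasure lebesgue (qball z s)"
      by (intro add_right_mono osc s)
    also have "\<dots> = ennreal (D * s powr \<beta>) * emeasure lebesgue (qball z s)"
      unfolding emeasure_qball[OF s] using s c1 K0 M L D c
      by (simp add: ennreal_mult[symmetric] ennreal_plus[symmetric] D_def c_def field_simps del: ennreal_plus)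
    finally show ?thesis .
  qed
  have zero: "(\<integral>\<^sup>+y\<in>K. ennreal \<bar>b y - g y\<bar> \<partial>lebesgue) = 0" if K: "compact K" for K
  proof -
    have "compact (d 0 ` K)"
      by (rule compact_continuous_image[OF continuous_on_subset[OF d_continuous] K]) simp
    then obtain R0 where R0: "\<And>x. x \<in> K \<Longrightarrow> d 0 x \<le> R0"
      by (metis bounded_imp_bdd_above bdd_above.E compact_imp_bounded imageI)
    define R where "R = c\<^sub>0 * (max R0 0 + 2)"
    have R: "0 < R" using c0 by (simp add: R_def add_nonneg_pos)
    have inR: "qball x s \<subseteq> qball 0 R" if "x \<in> K" "s \<le> 1" for x s
    proof
      fix u assume u: "u \<in> qball x s"
      have "d 0 u \<le> c\<^sub>0 * (d 0 x + d x u)" by (rule d_triangle)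
      also have "\<dots> < c\<^sub>0 * (max R0 0 + 2)"
        using u R0[OF that(1)] that c0 by (intro mult_strict_left_mono) (auto simp: mem_qball)
      finally show "u \<in> qball 0 R" by (simp add: mem_qball R_def)
    qed
    have le: "(\<integral>\<^sup>+y\<in>K. ennreal \<bar>b y - g y\<bar> \<partial>lebesgue) \<le>
        ennreal (D * (\<kappa> * s) powr \<beta> * \<kappa> ^ Q * (c\<^sub>1 * R ^ Q))" if s: "0 < s" "s \<le> 1" for s
    proof -
      have "K \<subseteq> (\<Union>p\<in>K \<times> {s}. case p of (z, r) \<Rightarrow> qball z r)"
        using centre_in_qball s by auto
      then obtain I where I: "I \<subseteq> K \<times> {s}" "finite I" "K \<subseteq> (\<Union>(z, r)\<in>I. qball z r)"
        using compactE_image[OF K, of "K \<times> {s}" "\<lambda>(z, r). qball z r"] open_qball by (auto simp: case_prod_beta)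
      from vitali_finite[OF I(2)] obtain J where J: "J \<subseteq> I" "disjoint_family_on (\<lambda>(z, r). qball z r) J"
        "(\<Union>(z, r)\<in>I. qball z r) \<subseteq> (\<Union>(z, r)\<in>J. qball z (\<kappa> * r))"
        using I(1) s by auto
      have finJ: "finite J" using J(1) I(2) finite_subset by blast
      have Js: "snd p = s" "fst p \<in> K" if "p \<in> J" for p using that J(1) I(1) by auto
      have \<kappa>s: "0 < \<kappa> * s" using kappa_ge_1 s by simp
      have "(\<integral>\<^sup>+y\<in>K. ennreal \<bar>b y - g y\<bar> \<partial>lebesgue) \<le>
          (\<integral>\<^sup>+y. (\<Sum>p\<in>J. ennreal \<bar>b y - g y\<bar> * indicator (qball (fst p) (\<kappa> * s)) y) \<partial>lebesgue)"
      proof (rule nn_integral_mono)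
        fix y
        show "ennreal \<bar>b y - g y\<bar> * indicator K y \<le> (\<Sum>p\<in>J. ennreal \<bar>b y - g y\<bar> * indicator (qball (fst p) (\<kappa> * s)) y)"
        proof (cases "y \<in> K")
          case True
          then have "y \<in> (\<Union>(z, r)\<in>J. qball z (\<kappa> * r))" using I(3) J(3) by blast
          then obtain p where p: "p \<in> J" "y \<in> qball (fst p) (\<kappa> * s)" using Js(1) by fastforce
          have "ennreal \<bar>b y - g y\<bar> * indicator K y = ennreal \<bar>b y - g y\<bar> * indicator (qball (fst p) (\<kappa> * s)) y"
            using True p by simp
          also have "\<dots> \<le> (\<Sum>p\<in>J. ennreal \<bar>b y - g y\<bar> * indicator (qball (fst p) (\<kappa> * s)) y)"
            by (rule member_le_sum[OF p(1) _ finJ]) simp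
          finally show ?thesis .
        qed simp
      qed
      also have "\<dots> = (\<Sum>p\<in>J. \<integral>\<^sup>+y\<in>qball (fst p) (\<kappa> * s). ennreal \<bar>b y - g y\<bar> \<partial>lebesgue)"
        by (rule nn_integral_sum) measurable
      also have "\<dots> \<le> (\<Sum>p\<in>J. ennreal (D * (\<kappa> * s) powr \<beta>) * (ennreal (\<kappa> ^ Q) * emeasure lebesgue (qball (fst p) s)))"
        using small[OF \<kappa>s] by (intro sum_mono) (simp add: emeasure_enlarged_qball[OF s(1)] del: emeasure_completion)
      also have "\<dots> = ennreal (D * (\<kappa> * s) powr \<beta>) * ennreal (\<kappa> ^ Q) * (\<Sum>p\<in>J. emeasure lebesgue (qball (fst p) s))"
        by (simp add: sum_distrib_left mult.assoc)
      also have "(\<Sum>p\<in>J. emeasure lebesgue (qball (fst p) s)) = emeasure lebesgue (\<Union>p\<in>J. qball (fst p) s)"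
      proof (rule sum_emeasure)
        show "disjoint_family_on (\<lambda>p. qball (fst p) s) J"
          using J(2) Js(1) by (simp add: disjoint_family_on_def case_prod_beta)
      qed (use finJ sets_qball in auto)
      also have "ennreal (D * (\<kappa> * s) powr \<beta>) * ennreal (\<kappa> ^ Q) * emeasure lebesgue (\<Union>p\<in>J. qball (fst p) s) \<le>
          ennreal (D * (\<kappa> * s) powr \<beta>) * ennreal (\<kappa> ^ Q) * emeasure lebesgue (qball 0 R)"
      proof (intro mult_left_mono emeasure_mono)
        show "(\<Union>p\<in>J. qball (fst p) s) \<subseteq> qball 0 R"
          using inR[OF Js(2) s(2)] by blast
      qed (use sets_qball in auto)
      also have "emeasure lebesgue (qball 0 R) = ennreal (c\<^sub>1 * R ^ Q)" by (rule emeasure_qball[OF R])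
      finally show ?thesis
        using D kappa_ge_1 c1 R by (simp add: ennreal_mult[symmetric] mult_left_mono)
    qed
    have "((\<lambda>s. ennreal (D * (\<kappa> * s) powr \<beta> * \<kappa> ^ Q * (c\<^sub>1 * R ^ Q))) \<longlongrightarrow> ennreal (D * 0 * \<kappa> ^ Q * (c\<^sub>1 * R ^ Q))) (at_right 0)"
    proof (intro tendsto_intros tendsto_zero_powrI)
      show "((\<lambda>s. \<kappa> * s) \<longlongrightarrow> 0) (at_right 0)" by (auto intro!: tendsto_eq_intros)
      show "\<forall>\<^sub>F s in at_right 0. 0 \<le> \<kappa> * s"
        using eventually_at_right_less[of "0::real"] kappa_ge_1 by (auto elim!: eventually_mono)
    qed (use \<beta> in auto)
    moreover have "\<forall>\<^sub>F s in at_right 0. (\<integral>\<^sup>+y\<in>K. ennreal \<bar>b y - g y\<bar> \<partial>lebesgue) \<le>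
        ennreal (D * (\<kappa> * s) powr \<beta> * \<kappa> ^ Q * (c\<^sub>1 * R ^ Q))"
      using le by (intro eventually_at_rightI[of 0 1]) auto
    ultimately have "(\<integral>\<^sup>+y\<in>K. ennreal \<bar>b y - g y\<bar> \<partial>lebesgue) \<le> ennreal (D * 0 * \<kappa> ^ Q * (c\<^sub>1 * R ^ Q))"
      by (intro tendsto_lowerbound) auto
    then show ?thesis by simp
  qed
  have "AE x in lebesgue. \<forall>n. x \<in> cball 0 (real n) \<longrightarrow> b x = g x"
    unfolding AE_all_countable
  proof
    fix n
    have [measurable]: "cball 0 (real n) \<in> sets (lebesgue :: 'a measure)" by simp
    have "AE x in lebesgue. ennreal \<bar>b x - g x\<bar> * indicator (cball 0 (real n)) x = 0"
      using zero[OF compact_cball, of 0 "real n"] by (subst (asm) nn_integral_0_iff_AE) measurable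
    then show "AE x in lebesgue. x \<in> cball 0 (real n) \<longrightarrow> b x = g x"
      by eventually_elim (auto split: split_indicator_asm)
  qed
  then have "AE x in lebesgue. b x = g x"
    by eventually_elim (metis mem_cball_0 real_arch_simple)
  with lip show ?thesis by blast
qed


text \<open>The mean of \<open>\<bar>b x - b y\<bar>\<close> over \<open>y\<close> in the ball is one of the averages in the supremum, and it is at
least the absolute value of the mean of \<open>b x - b y\<close>.\<close>

lemma oscillation_le_maximal_comm:
  assumes b: "locally_integrable b" and x: "x \<in> qball z r"
  shows "ennreal \<bar>b x - avg b z r\<bar> \<le> maximal_comm b (indicator (qball z r)) x"
proof -
  have r: "0 < r" using qball_radius_pos[OF x] .
  have v: "0 < c\<^sub>1 * r ^ Q" using c1 r by simp
  have [measurable]: "b \<in> borel_measurable lebesgue" by (rule locally_integrable_measurable[OF b])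
  have int: "set_integrable lebesgue (qball z r) (\<lambda>y. \<bar>b y - b x\<bar>)"
    using set_integrable_abs[OF set_integral_diff(1)[OF qball_integrable[OF b] integrable_const_qball]] .
  define t where "t = (LINT y:qball z r|lebesgue. \<bar>b y - b x\<bar>)"
  have t: "0 \<le> t" unfolding t_def set_lebesgue_integral_def by (intro integral_nonneg_AE) auto
  have eq: "(\<integral>\<^sup>+y\<in>qball z r. ennreal \<bar>b y - b x\<bar> \<partial>lebesgue) = ennreal t"
  proof -
    have "(\<integral>\<^sup>+y\<in>qball z r. ennreal \<bar>b y - b x\<bar> \<partial>lebesgue) =
        (\<integral>\<^sup>+y. ennreal (indicator (qball z r) y *\<^sub>R \<bar>b y - b x\<bar>) \<partial>lebesgue)"
      by (intro nn_integral_cong) (auto split: split_indicator)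
    also have "\<dots> = ennreal t"
      unfolding t_def set_lebesgue_integral_def using int unfolding set_integrable_def
      by (intro nn_integral_eq_integral) auto
    finally show ?thesis .
  qed
  have "\<bar>avg b z r - b x\<bar> \<le> t / (c\<^sub>1 * r ^ Q)"
    by (rule avg_deviation_le[OF b r order_refl _ t]) (simp add: eq)
  then have "ennreal \<bar>b x - avg b z r\<bar> \<le> ennreal (t / (c\<^sub>1 * r ^ Q))"
    by (intro ennreal_leI) (simp add: abs_minus_commute)
  also have "\<dots> = (\<integral>\<^sup>+y\<in>qball z r. ennreal \<bar>b y - b x\<bar> \<partial>lebesgue) / emeasure lebesgue (qball z r)"
    unfolding eq emeasure_qball[OF r] using t v by (simp add: divide_ennreal)
  also have "(\<integral>\<^sup>+y\<in>qball z r. ennreal \<bar>b y - b x\<bar> \<partial>lebesgue) =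
      (\<integral>\<^sup>+y\<in>qball z r. ennreal (\<bar>b x - b y\<bar> * \<bar>indicator (qball z r) y\<bar>) \<partial>lebesgue)"
    by (intro nn_integral_cong) (auto split: split_indicator simp: abs_minus_commute)
  also have "\<dots> / emeasure lebesgue (qball z r) \<le> maximal_comm b (indicator (qball z r)) x"
    unfolding maximal_comm_def by (rule SUP_upper) (use x in blast)
  finally show ?thesis .
qed

lemma indicator_orlicz:
  assumes "young_Y \<Phi>" and r: "0 < r" and v: "v = c\<^sub>1 * r ^ Q"
  shows "indicator (qball z r) \<in> orlicz_space \<Phi>"
    and "orlicz_norm \<Phi> (\<lambda>x. ennreal \<bar>indicator (qball z r) x\<bar>) \<le> ennreal (1 / young_inverse \<Phi> (1 / v))"
proof -
  interpret young_Y \<Phi> by fact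
  have v0: "0 < v" using c1 r by (simp add: v)
  define k where "k = young_inverse \<Phi> (1 / v)"
  have k: "0 < k" using inverse_pos v0 by (simp add: k_def)
  have "\<Phi> k \<le> ennreal (1 / v)" unfolding k_def using v0 by (intro apply_inverse_le) simp
  then have "\<Phi> k * ennreal v \<le> ennreal (1 / v) * ennreal v" by (rule mult_right_mono) simp
  also have "\<dots> = 1" using v0 by (simp add: ennreal_mult[symmetric])
  finally have kv: "\<Phi> k * ennreal v \<le> 1" .
  have int: "(\<integral>\<^sup>+x. \<Phi> (k * \<bar>indicator (qball z r) x\<bar>) \<partial>lebesgue) \<le> 1"
  proof -
    have "(\<integral>\<^sup>+x. \<Phi> (k * \<bar>indicator (qball z r) x\<bar>) \<partial>lebesgue) = (\<integral>\<^sup>+x. \<Phi> k * indicator (qball z r) x \<partial>lebesgue)"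
      by (intro nn_integral_cong) (auto split: split_indicator)
    also have "\<dots> = \<Phi> k * ennreal v"
      using emeasure_qball[OF r, of z] by (simp add: nn_integral_cmult_indicator v del: emeasure_completion)
    finally show ?thesis using kv by simp
  qed
  have "locally_integrable (indicator (qball z r) :: 'a \<Rightarrow> real)"
    unfolding locally_integrable_def
  proof (intro allI impI)
    fix K :: "'a set" assume K: "compact K"
    have "integrable lebesgue (indicator (K \<inter> qball z r) :: 'a \<Rightarrow> real)"
    proof (rule integrable_real_indicator)
      have "K \<in> sets lebesgue" using K by (simp add: compact_imp_closed)
      then show "K \<inter> qball z r \<in> sets lebesgue" by auto
      have "emeasure lebesgue (K \<inter> qball z r) \<le> emeasure lebesgue (qball z r)" by (rule emeasure_mono) auto
      then show "emeasure lebesgue (K \<inter> qball z r) < \<infinity>"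
        unfolding emeasure_qball[OF r] by (rule le_less_trans) simp
    qed
    moreover have "(\<lambda>x. indicator K x *\<^sub>R indicator (qball z r) x) = (indicator (K \<inter> qball z r) :: 'a \<Rightarrow> real)"
      by (simp add: fun_eq_iff indicator_inter_arith)
    ultimately show "set_integrable lebesgue K (indicator (qball z r) :: 'a \<Rightarrow> real)"
      by (simp only: set_integrable_def)
  qed
  then show "indicator (qball z r) \<in> orlicz_space \<Phi>"
    unfolding orlicz_space_def using int k
    by (auto intro!: exI[of _ k] intro: le_less_trans)
  have "(\<integral>\<^sup>+x. young_ext \<Phi> (ennreal \<bar>indicator (qball z r) x\<bar> / ennreal (1 / k)) \<partial>lebesgue) \<le> 1"
  proof -
    have "young_ext \<Phi> (ennreal \<bar>indicator (qball z r) x\<bar> / ennreal (1 / k)) = \<Phi> (k * \<bar>indicator (qball z r) x\<bar>)" for x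
      using k by (simp add: divide_ennreal young_ext_ennreal mult.commute)
    then show ?thesis using int by simp
  qed
  then show "orlicz_norm \<Phi> (\<lambda>x. ennreal \<bar>indicator (qball z r) x\<bar>) \<le> ennreal (1 / young_inverse \<Phi> (1 / v))"
    unfolding orlicz_norm_def k_def[symmetric] using k by (intro Inf_lower) auto
qed

text \<open>Testing the boundedness on the indicator function of a ball of measure \<open>v\<close> yields an \<open>l\<close>, admissible for the commutator,
of size \<open>(N + 1) / \<Phi>\<^sup>-\<^sup>1 (1 / v)\<close>. So \<open>\<bar>b - avg b z r\<bar> / l\<close> has mean at most \<open>2 \<Psi>\<^sup>-\<^sup>1 (1 / v)\<close> by
\<open>set_integral_le_inverse\<close>, and the hypothesis bounds the quotient \<open>\<Psi>\<^sup>-\<^sup>1 (1 / v) / \<Phi>\<^sup>-\<^sup>1 (1 / v)\<close> by a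
multiple of \<open>v\<close> to the power \<open>\<beta> / Q\<close>.\<close>

theorem lipschitz_of_bounded:
  assumes Y: "young_Y \<Phi>" and "young \<Psi>" and b: "locally_integrable b" and \<beta>: "0 < \<beta>"
    and C: "\<And>t. 0 < t \<Longrightarrow> young_inverse \<Psi> t \<le> C * young_inverse \<Phi> t * t powr (- \<beta> / Q)" and C0: "0 < C"
    and bdd: "orlicz_bounded \<Phi> \<Psi> (maximal_comm b)"
  shows "\<exists>g. (AE x in lebesgue. b x = g x) \<and> (\<exists>L. \<forall>x y. \<bar>g x - g y\<bar> \<le> L * d x y powr \<beta>)"
proof -
  interpret \<Phi>: young_Y \<Phi> by fact
  interpret \<Psi>: young \<Psi> by fact
  have [measurable]: "b \<in> borel_measurable lebesgue" by (rule locally_integrable_measurable[OF b])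
  from bdd obtain N where N: "0 \<le> N" "\<And>f. f \<in> orlicz_space \<Phi> \<Longrightarrow>
      orlicz_norm \<Psi> (maximal_comm b f) \<le> ennreal N * orlicz_norm \<Phi> (\<lambda>x. ennreal \<bar>f x\<bar>)"
    unfolding orlicz_bounded_def by blast
  define K\<^sub>0 where "K\<^sub>0 = 2 * (N + 1) * C * c\<^sub>1 * c\<^sub>1 powr (\<beta> / Q)"
  show ?thesis
  proof (rule campanato[OF b \<beta>])
    show "0 \<le> K\<^sub>0" using N C0 c1 by (simp add: K\<^sub>0_def)
    fix z r assume r: "0 < (r::real)"
    define v where "v = c\<^sub>1 * r ^ Q"
    have v: "0 < v" using c1 r by (simp add: v_def)
    define k where "k = young_inverse \<Phi> (1 / v)"
    have k: "0 < k" using \<Phi>.inverse_pos v by (simp add: k_def)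
    have "orlicz_norm \<Psi> (maximal_comm b (indicator (qball z r))) \<le>
        ennreal N * orlicz_norm \<Phi> (\<lambda>x. ennreal \<bar>indicator (qball z r) x\<bar>)"
      by (intro N indicator_orlicz[OF Y r v_def])
    also have "\<dots> \<le> ennreal N * ennreal (1 / k)"
      unfolding k_def by (intro mult_left_mono indicator_orlicz[OF Y r v_def]) simp
    \<comment> \<open>\<open>N + 1\<close> instead of \<open>N\<close>: the norm is an infimum, so an admissible \<open>l\<close> exists only strictly above it.\<close>
    also have "\<dots> < ennreal ((N + 1) / k)"
      using N k by (simp add: ennreal_mult[symmetric] ennreal_less_iff divide_strict_right_mono)
    finally obtain l where l: "0 < l" "ennreal l < ennreal ((N + 1) / k)"
      "(\<integral>\<^sup>+x. young_ext \<Psi> (maximal_comm b (indicator (qball z r)) x / ennreal l) \<partial>lebesgue) \<le> 1"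
      unfolding orlicz_norm_def Inf_less_iff by blast
    have lN: "l \<le> (N + 1) / k" using l(1,2) by (simp add: ennreal_less_iff)
    define G where "G = (\<lambda>x. ennreal \<bar>b x - avg b z r\<bar> * indicator (qball z r) x / ennreal l)"
    have G [measurable]: "G \<in> borel_measurable lebesgue" by (simp add: G_def)
    have "G x \<le> maximal_comm b (indicator (qball z r)) x / ennreal l" for x
      unfolding G_def using oscillation_le_maximal_comm[OF b, of x z r]
      by (intro divide_right_mono_ennreal) (auto split: split_indicator)
    then have "(\<integral>\<^sup>+x. young_ext \<Psi> (G x) \<partial>lebesgue) \<le>
        (\<integral>\<^sup>+x. young_ext \<Psi> (maximal_comm b (indicator (qball z r)) x / ennreal l) \<partial>lebesgue)"
      by (intro nn_integral_mono monoD[OF \<Psi>.mono_young_ext])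
    also note l(3)
    finally have "(\<integral>\<^sup>+x\<in>qball z r. G x \<partial>lebesgue) \<le> ennreal (2 * v * young_inverse \<Psi> (1 / v))"
      using emeasure_qball[OF r, of z] v
      by (intro \<Psi>.set_integral_le_inverse) (auto simp: v_def simp del: emeasure_completion)
    then have "ennreal l * (\<integral>\<^sup>+x\<in>qball z r. G x \<partial>lebesgue) \<le> ennreal l * ennreal (2 * v * young_inverse \<Psi> (1 / v))"
      by (rule mult_left_mono) simp
    also have "ennreal l * (\<integral>\<^sup>+x\<in>qball z r. G x \<partial>lebesgue) = (\<integral>\<^sup>+x. ennreal l * (G x * indicator (qball z r) x) \<partial>lebesgue)"
      by (rule nn_integral_cmult[symmetric]) measurable
    also have "\<dots> = (\<integral>\<^sup>+y\<in>qball z r. ennreal \<bar>b y - avg b z r\<bar> \<partial>lebesgue)"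
      using l(1) by (intro nn_integral_cong)
        (auto simp: G_def divide_ennreal ennreal_mult[symmetric] split: split_indicator)
    also have "ennreal l * ennreal (2 * v * young_inverse \<Psi> (1 / v)) = ennreal (l * (2 * v * young_inverse \<Psi> (1 / v)))"
      using l(1) by (simp add: ennreal_mult')
    also have "l * (2 * v * young_inverse \<Psi> (1 / v)) \<le> (N + 1) / k * (2 * v * (C * k * (1 / v) powr (- \<beta> / Q)))"
      using C[of "1 / v"] v lN l(1) N k \<Psi>.inverse_nonneg unfolding k_def[symmetric]
      by (intro mult_mono mult_left_mono) (auto simp: k_def)
    also have "\<dots> = 2 * (N + 1) * C * (v * v powr (\<beta> / Q))"
      using k v by (simp add: powr_divide powr_minus_divide)
    also have "\<dots> = K\<^sub>0 * r ^ Q * r powr \<beta>"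
    proof -
      have "(r ^ Q) powr (\<beta> / Q) = r powr \<beta>"
        using r Q by (simp add: powr_realpow[symmetric] powr_powr)
      then show ?thesis using r c1 by (simp add: K\<^sub>0_def v_def powr_mult)
    qed
    finally show "(\<integral>\<^sup>+y\<in>qball z r. ennreal \<bar>b y - avg b z r\<bar> \<partial>lebesgue) \<le> ennreal (K\<^sub>0 * r ^ Q * r powr \<beta>)"
      by (simp add: ennreal_leI)
  qed
qed

end


section \<open>The characterization on stratified groups\<close>

context stratified_group
begin

interpretation G: Groups.group mul 0 uminus
  by (rule group_mul)

lemma bounded_left_translate:
  assumes "bounded S"
  shows "bounded (mul a ` S)"
proof -
  have "compact (mul a ` closure S)"
    using assms by (intro compact_continuous_image continuous_on_mul continuous_intros)
      (simp_all add: compact_closure)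
  then show ?thesis
    using bounded_subset[OF compact_imp_bounded image_mono[OF closure_subset]] by blast
qed

text \<open>Balls of the group are the balls of the quasi-metric \<open>\<rho> (y\<^sup>-\<^sup>1 x)\<close>, and the measure of a ball is supplied by
\<open>emeasure_group_ball\<close>.\<close>

lemma ahlfors_quasimetric_group:
  assumes hom: "homogeneous_norm V m mul \<rho>"
  obtains c\<^sub>0 c\<^sub>1 where
    "ahlfors_quasimetric (\<lambda>x y. \<rho> (mul (- y) x)) c\<^sub>0 c\<^sub>1 (homogeneous_dimension V m)"
proof -
  obtain c\<^sub>0 where c\<^sub>0: "1 \<le> c\<^sub>0" "\<And>x y. \<rho> (mul x y) \<le> c\<^sub>0 * (\<rho> x + \<rho> y)"
    using hom unfolding homogeneous_norm_def by blast
  define d where "d = (\<lambda>x y. \<rho> (mul (- y) x))"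
  have ball: "{y. d x y < r} = group_ball mul \<rho> x r" for x r
    by (simp add: d_def group_ball_def)
  have "ahlfors_quasimetric d c\<^sub>0 (measure lebesgue {x. \<rho> x < 1}) (homogeneous_dimension V m)"
  proof
    fix x y z :: 'a and r :: real
    show "0 \<le> d x y" using norm_nonneg[OF hom] by (simp add: d_def)
    show "d x y = d y x"
      using norm_neg[OF hom, of "mul (- y) x"] by (simp add: d_def G.inverse_distrib_swap)
    have "mul (- y) x = 0 \<longleftrightarrow> x = y"
      using G.left_cancel[of "- y" x y] by simp
    then show "d x y = 0 \<longleftrightarrow> x = y"
      using norm_zero_iff[OF hom] by (simp add: d_def)
    have "mul (- z) x = mul (mul (- z) y) (mul (- y) x)"
      by (metis G.assoc G.left_neutral G.right_inverse)
    then show "d x z \<le> c\<^sub>0 * (d x y + d y z)"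
      using c\<^sub>0(2)[of "mul (- z) y" "mul (- y) x"] by (simp add: d_def add.commute)
    show "1 \<le> c\<^sub>0" by (rule c\<^sub>0)
    show "0 < measure lebesgue {x. \<rho> x < 1}" by (rule measure_norm_ball_pos[OF hom])
    show "0 < homogeneous_dimension V m" by (rule homogeneous_dimension_pos)
    show "continuous_on UNIV (d x)"
      unfolding d_def
      by (rule continuous_on_compose2[OF norm_continuous[OF hom]])
        (auto intro!: continuous_on_mul continuous_intros)
    show "bounded {y. d x y < r}"
      unfolding ball group_ball_eq_translate[of \<rho>, OF norm_neg[OF hom]]
      by (intro bounded_left_translate bounded_norm_ball[OF hom])
    show "emeasure lebesgue {y. d x y < r} =
        ennreal (measure lebesgue {x. \<rho> x < 1} * r ^ homogeneous_dimension V m)" if "0 < r"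
      unfolding ball by (rule emeasure_group_ball[OF hom that])
  qed
  then show ?thesis unfolding d_def by (rule that)
qed

end

theorem theorem3p8:
  fixes brk mul :: "'a::euclidean_space \<Rightarrow> 'a \<Rightarrow> 'a"
    and V :: "nat \<Rightarrow> 'a set" and m :: nat
    and \<rho> :: "'a \<Rightarrow> real" and Q :: nat and \<beta> :: real
    and b :: "'a \<Rightarrow> real" and \<Phi> \<Psi> :: "real \<Rightarrow> ennreal"
  assumes "stratified_group brk V m mul"
    and "homogeneous_norm V m mul \<rho>"
    and "Q = homogeneous_dimension V m"
    and "0 < \<beta>" and "\<beta> < 1"
    and "locally_integrable b"
    and "young_function \<Phi>" and "young_function \<Psi>"
    and "\<Phi> \<in> young_class_Y"
  shows
    "(nabla2 \<Phi> \<and>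
      (\<exists>C>0. \<forall>t>0. t powr (- \<beta> / real Q) * young_inverse \<Phi> t \<le> C * young_inverse \<Psi> t) \<longrightarrow>
        (b \<in> lipschitz_space mul \<rho> \<beta> \<longrightarrow> orlicz_bounded \<Phi> \<Psi> (maximal_commutator mul \<rho> b)))
     \<and>
     ((\<exists>C>0. \<forall>t>0. young_inverse \<Psi> t \<le> C * young_inverse \<Phi> t * t powr (- \<beta> / real Q)) \<longrightarrow>
        (orlicz_bounded \<Phi> \<Psi> (maximal_commutator mul \<rho> b) \<longrightarrow> b \<in> lipschitz_space mul \<rho> \<beta>))
     \<and>
     (nabla2 \<Phi> \<and>
      (\<exists>C>0. \<forall>t>0. young_inverse \<Psi> t \<le> C * (young_inverse \<Phi> t * t powr (- \<beta> / real Q))) \<and>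
      (\<exists>C>0. \<forall>t>0. young_inverse \<Phi> t * t powr (- \<beta> / real Q) \<le> C * young_inverse \<Psi> t) \<longrightarrow>
        (b \<in> lipschitz_space mul \<rho> \<beta> \<longleftrightarrow> orlicz_bounded \<Phi> \<Psi> (maximal_commutator mul \<rho> b)))"
proof -
  interpret stratified_group brk V m mul by fact
  obtain c\<^sub>0 c\<^sub>1 where "ahlfors_quasimetric (\<lambda>x y. \<rho> (mul (- y) x)) c\<^sub>0 c\<^sub>1 (homogeneous_dimension V m)"
    using ahlfors_quasimetric_group[OF assms(2)] by blast
  then interpret ahlfors_quasimetric "\<lambda>x y. \<rho> (mul (- y) x)" c\<^sub>0 c\<^sub>1 Q
    unfolding \<open>Q = homogeneous_dimension V m\<close> .
  have comm: "maximal_commutator mul \<rho> b = maximal_comm b"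
    by (simp add: fun_eq_iff maximal_commutator_def maximal_comm_def group_ball_def qball_def)
  have Y: "young_Y \<Phi>" and \<Psi>: "young \<Psi>"
    using assms by (auto simp: young_Y_def young_Y_axioms_def young_def)
  have sufficient: "orlicz_bounded \<Phi> \<Psi> (maximal_commutator mul \<rho> b)"
    if "nabla2 \<Phi>" "C > 0" "\<And>t. t > 0 \<Longrightarrow> t powr (- \<beta> / real Q) * young_inverse \<Phi> t \<le> C * young_inverse \<Psi> t"
      "b \<in> lipschitz_space mul \<rho> \<beta>" for C
  proof -
    from that(4) obtain g L where "AE x in lebesgue. b x = g x"
      "\<And>x y. \<bar>g x - g y\<bar> \<le> L * \<rho> (mul (- y) x) powr \<beta>"
      unfolding lipschitz_space_def by blast
    then show ?thesis
      unfolding comm using that(1-3) \<open>0 < \<beta>\<close>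
      by (intro maximal_commutator_bounded[OF Y \<Psi>, of \<beta> C b g L]) auto
  qed
  have necessary: "b \<in> lipschitz_space mul \<rho> \<beta>"
    if "C > 0" "\<And>t. t > 0 \<Longrightarrow> young_inverse \<Psi> t \<le> C * young_inverse \<Phi> t * t powr (- \<beta> / real Q)"
      "orlicz_bounded \<Phi> \<Psi> (maximal_commutator mul \<rho> b)" for C
    using lipschitz_of_bounded[OF Y \<Psi> \<open>locally_integrable b\<close> \<open>0 < \<beta>\<close> that(2,1)] that(3)
    unfolding comm lipschitz_space_def by blast
  show ?thesis
  proof (intro conjI impI)
    assume *: "nabla2 \<Phi> \<and>
      (\<exists>C>0. \<forall>t>0. t powr (- \<beta> / real Q) * young_inverse \<Phi> t \<le> C * young_inverse \<Psi> t)"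
      "b \<in> lipschitz_space mul \<rho> \<beta>"
    then show "orlicz_bounded \<Phi> \<Psi> (maximal_commutator mul \<rho> b)"
      using sufficient by blast
  next
    assume "\<exists>C>0. \<forall>t>0. young_inverse \<Psi> t \<le> C * young_inverse \<Phi> t * t powr (- \<beta> / real Q)"
      "orlicz_bounded \<Phi> \<Psi> (maximal_commutator mul \<rho> b)"
    then show "b \<in> lipschitz_space mul \<rho> \<beta>"
      using necessary by blast
  next
    assume *: "nabla2 \<Phi> \<and>
      (\<exists>C>0. \<forall>t>0. young_inverse \<Psi> t \<le> C * (young_inverse \<Phi> t * t powr (- \<beta> / real Q))) \<and>
      (\<exists>C>0. \<forall>t>0. young_inverse \<Phi> t * t powr (- \<beta> / real Q) \<le> C * young_inverse \<Psi> t)"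
    show "b \<in> lipschitz_space mul \<rho> \<beta> \<longleftrightarrow> orlicz_bounded \<Phi> \<Psi> (maximal_commutator mul \<rho> b)"
    proof
      assume "b \<in> lipschitz_space mul \<rho> \<beta>"
      then show "orlicz_bounded \<Phi> \<Psi> (maximal_commutator mul \<rho> b)"
        using * sufficient by (metis mult.commute)
    next
      assume "orlicz_bounded \<Phi> \<Psi> (maximal_commutator mul \<rho> b)"
      then show "b \<in> lipschitz_space mul \<rho> \<beta>"
        using * necessary by (metis mult.assoc)
    qed
  qed
qed

end
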